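(* Let $p$ be an odd prime. For any $n\ge 1$, $(H^*B\mathbb{V}_n)^{GL_n}$, considered as an $\mathbb{F}_p$-vector space, has a basis consisting of all elements $$q^I=R_{n;0}^{\epsilon_1}q_{n,0}^{i_1}\cdots R_{n;n-1}^{\epsilon_n}q_{n,n-1}^{i_n}$$ for $i_1\in\mathbb{Z}$, $i_s\ge 0$ for $2\le s\le n$, $\epsilon_s\in\{0,1\}$ and $i_1-m(I)+b(I)\ge 0$.
   Context: $\mathbb{V}_n=(\mathbb{Z}/p)^n$; $H^*B\mathbb{V}_n=E(e_1,\dots,e_n)\otimes\mathbb{F}_p[x_1,\dots,x_n]$ (mod $p$ cohomology), $|e_i|=1$, $x_i=\beta e_i$, $|x_i|=2$. $GL_n=GL_n(\mathbb{F}_p)$ acts by algebra automorphisms with $(a_{ij})x_s=\sum_ia_{is}x_i$, $(a_{ij})e_s=\sum_ia_{is}e_i$, and $(-)^{GL_n}$ denotes invariants. Put $[r_1,\dots,r_n]=\det(x_i^{p^{r_j}})$, $L_{n,i}=[0,\dots,\hat i,\dots,n]$ (omit $i$), $L_n=L_{n,n}$, $q_{n,i}=L_{n,i}/L_n$ ($0\le i\le n-1$). For $0\le s_1<\cdots<s_k\le n-1$ let $M_{n;s_1,\dots,s_k}=\frac1{k!}\det$ of the $n\times n$ matrix whose first $k$ rows are all $(e_1,\dots,e_n)$ and whose remaining rows are $(x_1^{p^r},\dots,x_n^{p^r})$ for $r\in\{0,\dots,n-1\}\setminus\{s_1,\dots,s_k\}$ in increasing order (determinant expanded as $\sum_\pi\mathrm{sgn}(\pi)a_{1\pi(1)}\cdots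 a_{n\pi(n)}$), and $R_{n;s_1,\dots,s_k}=M_{n;s_1,\dots,s_k}L_n^{p-2}$. For $I=(\epsilon_1,i_1,\dots,\epsilon_n,i_n)$: $b(I)=\sum_s\epsilon_s$, $m(I)=\max_s\epsilon_s$. If $i_1<0$ the product $q^I$ is interpreted in the localization inverting $q_{n,0}$, using $R_{n;s_1}\cdots R_{n;s_k}=(-1)^{k(k-1)/2}R_{n;s_1,\dots,s_k}q_{n,0}^{k-1}$; under the condition $i_1-m(I)+b(I)\ge 0$ it lies in $H^*B\mathbb{V}_n$. *)

theory Defs
  imports
    "HOL-Library.Poly_Mapping"
    "HOL-Computational_Algebra.Polynomial_Factorial"
    "HOL-Combinatorics.Permutations"
    "Jordan_Normal_Form.Determinant"
    "Berlekamp_Zassenhaus.Finite_Field"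
begin

section \<open>Exterior algebras\<close>

text \<open>
  \<open>'a ext\<close> is the exterior algebra over the commutative ring \<open>'a\<close> on generators
  \<open>e\<^sub>0, e\<^sub>1, e\<^sub>2, \<dots>\<close>. An element is given by its coordinates with respect to the basis
  \<open>e\<^sub>S = e\<^bsub>s\<^sub>1\<^esub> \<cdots> e\<^bsub>s\<^sub>k\<^esub>\<close>, where \<open>S = {s\<^sub>1 < \<dots> < s\<^sub>k}\<close> is a finite set.
\<close>

typedef (overloaded) 'a ext =
  "{f :: nat set \<Rightarrow> 'a::zero. finite {S. f S \<noteq> 0} \<and> (\<forall>S. f S \<noteq> 0 \<longrightarrow> finite S)}"
  morphisms ecoeff Abs_ext
  by (rule exI[of _ "\<lambda>_. 0"]) simp

setup_lifting type_definition_ext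

text \<open>For disjoint \<open>S\<close>, \<open>T\<close> one has \<open>e\<^sub>S e\<^sub>T = koszul S T \<cdot> e\<^bsub>S \<union> T\<^esub>\<close>.\<close>

definition koszul :: "nat set \<Rightarrow> nat set \<Rightarrow> 'a::comm_ring_1"
  where "koszul S T = (-1) ^ card {(s, t). s \<in> S \<and> t \<in> T \<and> t < s}"

lemma koszul_empty [simp]: "koszul {} T = 1" "koszul S {} = 1"
  by (simp_all add: koszul_def)

lemma koszul_Un_left:
  assumes "finite S" "finite T" "finite U" "S \<inter> T = {}"
  shows "koszul (S \<union> T) U = koszul S U * koszul T U"
proof -
  have "{(s, t). s \<in> S \<union> T \<and> t \<in> U \<and> t < s} =
      {(s, t). s \<in> S \<and> t \<in> U \<and> t < s} \<union> {(s, t). s \<in> T \<and> t \<in> U \<and> t < s}"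
    by auto
  moreover have "finite {(s, t). s \<in> S \<and> t \<in> U \<and> t < s}"
    by (rule finite_subset[of _ "S \<times> U"]) (use assms in auto)
  moreover have "finite {(s, t). s \<in> T \<and> t \<in> U \<and> t < s}"
    by (rule finite_subset[of _ "T \<times> U"]) (use assms in auto)
  moreover have "{(s, t). s \<in> S \<and> t \<in> U \<and> t < s} \<inter> {(s, t). s \<in> T \<and> t \<in> U \<and> t < s} = {}"
    using assms(4) by auto
  ultimately show ?thesis
    by (simp add: koszul_def card_Un_disjoint power_add)
qed

lemma koszul_Un_right:
  assumes "finite S" "finite T" "finite U" "T \<inter> U = {}"
  shows "koszul S (T \<union> U) = koszul S T * koszul S U"
proof -
  have "{(s, t). s \<in> S \<and> t \<in> T \<union> U \<and> t < s} =
      {(s, t). s \<in> S \<and> t \<in> T \<and> t < s} \<union> {(s, t). s \<in> S \<and> t \<in> U \<and> t < s}"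
    by auto
  moreover have "finite {(s, t). s \<in> S \<and> t \<in> T \<and> t < s}"
    by (rule finite_subset[of _ "S \<times> T"]) (use assms in auto)
  moreover have "finite {(s, t). s \<in> S \<and> t \<in> U \<and> t < s}"
    by (rule finite_subset[of _ "S \<times> U"]) (use assms in auto)
  moreover have "{(s, t). s \<in> S \<and> t \<in> T \<and> t < s} \<inter> {(s, t). s \<in> S \<and> t \<in> U \<and> t < s} = {}"
    using assms(4) by auto
  ultimately show ?thesis
    by (simp add: koszul_def card_Un_disjoint power_add)
qed

lemma finite_supp_mult:
  fixes f g :: "nat set \<Rightarrow> 'a::comm_ring_1"
  assumes "finite {S. f S \<noteq> 0}" "finite {S. g S \<noteq> 0}"
  shows "finite {U. (\<Sum>S\<in>Pow U. koszul S (U - S) * f S * g (U - S)) \<noteq> 0}"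
proof (rule finite_subset)
  show "finite ((\<lambda>(S, T). S \<union> T) ` ({S. f S \<noteq> 0} \<times> {S. g S \<noteq> 0}))"
    using assms by simp
  show "{U. (\<Sum>S\<in>Pow U. koszul S (U - S) * f S * g (U - S)) \<noteq> 0} \<subseteq>
      (\<lambda>(S, T). S \<union> T) ` ({S. f S \<noteq> 0} \<times> {S. g S \<noteq> 0})"
  proof
    fix U
    assume "U \<in> {U. (\<Sum>S\<in>Pow U. koszul S (U - S) * f S * g (U - S)) \<noteq> 0}"
    then obtain S where "S \<in> Pow U" "koszul S (U - S) * f S * g (U - S) \<noteq> 0"
      by (metis (mono_tags, lifting) mem_Collect_eq sum.neutral)
    then have "S \<subseteq> U" "f S \<noteq> 0" "g (U - S) \<noteq> 0"
      by auto
    then have "(S, U - S) \<in> {S. f S \<noteq> 0} \<times> {S. g S \<noteq> 0}" "U = (\<lambda>(S, T). S \<union> T) (S, U - S)"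
      by auto
    then show "U \<in> (\<lambda>(S, T). S \<union> T) ` ({S. f S \<noteq> 0} \<times> {S. g S \<noteq> 0})"
      by (rule rev_image_eqI)
  qed
qed

instantiation ext :: (comm_ring_1) ring_1
begin

lift_definition zero_ext :: "'a ext" is "\<lambda>_. 0" by simp

lift_definition one_ext :: "'a ext" is "\<lambda>S. if S = {} then 1 else 0" by simp

lift_definition plus_ext :: "'a ext \<Rightarrow> 'a ext \<Rightarrow> 'a ext" is "\<lambda>f g S. f S + g S"
proof -
  fix f g :: "nat set \<Rightarrow> 'a"
  assume "finite {S. f S \<noteq> 0} \<and> (\<forall>S. f S \<noteq> 0 \<longrightarrow> finite S)"
    "finite {S. g S \<noteq> 0} \<and> (\<forall>S. g S \<noteq> 0 \<longrightarrow> finite S)"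
  moreover have "{S. f S + g S \<noteq> 0} \<subseteq> {S. f S \<noteq> 0} \<union> {S. g S \<noteq> 0}" by auto
  ultimately show "finite {S. f S + g S \<noteq> 0} \<and> (\<forall>S. f S + g S \<noteq> 0 \<longrightarrow> finite S)"
    by (metis (no_types, lifting) add.right_neutral finite_Un finite_subset)
qed

lift_definition uminus_ext :: "'a ext \<Rightarrow> 'a ext" is "\<lambda>f S. - f S" by simp

lift_definition minus_ext :: "'a ext \<Rightarrow> 'a ext \<Rightarrow> 'a ext" is "\<lambda>f g S. f S - g S"
proof -
  fix f g :: "nat set \<Rightarrow> 'a"
  assume "finite {S. f S \<noteq> 0} \<and> (\<forall>S. f S \<noteq> 0 \<longrightarrow> finite S)"
    "finite {S. g S \<noteq> 0} \<and> (\<forall>S. g S \<noteq> 0 \<longrightarrow> finite S)"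
  moreover have "{S. f S - g S \<noteq> 0} \<subseteq> {S. f S \<noteq> 0} \<union> {S. g S \<noteq> 0}" by auto
  ultimately show "finite {S. f S - g S \<noteq> 0} \<and> (\<forall>S. f S - g S \<noteq> 0 \<longrightarrow> finite S)"
    by (metis (no_types, lifting) diff_0_right finite_Un finite_subset)
qed

lift_definition times_ext :: "'a ext \<Rightarrow> 'a ext \<Rightarrow> 'a ext"
  is "\<lambda>f g U. \<Sum>S\<in>Pow U. koszul S (U - S) * f S * g (U - S)"
proof (intro conjI allI impI)
  fix f g :: "nat set \<Rightarrow> 'a" and U
  assume "finite {S. f S \<noteq> 0} \<and> (\<forall>S. f S \<noteq> 0 \<longrightarrow> finite S)"
    "finite {S. g S \<noteq> 0} \<and> (\<forall>S. g S \<noteq> 0 \<longrightarrow> finite S)"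
  then show "finite {U. (\<Sum>S\<in>Pow U. koszul S (U - S) * f S * g (U - S)) \<noteq> 0}"
    by (intro finite_supp_mult) auto
  assume "(\<Sum>S\<in>Pow U. koszul S (U - S) * f S * g (U - S)) \<noteq> 0"
  then show "finite U"
    by (metis finite_Pow_iff sum.infinite)
qed

instance
proof
  fix a b c :: "'a ext"
  show "a + b + c = a + (b + c)" by transfer (simp add: add.assoc)
  show "a + b = b + a" by transfer (simp add: add.commute)
  show "0 + a = a" by transfer simp
  show "- a + a = 0" by transfer simp
  show "a - b = a + - b" by transfer simp
  show "(0 :: 'a ext) \<noteq> 1"
  proof
    assume "(0 :: 'a ext) = 1"
    then have "ecoeff (0 :: 'a ext) {} = ecoeff 1 {}" by simp
    then show False by transfer simp
  qed
  show "(a + b) * c = a * c + b * c"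
    by transfer (simp add: algebra_simps sum.distrib)
  show "a * (b + c) = a * b + a * c"
    by transfer (simp add: algebra_simps sum.distrib)
  show "1 * a = a"
  proof transfer
    fix f :: "nat set \<Rightarrow> 'a"
    assume f: "finite {S. f S \<noteq> 0} \<and> (\<forall>S. f S \<noteq> 0 \<longrightarrow> finite S)"
    show "(\<lambda>U. \<Sum>S\<in>Pow U. koszul S (U - S) * (if S = {} then 1 else 0) * f (U - S)) = f"
    proof
      fix U
      show "(\<Sum>S\<in>Pow U. koszul S (U - S) * (if S = {} then 1 else 0) * f (U - S)) = f U"
      proof (cases "finite U")
        case True
        have "(\<Sum>S\<in>Pow U. koszul S (U - S) * (if S = {} then 1 else 0) * f (U - S)) =
            (\<Sum>S\<in>Pow U. if S = {} then f U else 0)"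
          by (rule sum.cong) auto
        then show ?thesis using True by simp
      next
        case False
        moreover have "f U = 0" using False f by blast
        ultimately show ?thesis by simp
      qed
    qed
  qed
  show "a * 1 = a"
  proof transfer
    fix f :: "nat set \<Rightarrow> 'a"
    assume f: "finite {S. f S \<noteq> 0} \<and> (\<forall>S. f S \<noteq> 0 \<longrightarrow> finite S)"
    show "(\<lambda>U. \<Sum>S\<in>Pow U. koszul S (U - S) * f S * (if U - S = {} then 1 else 0)) = f"
    proof
      fix U
      show "(\<Sum>S\<in>Pow U. koszul S (U - S) * f S * (if U - S = {} then 1 else 0)) = f U"
      proof (cases "finite U")
        case True
        have "(\<Sum>S\<in>Pow U. koszul S (U - S) * f S * (if U - S = {} then 1 else 0)) =
            (\<Sum>S\<in>Pow U. if S = U then f U else 0)"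
          by (rule sum.cong) auto
        then show ?thesis using True by simp
      next
        case False
        moreover have "f U = 0" using False f by blast
        ultimately show ?thesis by simp
      qed
    qed
  qed
  show "a * b * c = a * (b * c)"
  proof (transfer, rule ext)
    fix f g h :: "nat set \<Rightarrow> 'a" and U :: "nat set"
    show "(\<Sum>V\<in>Pow U. koszul V (U - V) * (\<Sum>S\<in>Pow V. koszul S (V - S) * f S * g (V - S)) * h (U - V)) =
      (\<Sum>S\<in>Pow U. koszul S (U - S) * f S *
         (\<Sum>T\<in>Pow (U - S). koszul T (U - S - T) * g T * h (U - S - T)))"
      (is "?L = ?R")
    proof (cases "finite U")
      case False
      then show ?thesis by (simp add: sum.infinite)
    next
      case True
      have fin: "finite A" if "A \<subseteq> U" for A
        using True that finite_subset by blast
      have "?L = (\<Sum>V\<in>Pow U. \<Sum>S\<in>Pow V.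
          koszul V (U - V) * koszul S (V - S) * f S * g (V - S) * h (U - V))"
        by (simp add: sum_distrib_left sum_distrib_right mult.assoc)
      also have "\<dots> = (\<Sum>(V, S)\<in>Sigma (Pow U) Pow.
          koszul V (U - V) * koszul S (V - S) * f S * g (V - S) * h (U - V))"
        by (rule sum.Sigma) (use fin True in auto)
      also have "\<dots> = (\<Sum>(S, T)\<in>Sigma (Pow U) (\<lambda>S. Pow (U - S)).
          koszul S (U - S) * koszul T (U - S - T) * f S * g T * h (U - S - T))"
      proof (rule sum.reindex_bij_witness[where i = "\<lambda>(S, T). (S \<union> T, S)" and j = "\<lambda>(V, S). (S, V - S)"])
        fix x
        assume "x \<in> Sigma (Pow U) Pow"
        then obtain V S where x: "x = (V, S)" "S \<subseteq> V" "V \<subseteq> U" by auto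
        define T W where "T = V - S" and "W = U - V"
        have eqs: "V - S = T" "U - V = W" "V = S \<union> T" "U - S = T \<union> W" "U - S - T = W"
          and dis: "S \<inter> T = {}" "T \<inter> W = {}" "S \<inter> W = {}"
          using x by (auto simp: T_def W_def)
        have fins: "finite S" "finite T" "finite W"
          using fin[of S] fin[of T] fin[of W] x by (auto simp: T_def W_def)
        have "koszul (S \<union> T) W * koszul S T = koszul S (T \<union> W) * (koszul T W :: 'a)"
          using fins dis by (simp add: koszul_Un_left koszul_Un_right mult.commute mult.left_commute)
        then show "(case case x of (V, S) \<Rightarrow> (S, V - S) of (S, T) \<Rightarrow>
            koszul S (U - S) * koszul T (U - S - T) * f S * g T * h (U - S - T)) =
          (case x of (V, S) \<Rightarrow> koszul V (U - V) * koszul S (V - S) * f S * g (V - S) * h (U - V))"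
          using eqs x(1) by simp
      qed auto
      also have "\<dots> = (\<Sum>S\<in>Pow U. \<Sum>T\<in>Pow (U - S).
          koszul S (U - S) * koszul T (U - S - T) * f S * g T * h (U - S - T))"
        by (rule sum.Sigma[symmetric]) (use fin True in auto)
      also have "\<dots> = ?R"
        by (simp add: sum_distrib_left sum_distrib_right mult_ac)
      finally show ?thesis .
    qed
  qed
qed

end

lift_definition ext_gen :: "nat \<Rightarrow> 'a::comm_ring_1 ext" is "\<lambda>i S. if S = {i} then 1 else 0"
  by simp

lift_definition ext_const :: "'a::comm_ring_1 \<Rightarrow> 'a ext" is "\<lambda>c S. if S = {} then c else 0"
  by simp

lemma ecoeff_gen_mult_gen:
  "ecoeff (ext_gen i * ext_gen j) U = (if i \<noteq> j \<and> U = {i, j} then koszul {i} {j} else 0)"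
proof (transfer fixing: i j U)
  show "(\<Sum>S\<in>Pow U. koszul S (U - S) * (if S = {i} then 1 else 0) * (if U - S = {j} then 1 else 0)) =
    (if i \<noteq> j \<and> U = {i, j} then koszul {i} {j} else (0 :: 'a))" (is "?L = ?R")
  proof (cases "finite U")
    case True
    have "?L = (\<Sum>S\<in>Pow U. if S = {i} then
        (if U - {i} = {j} then koszul {i} {j} else 0) else 0)"
      by (rule sum.cong) auto
    also have "\<dots> = ?R"
      using True by (auto simp: sum.delta)
    finally show ?thesis .
  qed auto
qed

lemma ext_gen_square: "ext_gen i * ext_gen i = 0"
  by (simp add: ecoeff_inject[symmetric] fun_eq_iff ecoeff_gen_mult_gen zero_ext.rep_eq)

lemma ext_gen_anticommute: "ext_gen i * ext_gen j = - (ext_gen j * ext_gen i)"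
proof -
  have "{(s, t). s = a \<and> t = b \<and> t < s} = (if b < a then {(a, b)} else {})" for a b :: nat
    by auto
  then have "koszul {a} {b} = (if b < a then -1 else 1 :: 'a)" for a b
    by (simp add: koszul_def)
  then show ?thesis
    by (auto simp: ecoeff_inject[symmetric] fun_eq_iff ecoeff_gen_mult_gen uminus_ext.rep_eq)
qed

lemma ecoeff_const_mult: "ecoeff (ext_const c * h) S = c * ecoeff h S"
proof transfer
  fix c :: 'a and h :: "nat set \<Rightarrow> 'a" and U
  assume h: "finite {S. h S \<noteq> 0} \<and> (\<forall>S. h S \<noteq> 0 \<longrightarrow> finite S)"
  show "(\<Sum>S\<in>Pow U. koszul S (U - S) * (if S = {} then c else 0) * h (U - S)) = c * h U"
  proof (cases "finite U")
    case True
    have "(\<Sum>S\<in>Pow U. koszul S (U - S) * (if S = {} then c else 0) * h (U - S)) =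
        (\<Sum>S\<in>Pow U. if S = {} then c * h U else 0)"
      by (rule sum.cong) auto
    then show ?thesis using True by simp
  next
    case False
    moreover have "h U = 0" using False h by blast
    ultimately show ?thesis by simp
  qed
qed


section \<open>The cohomology ring and its localization\<close>

text \<open>
  \<open>'p mod_ring\<close> is the field \<open>\<int>/p\<close> for \<open>p = CARD('p)\<close> prime, and \<open>'p fp_poly\<close> is the
  polynomial ring over it in variables \<open>x\<^sub>0, x\<^sub>1, \<dots>\<close>. Since the \<open>x\<^sub>i\<close> have even degree, the graded
  tensor product of an exterior algebra with a polynomial ring is the exterior algebra over that
  polynomial ring. All indices are shifted by one: \<open>e\<^sub>1, \<dots>, e\<^sub>n\<close> and \<open>x\<^sub>1, \<dots>, x\<^sub>n\<close> are the
  generators with index in \<open>{..<n}\<close>.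
\<close>

type_synonym 'p fp_poly = "(nat \<Rightarrow>\<^sub>0 nat) \<Rightarrow>\<^sub>0 'p mod_ring"

definition poly_const :: "'p::prime_card mod_ring \<Rightarrow> 'p fp_poly"
  where "poly_const c = Poly_Mapping.single 0 c"

definition poly_var :: "nat \<Rightarrow> 'p::prime_card fp_poly"
  where "poly_var i = Poly_Mapping.single (Poly_Mapping.single i 1) 1"

definition cohomology :: "nat \<Rightarrow> 'p::prime_card fp_poly ext set"
  where "cohomology n =
    {h. \<forall>S. ecoeff h S \<noteq> 0 \<longrightarrow>
         S \<subseteq> {..<n} \<and> (\<forall>m \<in> Poly_Mapping.keys (ecoeff h S). Poly_Mapping.keys m \<subseteq> {..<n})}"

text \<open>
  \<open>H\<^sup>*BV\<^sub>n\<close> is free over its polynomial part, so its localization at the nonzero polynomial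
  \<open>q\<^bsub>n,0\<^esub>\<close> embeds into the exterior algebra over the field of fractions. Computations in the
  localization are carried out there; \<open>to_loc\<close> is the embedding of unlocalized elements.
\<close>

lift_definition to_loc :: "'a::idom ext \<Rightarrow> 'a fract ext" is "\<lambda>f S. to_fract (f S)"
  by simp

lemma inj_to_loc: "inj to_loc"
  by (rule injI) (simp add: ecoeff_inject[symmetric] to_loc.rep_eq fun_eq_iff)

definition fp_scale :: "'p::prime_card mod_ring \<Rightarrow> 'p fp_poly fract ext \<Rightarrow> 'p fp_poly fract ext"
  where "fp_scale c h = ext_const (to_fract (poly_const c)) * h"

lemma poly_const_add: "poly_const (c + d) = poly_const c + poly_const d"
  by (simp add: poly_const_def single_add)

lemma poly_const_mult: "poly_const (c * d) = poly_const c * poly_const d"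
  by (simp add: poly_const_def mult_single)

lemma poly_const_1: "poly_const 1 = 1"
  by (simp add: poly_const_def)

global_interpretation Fp: vector_space "fp_scale :: 'p::prime_card mod_ring \<Rightarrow> _"
proof
  fix c d :: "'p mod_ring" and g h :: "'p fp_poly fract ext"
  show "fp_scale c (g + h) = fp_scale c g + fp_scale c h"
    by (simp add: fp_scale_def distrib_left)
  show "fp_scale (c + d) h = fp_scale c h + fp_scale d h"
    by (simp add: fp_scale_def ecoeff_inject[symmetric] fun_eq_iff ecoeff_const_mult
        plus_ext.rep_eq poly_const_add distrib_right)
  show "fp_scale c (fp_scale d h) = fp_scale (c * d) h"
    by (simp add: fp_scale_def ecoeff_inject[symmetric] fun_eq_iff ecoeff_const_mult
        poly_const_mult mult.assoc)
  show "fp_scale 1 h = h"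
    by (simp add: fp_scale_def ecoeff_inject[symmetric] fun_eq_iff ecoeff_const_mult poly_const_1)
qed


section \<open>The action of the general linear group\<close>

definition general_linear :: "nat \<Rightarrow> 'p::prime_card mod_ring mat set"
  where "general_linear n = {A \<in> carrier_mat n n. invertible_mat A}"

definition act_var :: "nat \<Rightarrow> 'p::prime_card mod_ring mat \<Rightarrow> nat \<Rightarrow> 'p fp_poly"
  where "act_var n A s = (\<Sum>i<n. poly_const (A $$ (i, s)) * poly_var i)"

definition act_gen :: "nat \<Rightarrow> 'p::prime_card mod_ring mat \<Rightarrow> nat \<Rightarrow> 'p fp_poly ext"
  where "act_gen n A s = (\<Sum>i<n. ext_const (poly_const (A $$ (i, s))) * ext_gen i)"

definition act_poly :: "nat \<Rightarrow> 'p::prime_card mod_ring mat \<Rightarrow> 'p fp_poly \<Rightarrow> 'p fp_poly"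
  where "act_poly n A f =
    (\<Sum>m \<in> Poly_Mapping.keys f. poly_const (Poly_Mapping.lookup f m) *
       (\<Prod>s \<in> Poly_Mapping.keys m. act_var n A s ^ Poly_Mapping.lookup m s))"

text \<open>
  The algebra endomorphism with \<open>x\<^sub>s \<mapsto> act_var n A s\<close> and \<open>e\<^sub>s \<mapsto> act_gen n A s\<close>, evaluated on
  \<open>h = \<Sum>\<^sub>S h\<^sub>S e\<^sub>S\<close>.
\<close>

definition act :: "nat \<Rightarrow> 'p::prime_card mod_ring mat \<Rightarrow> 'p fp_poly ext \<Rightarrow> 'p fp_poly ext"
  where "act n A h =
    (\<Sum>S | ecoeff h S \<noteq> 0. ext_const (act_poly n A (ecoeff h S)) *
       prod_list (map (act_gen n A) (sorted_list_of_set S)))"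

lemma act_poly_var: "act_poly n A (poly_var s) = act_var n A s"
  by (simp add: act_poly_def poly_var_def poly_const_1)

lemma act_poly_1: "act_poly n A 1 = 1"
  by (simp add: act_poly_def poly_const_1 flip: single_one)

lemma ext_const_1: "ext_const 1 = 1"
  by (simp add: ecoeff_inject[symmetric] fun_eq_iff ext_const.rep_eq one_ext.rep_eq)

lemma act_ext_const_var: "act n A (ext_const (poly_var s)) = ext_const (act_var n A s)"
proof -
  have "poly_var s \<noteq> (0 :: 'a fp_poly)"
    unfolding poly_var_def by (metis lookup_single_eq lookup_zero zero_neq_one)
  then have "{S. ecoeff (ext_const (poly_var s :: 'a fp_poly)) S \<noteq> 0} = {{}}"
    by (auto simp: ext_const.rep_eq)
  then show ?thesis
    by (simp add: act_def ext_const.rep_eq act_poly_var)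
qed

lemma act_ext_gen: "act n A (ext_gen s) = act_gen n A s"
proof -
  have "{S. ecoeff (ext_gen s :: 'a fp_poly ext) S \<noteq> 0} = {{s}}"
    by (auto simp: ext_gen.rep_eq)
  then show ?thesis
    by (simp add: act_def ext_gen.rep_eq act_poly_1 ext_const_1)
qed

definition invariants :: "nat \<Rightarrow> 'p::prime_card fp_poly ext set"
  where "invariants n = {h \<in> cohomology n. \<forall>A \<in> general_linear n. act n A h = h}"


section \<open>Dickson and Mui invariants\<close>

text \<open>The determinant \<open>[r\<^sub>1, \<dots>, r\<^sub>n] = det (x\<^sub>i^(p^r\<^sub>j))\<close>.\<close>

definition bracket :: "nat list \<Rightarrow> 'p::prime_card fp_poly"
  where "bracket r = det (mat (length r) (length r) (\<lambda>(i, j). poly_var i ^ (CARD('p) ^ (r ! j))))"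

definition dickson_L :: "nat \<Rightarrow> nat \<Rightarrow> 'p::prime_card fp_poly"
  where "dickson_L n i = bracket (filter (\<lambda>r. r \<noteq> i) [0..<Suc n])"

definition dickson_q :: "nat \<Rightarrow> nat \<Rightarrow> 'p::prime_card fp_poly fract"
  where "dickson_q n i = to_fract (dickson_L n i) / to_fract (dickson_L n n)"

text \<open>
  Determinant over a noncommutative ring, with the factors of each term ordered by rows.
\<close>

definition row_det :: "nat \<Rightarrow> (nat \<Rightarrow> nat \<Rightarrow> 'a::ring_1) \<Rightarrow> 'a"
  where "row_det n a =
    (\<Sum>\<pi> | \<pi> permutes {..<n}. of_int (sign \<pi>) * prod_list (map (\<lambda>i. a i (\<pi> i)) [0..<n]))"

text \<open>
  Only \<open>M\<^bsub>n;s\<^esub>\<close> with a single index \<open>s\<close> enters the definition of \<open>q\<^sup>I\<close>, so there is one row of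
  exterior generators and the normalizing factor is \<open>1/1! = 1\<close>.
\<close>

definition mui_M :: "nat \<Rightarrow> nat \<Rightarrow> 'p::prime_card fp_poly ext"
  where "mui_M n s = row_det n (\<lambda>i j.
    if i = 0 then ext_gen j
    else ext_const (poly_var j ^ (CARD('p) ^ (filter (\<lambda>r. r \<noteq> s) [0..<n] ! (i - 1)))))"

definition mui_R :: "nat \<Rightarrow> nat \<Rightarrow> 'p::prime_card fp_poly ext"
  where "mui_R n s = mui_M n s * ext_const (dickson_L n n ^ (CARD('p) - 2))"

text \<open>
  A multi-index \<open>(\<epsilon>\<^sub>1, i\<^sub>1, \<dots>, \<epsilon>\<^sub>n, i\<^sub>n)\<close> is encoded as the list \<open>[(\<epsilon>\<^sub>1, i\<^sub>1), \<dots>, (\<epsilon>\<^sub>n, i\<^sub>n)]\<close>;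
  \<open>eps_sum\<close> and \<open>eps_max\<close> are the functions usually written \<open>b(I)\<close> and \<open>m(I)\<close>.
\<close>

type_synonym multi_index = "(nat \<times> int) list"

definition eps_sum :: "multi_index \<Rightarrow> nat"
  where "eps_sum I = sum_list (map fst I)"

definition eps_max :: "multi_index \<Rightarrow> nat"
  where "eps_max I = Max (set (map fst I))"

definition admissible :: "nat \<Rightarrow> multi_index set"
  where "admissible n = {I. length I = n \<and> (\<forall>s<n. fst (I ! s) \<in> {0, 1}) \<and>
    (\<forall>s. 1 \<le> s \<and> s < n \<longrightarrow> snd (I ! s) \<ge> 0) \<and>
    snd (I ! 0) - int (eps_max I) + int (eps_sum I) \<ge> 0}"

definition q_monomial :: "nat \<Rightarrow> multi_index \<Rightarrow> 'p::prime_card fp_poly fract ext"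
  where "q_monomial n I =
    prod_list (map (\<lambda>s. to_loc (mui_R n s) ^ fst (I ! s) * ext_const (dickson_q n s powi snd (I ! s))) [0..<n])"

end

theory Submission
  imports Defs
begin

text \<open>
  Dickson: in an invariant polynomial \<open>f\<close> only powers \<open>x\<^sub>n\<^sup>a\<close> with \<open>a = 0\<close> or \<open>a \<ge> p - 1\<close> occur,
  and, as \<open>p > 2\<close>, invariance under \<open>x\<^sub>i \<mapsto> x\<^sub>i + x\<^sub>n\<close>
  forces \<open>f\<close> with \<open>x\<^sub>n = 0\<close> to be a \<open>p\<close>-th power \<open>g\<^sup>p\<close>, where \<open>g\<close> is invariant in one variable less.
  Since \<open>q\<^bsub>n,i\<^esub>\<close> restricts to \<open>q\<^bsub>n-1,i-1\<^esub>\<^sup>p\<close>, induction on \<open>n\<close> provides a polynomial in the \<open>q\<^bsub>n,i\<^esub>\<close> with the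
  same restriction as \<open>f\<close>. The difference is divisible by \<open>x\<^sub>n\<^bsup>p-1\<^esup>\<close>, hence by transitivity on the
  linear forms by \<open>L\<^sub>n\<^bsup>p-1\<^esup> = q\<^bsub>n,0\<^esub>\<close>, and one proceeds by induction on the degree.

  Mui: the homomorphism \<open>e\<^sub>j \<mapsto> \<Sum>\<^sub>s (-1)\<^sup>s x\<^sub>j^(p\<^sup>s) e\<^sub>s\<close> over the polynomial ring is injective, turns the
  action of the general linear group into its action on coefficients, and maps \<open>R\<^bsub>n;s\<^esub>\<close> to
  \<open>q\<^bsub>n,0\<^esub> e\<^sub>s\<close>. So \<open>q\<^sup>I\<close> becomes a monomial in the \<open>q\<^bsub>n,i\<^esub>\<close> times some \<open>e\<^sub>S\<close>, with exponent
  \<open>i\<^sub>1 + b(I)\<close> at \<open>q\<^bsub>n,0\<^esub>\<close>, and the claim reduces to: the invariants correspond exactly to the families of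
  Dickson invariants \<open>(f\<^sub>S)\<close> with \<open>q\<^bsub>n,0\<^esub>\<close> dividing \<open>f\<^sub>S\<close> for \<open>S \<noteq> {}\<close>. Divisibility holds as an
  invariant is congruent to a polynomial modulo \<open>(x\<^sub>n, e\<^sub>n)\<close>; conversely, \<open>M\<^bsub>n;s\<^esub>\<close> lies in that ideal and
  \<open>e\<^sub>n\<^sup>2 = 0\<close>, so \<open>L\<^sub>n\<^bsup>k-1\<^esup>\<close> divides every product of \<open>k\<close> of the \<open>M\<^bsub>n;s\<^esub>\<close>.
\<close>

section \<open>Evaluation of polynomials\<close>

text \<open>The degree induction closes only if the polynomial in the q_{n,i} subtracted from
  \<open>f\<close> has degree at most that of \<open>f\<close>. Spans are therefore filtered by
  weight, q_{n,i} having weight p^n - p^i: lifting from n-1 to n multiplies weights by p, and if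
  \<open>f\<close> restricts to g^p, then p times the degree of \<open>g\<close> is at most the
  degree of \<open>f\<close>. The gap below p - 1 in the exponents comes from scaling one variable
  by a unit c, as c^a = 1 for all units forces a = 0 or a >= p - 1. This bound is exactly the power
  of L_n in q_{n,0}. The admissibility condition says i_1 + b(I) >= 0 if all \<epsilon>_s vanish and
  i_1 + b(I) >= 1 otherwise. That is the divisibility by q_{n,0} demanded of f_S for nonempty S, so
  admissible indices correspond bijectively to a set S together with the exponents of a monomial
  allowed in f_S. Invariants M with several indices are never formed. Their role is played by the
  quotient of a product of the M_{n;s} by a power of L_n, identified by its image under the
  injective homomorphism.\<close>

definition monomial_eval :: "(nat \<Rightarrow> 'b::comm_ring_1) \<Rightarrow> (nat \<Rightarrow>\<^sub>0 nat) \<Rightarrow> 'b"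
  where "monomial_eval \<sigma> m = (\<Prod>s\<in>Poly_Mapping.keys m. \<sigma> s ^ Poly_Mapping.lookup m s)"

text \<open>Coefficients pass through \<open>\<phi>\<close>, so that the target may also be
  \<open>'p fp_poly poly\<close>, where a formal variable records a degree.\<close>

definition psubst :: "('p::prime_card mod_ring \<Rightarrow> 'b::comm_ring_1) \<Rightarrow> (nat \<Rightarrow> 'b) \<Rightarrow> 'p fp_poly \<Rightarrow> 'b"
  where "psubst \<phi> \<sigma> f =
    (\<Sum>m\<in>Poly_Mapping.keys f. \<phi> (Poly_Mapping.lookup f m) * monomial_eval \<sigma> m)"

definition polys :: "nat \<Rightarrow> 'p::prime_card fp_poly set"
  where "polys n = {f. \<forall>m\<in>Poly_Mapping.keys f. Poly_Mapping.keys m \<subseteq> {..<n}}"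

lemma act_poly_eq_psubst: "act_poly n A = psubst poly_const (act_var n A)"
  by (simp add: fun_eq_iff act_poly_def psubst_def monomial_eval_def)

lemma monomial_eval_superset:
  assumes "finite B" "Poly_Mapping.keys m \<subseteq> B"
  shows "monomial_eval \<sigma> m = (\<Prod>s\<in>B. \<sigma> s ^ Poly_Mapping.lookup m s)"
  unfolding monomial_eval_def
  by (rule prod.mono_neutral_left) (use assms in \<open>auto simp: in_keys_iff\<close>)

lemma monomial_eval_0 [simp]: "monomial_eval \<sigma> 0 = 1"
  by (simp add: monomial_eval_def)

lemma monomial_eval_single [simp]: "monomial_eval \<sigma> (Poly_Mapping.single i k) = \<sigma> i ^ k"
  by (simp add: monomial_eval_def)

lemma monomial_eval_add: "monomial_eval \<sigma> (m + m') = monomial_eval \<sigma> m * monomial_eval \<sigma> m'"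
proof -
  let ?B = "Poly_Mapping.keys m \<union> Poly_Mapping.keys m'"
  have "Poly_Mapping.keys (m + m') \<subseteq> ?B"
    by (rule Poly_Mapping.keys_add)
  then show ?thesis
    by (simp add: monomial_eval_superset[of ?B] lookup_add power_add prod.distrib)
qed

lemma sum_single_lookup:
  "(\<Sum>m\<in>Poly_Mapping.keys f. Poly_Mapping.single m (Poly_Mapping.lookup f m)) = f"
  by (rule poly_mapping_eqI)
    (simp add: lookup_sum lookup_single when_def sum.delta' in_keys_iff cong: if_cong)

lemma single_conv_poly_var:
  "Poly_Mapping.single m c = poly_const c * monomial_eval poly_var m"
proof -
  have pow: "poly_var i ^ k = (Poly_Mapping.single (Poly_Mapping.single i k) 1 :: 'a fp_poly)" for i k
    by (induction k) (simp_all add: poly_var_def mult_single flip: single_add)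
  have "monomial_eval poly_var m = (Poly_Mapping.single m 1 :: 'a fp_poly)"
  proof -
    have "(\<Prod>s\<in>B. poly_var s ^ Poly_Mapping.lookup m s) =
        (Poly_Mapping.single (\<Sum>s\<in>B. Poly_Mapping.single s (Poly_Mapping.lookup m s)) 1 :: 'a fp_poly)"
      if "finite B" for B
      using that by (induction B) (simp_all add: pow mult_single)
    then show ?thesis
      by (simp add: monomial_eval_def sum_single_lookup)
  qed
  then show ?thesis by (simp add: poly_const_def mult_single)
qed

context
  fixes \<phi> :: "'p::prime_card mod_ring \<Rightarrow> 'b::comm_ring_1" and \<sigma> :: "nat \<Rightarrow> 'b"
  assumes hom: "comm_ring_hom \<phi>"
begin

interpretation \<phi>: comm_ring_hom \<phi> by (rule hom)

lemma psubst_superset: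
  assumes "finite B" "Poly_Mapping.keys f \<subseteq> B"
  shows "psubst \<phi> \<sigma> f = (\<Sum>m\<in>B. \<phi> (Poly_Mapping.lookup f m) * monomial_eval \<sigma> m)"
  unfolding psubst_def
  by (rule sum.mono_neutral_left) (use assms in \<open>auto simp: in_keys_iff\<close>)

lemma psubst_single: "psubst \<phi> \<sigma> (Poly_Mapping.single m c) = \<phi> c * monomial_eval \<sigma> m"
  by (simp add: psubst_def)

lemma psubst_add: "psubst \<phi> \<sigma> (f + g) = psubst \<phi> \<sigma> f + psubst \<phi> \<sigma> g"
proof -
  let ?B = "Poly_Mapping.keys f \<union> Poly_Mapping.keys g"
  have "Poly_Mapping.keys (f + g) \<subseteq> ?B"
    by (rule Poly_Mapping.keys_add)
  then show ?thesis
    by (simp add: psubst_superset[of ?B] lookup_add \<phi>.hom_add distrib_right sum.distrib)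
qed

lemma psubst_0: "psubst \<phi> \<sigma> 0 = 0"
  by (simp add: psubst_def)

lemma psubst_sum: "psubst \<phi> \<sigma> (sum h B) = (\<Sum>x\<in>B. psubst \<phi> \<sigma> (h x))"
  by (induction B rule: infinite_finite_induct) (simp_all add: psubst_0 psubst_add)

lemma psubst_mult: "psubst \<phi> \<sigma> (f * g) = psubst \<phi> \<sigma> f * psubst \<phi> \<sigma> g"
proof -
  have "f * g = (\<Sum>m\<in>Poly_Mapping.keys f. \<Sum>m'\<in>Poly_Mapping.keys g.
      Poly_Mapping.single (m + m') (Poly_Mapping.lookup f m * Poly_Mapping.lookup g m'))"
    by (subst (1 2) sum_single_lookup[symmetric]) (simp add: sum_product mult_single)
  then show ?thesis
    by (simp add: psubst_sum psubst_single psubst_def[of _ _ f] psubst_def[of _ _ g] sum_product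
        monomial_eval_add \<phi>.hom_mult mult_ac)
qed

lemma psubst_const [simp]: "psubst \<phi> \<sigma> (poly_const c) = \<phi> c"
  by (simp add: poly_const_def psubst_single)

lemma psubst_var [simp]: "psubst \<phi> \<sigma> (poly_var i) = \<sigma> i"
  by (simp add: poly_var_def psubst_single)

lemma comm_ring_hom_psubst: "comm_ring_hom (psubst \<phi> \<sigma>)"
  by unfold_locales
    (use psubst_const[of 1] in \<open>simp_all add: psubst_add psubst_mult psubst_0 poly_const_1\<close>)

end

lemma comm_ring_hom_poly_const: "comm_ring_hom poly_const"
  by unfold_locales
    (simp_all add: poly_const_add poly_const_mult poly_const_1, simp add: poly_const_def)

lemmas psubst_hom = comm_ring_hom_psubst[OF comm_ring_hom_poly_const]

lemma comm_ring_hom_act_poly: "comm_ring_hom (act_poly n A)"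
  unfolding act_poly_eq_psubst by (rule psubst_hom)

lemma polysI_var [simp]: "i < n \<Longrightarrow> poly_var i \<in> polys n"
  and polysI_const [simp]: "poly_const c \<in> polys n"
  by (auto simp: polys_def poly_var_def poly_const_def)

lemma polys_add: "f \<in> polys n \<Longrightarrow> g \<in> polys n \<Longrightarrow> f + g \<in> polys n"
  using Poly_Mapping.keys_add[of f g] by (fastforce simp: polys_def)

lemma polys_mult:
  assumes "f \<in> polys n" "g \<in> polys n" shows "f * g \<in> polys n"
proof -
  have "Poly_Mapping.keys m \<subseteq> {..<n}" if m: "m \<in> Poly_Mapping.keys (f * g)" for m
  proof -
    obtain a b where "m = a + b" "a \<in> Poly_Mapping.keys f" "b \<in> Poly_Mapping.keys g"
      using m keys_mult[of f g] by auto
    then show ?thesis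
      using assms Poly_Mapping.keys_add[of a b] by (fastforce simp: polys_def)
  qed
  then show ?thesis by (simp add: polys_def)
qed

lemma polys_0 [simp]: "0 \<in> polys n" by (simp add: polys_def)

lemma polys_1 [simp]: "1 \<in> polys n"
  using polysI_const[of 1] by (simp add: poly_const_1)

lemma polys_uminus: "f \<in> polys n \<Longrightarrow> - f \<in> polys n"
  by (auto simp: polys_def in_keys_iff)

lemma polys_power: "f \<in> polys n \<Longrightarrow> f ^ k \<in> polys n"
  by (induction k) (auto intro: polys_mult)

lemma polys_sum: "(\<And>x. x \<in> B \<Longrightarrow> h x \<in> polys n) \<Longrightarrow> sum h B \<in> polys n"
  by (induction B rule: infinite_finite_induct) (auto intro: polys_add)

lemma polys_prod: "(\<And>x. x \<in> B \<Longrightarrow> h x \<in> polys n) \<Longrightarrow> prod h B \<in> polys n"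
  by (induction B rule: infinite_finite_induct) (auto intro: polys_mult)

lemma polys_mono: "n \<le> k \<Longrightarrow> f \<in> polys n \<Longrightarrow> f \<in> polys k"
  by (fastforce simp: polys_def)

lemma polys_induct [consumes 1, case_names const var add mult]:
  assumes "f \<in> polys n"
    and const: "\<And>c. P (poly_const c)" and var: "\<And>i. i < n \<Longrightarrow> P (poly_var i)"
    and add: "\<And>f g. P f \<Longrightarrow> P g \<Longrightarrow> P (f + g)" and mult: "\<And>f g. P f \<Longrightarrow> P g \<Longrightarrow> P (f * g)"
  shows "P f"
proof -
  have P0: "P 0" and P1: "P 1"
    using const[of 0] const[of 1] by (simp_all add: poly_const_1) (simp add: poly_const_def)
  have pow: "P (g ^ k)" if "P g" for g k
    by (induction k) (auto intro: mult that P1)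
  have "P (\<Prod>s\<in>B. poly_var s ^ k s)" if "finite B" "B \<subseteq> {..<n}" for B k
    using that by (induction B) (auto intro!: P1 mult pow var)
  then have single: "P (Poly_Mapping.single m (Poly_Mapping.lookup f m))" if "m \<in> Poly_Mapping.keys f" for m
    using that assms(1) by (auto simp: single_conv_poly_var monomial_eval_def polys_def intro!: mult const)
  have "P (\<Sum>m\<in>B. Poly_Mapping.single m (Poly_Mapping.lookup f m))"
    if "finite B" "B \<subseteq> Poly_Mapping.keys f" for B
    using that by (induction B) (auto intro: P0 add single)
  from this[of "Poly_Mapping.keys f"] show ?thesis by (simp add: sum_single_lookup)
qed

lemma polys_exhaust: obtains n where "f \<in> polys n"
proof -
  have "finite (\<Union>m\<in>Poly_Mapping.keys f. Poly_Mapping.keys m)" by simp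
  then obtain k where "\<forall>i \<in> (\<Union>m\<in>Poly_Mapping.keys f. Poly_Mapping.keys m). i \<le> k"
    using finite_nat_set_iff_bounded_le by metis
  then have "f \<in> polys (Suc k)" by (fastforce simp: polys_def)
  then show ?thesis by (rule that)
qed

lemma psubst_in_polys:
  assumes "f \<in> polys k" "\<And>i. i < k \<Longrightarrow> \<sigma> i \<in> polys n"
  shows "psubst poly_const \<sigma> f \<in> polys n"
proof -
  interpret comm_ring_hom "psubst poly_const \<sigma>" by (rule psubst_hom)
  show ?thesis
    using assms(1)
    by (induction rule: polys_induct)
      (auto simp: comm_ring_hom_poly_const hom_distribs intro!: polys_add polys_mult assms(2))
qed

lemma comm_ring_hom_eq_on_polys:
  assumes "comm_ring_hom \<alpha>" "comm_ring_hom \<beta>" "f \<in> polys n"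
    and "\<And>c. \<alpha> (poly_const c) = \<beta> (poly_const c)"
    and "\<And>i. i < n \<Longrightarrow> \<alpha> (poly_var i) = \<beta> (poly_var i)"
  shows "\<alpha> f = \<beta> f"
proof -
  interpret \<alpha>: comm_ring_hom \<alpha> by fact
  interpret \<beta>: comm_ring_hom \<beta> by fact
  show ?thesis
    using assms(3)
    by (induction rule: polys_induct) (simp_all add: assms(4,5) \<alpha>.hom_add \<beta>.hom_add \<alpha>.hom_mult \<beta>.hom_mult)
qed

lemma psubst_id:
  assumes "f \<in> polys n" "\<And>i. i < n \<Longrightarrow> \<sigma> i = poly_var i"
  shows "psubst poly_const \<sigma> f = f"
proof -
  interpret comm_ring_hom "psubst poly_const \<sigma>" by (rule psubst_hom)
  show ?thesis
    using assms(1)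
    by (induction rule: polys_induct)
      (simp_all add: comm_ring_hom_poly_const assms(2) hom_add hom_mult)
qed

text \<open>A factor theorem in several variables: congruence of \<open>f\<close> with its image
  modulo \<open>l\<close> is preserved by sums and products, so it only has to hold on
  variables.\<close>

lemma dvd_diff_psubst:
  assumes "f \<in> polys n" "\<And>i. i < n \<Longrightarrow> l dvd poly_var i - \<sigma> i"
  shows "l dvd f - psubst poly_const \<sigma> f"
proof -
  interpret comm_ring_hom "psubst poly_const \<sigma>" by (rule psubst_hom)
  let ?h = "psubst poly_const \<sigma>"
  show ?thesis
    using assms(1)
  proof (induction rule: polys_induct)
    case (add f g)
    have "f + g - ?h (f + g) = (f - ?h f) + (g - ?h g)" by (simp add: hom_add)
    then show ?case using add by (metis dvd_add)
  next
    case (mult f g)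
    have "f * g - ?h (f * g) = (f - ?h f) * g + ?h f * (g - ?h g)"
      by (simp add: hom_mult algebra_simps)
    then show ?case using mult by (metis dvd_add dvd_mult dvd_mult2)
  qed (simp_all add: comm_ring_hom_poly_const assms(2))
qed

section \<open>Characteristic p and the Frobenius homomorphism\<close>

lemma char_fp_poly: "CHAR('p::prime_card fp_poly) = CARD('p)"
proof (rule CHAR_eqI)
  show "of_nat CARD('p) = (0 :: 'p fp_poly)"
    by (simp flip: single_of_nat)
  show "CARD('p) dvd x" if "of_nat x = (0 :: 'p fp_poly)" for x
  proof -
    have "Poly_Mapping.lookup (of_nat x :: 'p fp_poly) 0 = 0" using that by simp
    then have "of_nat x = (0 :: 'p mod_ring)" by (simp add: lookup_of_nat)
    then show ?thesis by (rule of_nat_0_mod_ring_dvd)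
  qed
qed

lemma prime_char_fp_poly: "prime CHAR('p::prime_card fp_poly)"
  by (simp add: char_fp_poly prime_card)

lemma fp_frobenius: "(c :: 'p::prime_card mod_ring) ^ CARD('p) = c"
  using finite_field_power_card_eq_same[of c] by simp

lemma fp_frobenius': "(c :: 'p::prime_card mod_ring) ^ (CARD('p) ^ k) = c"
  by (induction k) (simp_all add: fp_frobenius power_mult)

lemma poly_const_power: "poly_const (c ^ k) = poly_const c ^ k"
  by (induction k) (simp_all add: poly_const_1 poly_const_mult)

lemma comm_ring_hom_frobenius:
  "comm_ring_hom (\<lambda>f :: 'p::prime_card fp_poly. f ^ (CARD('p) ^ k))"
  by unfold_locales
    (simp_all add: freshmans_dream'[OF prime_char_fp_poly] char_fp_poly power_mult_distrib)

lemma poly_const_frobenius: "poly_const c ^ (CARD('p) ^ k) = (poly_const c :: 'p::prime_card fp_poly)"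
  by (simp add: fp_frobenius' flip: poly_const_power)

section \<open>Homomorphisms of exterior algebras\<close>

lemma ext_eqI: "(\<And>S. ecoeff g S = ecoeff h S) \<Longrightarrow> g = h"
  by (simp add: ecoeff_inject[symmetric] fun_eq_iff)

lemma finite_ecoeff_support: "finite {S. ecoeff h S \<noteq> 0}"
  using ecoeff[of h] by simp

lemma finite_if_ecoeff_nonzero: "ecoeff h S \<noteq> 0 \<Longrightarrow> finite S"
  using ecoeff[of h] by simp

lemma ecoeff_0 [simp]: "ecoeff 0 S = 0" by transfer simp

lemma ecoeff_1: "ecoeff 1 S = (if S = {} then 1 else 0)" by transfer simp

lemma ecoeff_add [simp]: "ecoeff (g + h) S = ecoeff g S + ecoeff h S" by transfer simp

lemma ecoeff_uminus [simp]: "ecoeff (- h) S = - ecoeff h S" by transfer simp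

lemma ecoeff_diff [simp]: "ecoeff (g - h) S = ecoeff g S - ecoeff h S" by transfer simp

lemma ecoeff_sum [simp]: "ecoeff (sum h B) S = (\<Sum>x\<in>B. ecoeff (h x) S)"
  by (induction B rule: infinite_finite_induct) simp_all

lemma ecoeff_mult:
  "ecoeff (g * h) U = (\<Sum>S\<in>Pow U. koszul S (U - S) * ecoeff g S * ecoeff h (U - S))"
  by transfer simp

lemma ext_const_0 [simp]: "ext_const 0 = 0"
  by (rule ext_eqI) (simp add: ext_const.rep_eq)

lemma ext_const_add: "ext_const (c + d) = ext_const c + ext_const d"
  by (rule ext_eqI) (simp add: ext_const.rep_eq)

lemma ext_const_uminus: "ext_const (- c) = - ext_const c"
  by (rule ext_eqI) (simp add: ext_const.rep_eq)

lemma ext_const_sum: "ext_const (sum f B) = (\<Sum>x\<in>B. ext_const (f x))"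
  by (induction B rule: infinite_finite_induct) (simp_all add: ext_const_add)

lemma ext_const_mult: "ext_const (c * d) = ext_const c * ext_const d"
  by (rule ext_eqI) (simp add: ecoeff_const_mult ext_const.rep_eq)

lemma ecoeff_mult_const: "ecoeff (h * ext_const c) U = c * ecoeff h U"
proof (cases "finite U")
  case True
  have "ecoeff (h * ext_const c) U =
      (\<Sum>S\<in>Pow U. if S = U then c * ecoeff h U else 0)"
    unfolding ecoeff_mult by (rule sum.cong) (auto simp: ext_const.rep_eq)
  then show ?thesis using True by simp
next
  case False
  then show ?thesis
    by (metis finite_if_ecoeff_nonzero mult_zero_right)
qed

lemma ext_const_commute: "h * ext_const c = ext_const c * h"
  by (rule ext_eqI) (simp add: ecoeff_const_mult ecoeff_mult_const)

lemma ext_const_left_commute: "g * (ext_const c * h) = ext_const c * (g * h)"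
  by (metis ext_const_commute mult.assoc)

lift_definition ext_base :: "nat set \<Rightarrow> 'a::comm_ring_1 ext"
  is "\<lambda>S T. if T = S \<and> finite S then 1 else 0"
  by (simp add: rev_finite_subset)

lemma ecoeff_base: "ecoeff (ext_base S) T = (if T = S \<and> finite S then 1 else 0)"
  by transfer simp

lemma ext_base_empty [simp]: "ext_base {} = 1"
  by (rule ext_eqI) (simp add: ecoeff_base ecoeff_1)

lemma ext_sum_base:
  assumes "finite B" "{S. ecoeff h S \<noteq> 0} \<subseteq> B"
  shows "h = (\<Sum>S\<in>B. ext_const (ecoeff h S) * ext_base S)"
proof (rule ext_eqI)
  fix T
  have "(\<Sum>S\<in>B. ecoeff (ext_const (ecoeff h S) * ext_base S) T) =
      (\<Sum>S\<in>B. if T = S then ecoeff h T else 0)"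
    by (rule sum.cong) (use finite_if_ecoeff_nonzero[of h T] in \<open>auto simp: ecoeff_const_mult ecoeff_base\<close>)
  then show "ecoeff h T = ecoeff (\<Sum>S\<in>B. ext_const (ecoeff h S) * ext_base S) T"
    using assms by auto
qed

lemma ext_gen_mult_base:
  "ext_gen i * ext_base T =
    (if i \<in> T then 0 else ext_const (koszul {i} T) * ext_base (insert i T))"
proof (rule ext_eqI)
  fix U
  show "ecoeff (ext_gen i * ext_base T :: 'a ext) U =
      ecoeff (if i \<in> T then 0 else ext_const (koszul {i} T) * ext_base (insert i T)) U"
  proof (cases "finite U")
    case True
    have "ecoeff (ext_gen i * ext_base T :: 'a ext) U =
        (\<Sum>S\<in>Pow U. if S = {i} then (if U - {i} = T \<and> finite T then koszul {i} T else 0) else 0)"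
      unfolding ecoeff_mult by (rule sum.cong) (auto simp: ext_gen.rep_eq ecoeff_base)
    also have "\<dots> = ecoeff (if i \<in> T then 0 else ext_const (koszul {i} T) * ext_base (insert i T)) U"
      using True by (auto simp: ecoeff_const_mult ecoeff_base)
    finally show ?thesis .
  next
    case False
    then show ?thesis by (metis finite_if_ecoeff_nonzero)
  qed
qed

text \<open>Brings the sign into the form in which insertion into a sorted list produces it.\<close>

lemma koszul_single:
  assumes "finite T"
  shows "koszul {i} T = (-1) ^ length (filter (\<lambda>t. t < i) (sorted_list_of_set T))"
proof -
  have "{(s, t). s \<in> {i} \<and> t \<in> T \<and> t < s} = Pair i ` {t \<in> T. t < i}" by auto
  then have "card {(s, t). s \<in> {i} \<and> t \<in> T \<and> t < s} = card {t \<in> T. t < i}"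
    by (simp add: card_image inj_on_def)
  also have "\<dots> = length (filter (\<lambda>t. t < i) (sorted_list_of_set T))"
    using assms by (subst distinct_card[symmetric]) auto
  finally show ?thesis by (simp only: koszul_def)
qed

lemma prod_list_ext_gen:
  assumes "sorted xs" "distinct xs"
  shows "prod_list (map ext_gen xs) = ext_base (set xs)"
  using assms
proof (induction xs)
  case (Cons x xs)
  have "filter (\<lambda>t. t < x) xs = []"
    using Cons.prems by (auto simp: filter_empty_conv)
  then show ?case
    using Cons by (simp add: ext_gen_mult_base koszul_single sorted_list_of_set.idem_if_sorted_distinct ext_const_1)
qed simp

lemma ext_base_conv_prod_list:
  "finite S \<Longrightarrow> ext_base S = prod_list (map ext_gen (sorted_list_of_set S))"
  by (simp add: prod_list_ext_gen)

text \<open>The sets \<open>X\<close> and \<open>C\<close> restrict generators and coefficients, so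
  that one induction serves the whole algebra, \<open>ext_on\<close> and
  \<open>cohomology\<close>.\<close>

lemma ext_induct_on [case_names coeff zero one const gen add mult]:
  assumes h: "\<And>S. ecoeff h S \<noteq> 0 \<Longrightarrow> S \<subseteq> X \<and> ecoeff h S \<in> C"
    and zero: "P 0" and one: "P 1"
    and const: "\<And>c. c \<in> C \<Longrightarrow> P (ext_const c)" and gen: "\<And>i. i \<in> X \<Longrightarrow> P (ext_gen i)"
    and add: "\<And>f g. P f \<Longrightarrow> P g \<Longrightarrow> P (f + g)" and mult: "\<And>f g. P f \<Longrightarrow> P g \<Longrightarrow> P (f * g)"
  shows "P h"
proof -
  let ?B = "{S. ecoeff h S \<noteq> 0}"
  have "P (prod_list (map ext_gen xs))" if "set xs \<subseteq> X" for xs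
    using that by (induction xs) (auto intro: one mult gen)
  then have summand: "P (ext_const (ecoeff h S) * ext_base S)" if "S \<in> ?B" for S
    using that h[of S] finite_if_ecoeff_nonzero[of h S]
    by (auto simp: ext_base_conv_prod_list intro!: mult const)
  have "P (\<Sum>S\<in>B. ext_const (ecoeff h S) * ext_base S)" if "finite B" "B \<subseteq> ?B" for B
    using that by (induction B) (auto intro: zero add summand)
  from this[of ?B] show ?thesis
    using ext_sum_base[of ?B h] finite_ecoeff_support[of h] by simp
qed

section \<open>Substitution of exterior generators\<close>

text \<open>The shape of \<open>act\<close> with arbitrary images of coefficients and generators.
  For a homomorphism \<open>\<phi>\<close> it is additive whatever \<open>a\<close> is;
  multiplicativity rests on the images anticommuting and squaring to zero.\<close>

definition ext_subst :: "('a::comm_ring_1 \<Rightarrow> 'b::comm_ring_1) \<Rightarrow> (nat \<Rightarrow> 'b ext) \<Rightarrow> 'a ext \<Rightarrow> 'b ext"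
  where "ext_subst \<phi> a h = (\<Sum>S | ecoeff h S \<noteq> 0.
    ext_const (\<phi> (ecoeff h S)) * prod_list (map a (sorted_list_of_set S)))"

lemma act_eq_ext_subst: "act n A = ext_subst (act_poly n A) (act_gen n A)"
  by (simp add: fun_eq_iff act_def ext_subst_def)

text \<open>Every smaller generator that is passed contributes one sign, which adds up to the sign
  in \<open>koszul_single\<close>. A repeated generator travels until it meets its copy, where the
  square vanishes.\<close>

lemma anticommute_prod_list:
  fixes a :: "nat \<Rightarrow> 'b::ring_1"
  assumes anti: "\<And>j. a i * a j = - (a j * a i)" and sq: "a i * a i = 0"
  shows anticommute_prod_list_insort: "sorted xs \<Longrightarrow> i \<notin> set xs \<Longrightarrow>
      a i * prod_list (map a xs) =
        (-1) ^ length (filter (\<lambda>t. t < i) xs) * prod_list (map a (insort i xs))"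
    and anticommute_prod_list_mem: "i \<in> set xs \<Longrightarrow> a i * prod_list (map a xs) = 0"
proof -
  show "sorted xs \<Longrightarrow> i \<notin> set xs \<Longrightarrow> a i * prod_list (map a xs) =
      (-1) ^ length (filter (\<lambda>t. t < i) xs) * prod_list (map a (insort i xs))"
  proof (induction xs)
    case (Cons x xs)
    show ?case
    proof (cases "i \<le> x")
      case True
      then have "filter (\<lambda>t. t < i) (x # xs) = []"
        using Cons.prems by (auto simp: filter_empty_conv)
      then show ?thesis using True by simp
    next
      case False
      let ?s = "(-1) ^ length (filter (\<lambda>t. t < i) xs) :: 'b"
      have comm: "?s * a x = a x * ?s"
        by (simp add: minus_one_power_iff)
      have "a i * prod_list (map a (x # xs)) = - (a x * (a i * prod_list (map a xs)))"
        using anti[of x] by (simp flip: mult.assoc)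
      also have "a i * prod_list (map a xs) = ?s * prod_list (map a (insort i xs))"
        using Cons by simp
      also have "- (a x * (?s * prod_list (map a (insort i xs)))) =
          - (?s * (a x * prod_list (map a (insort i xs))))"
        by (simp only: comm flip: mult.assoc)
      finally show ?thesis using False by simp
    qed
  qed simp
  show "i \<in> set xs \<Longrightarrow> a i * prod_list (map a xs) = 0"
  proof (induction xs)
    case (Cons x xs)
    have "a i * prod_list (map a (x # xs)) = - (a x * (a i * prod_list (map a xs)))"
      using anti[of x] by (simp flip: mult.assoc)
    moreover have "a x * (a i * prod_list (map a xs)) = 0"
      using Cons sq by (cases "i = x") (auto simp flip: mult.assoc)
    ultimately show ?case by simp
  qed simp
qed

context
  fixes \<phi> :: "'a::comm_ring_1 \<Rightarrow> 'b::comm_ring_1" and a :: "nat \<Rightarrow> 'b ext"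
  assumes hom: "comm_ring_hom \<phi>"
begin

interpretation \<phi>: comm_ring_hom \<phi> by (rule hom)

lemma ext_subst_superset:
  assumes "finite B" "{S. ecoeff h S \<noteq> 0} \<subseteq> B"
  shows "ext_subst \<phi> a h =
    (\<Sum>S\<in>B. ext_const (\<phi> (ecoeff h S)) * prod_list (map a (sorted_list_of_set S)))"
  unfolding ext_subst_def by (rule sum.mono_neutral_left) (use assms in auto)

lemma ext_subst_0: "ext_subst \<phi> a 0 = 0"
  by (simp add: ext_subst_def)

lemma ext_subst_add: "ext_subst \<phi> a (g + h) = ext_subst \<phi> a g + ext_subst \<phi> a h"
proof -
  let ?B = "{S. ecoeff g S \<noteq> 0} \<union> {S. ecoeff h S \<noteq> 0}"
  have "{S. ecoeff (g + h) S \<noteq> 0} \<subseteq> ?B" by auto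
  then show ?thesis
    by (simp add: ext_subst_superset[of ?B] finite_ecoeff_support \<phi>.hom_add ext_const_add
        distrib_right sum.distrib)
qed

lemma ext_subst_sum: "ext_subst \<phi> a (sum h B) = (\<Sum>x\<in>B. ext_subst \<phi> a (h x))"
  by (induction B rule: infinite_finite_induct) (simp_all add: ext_subst_0 ext_subst_add)

lemma ext_subst_base:
  assumes "finite S"
  shows "ext_subst \<phi> a (ext_base S) = prod_list (map a (sorted_list_of_set S))"
  using assms
  by (subst ext_subst_superset[of "{S}"]) (auto simp: ecoeff_base ext_const_1)

lemma ext_subst_const_mult:
  "ext_subst \<phi> a (ext_const c * h) = ext_const (\<phi> c) * ext_subst \<phi> a h"
  by (subst (1 2) ext_subst_superset[of "{S. ecoeff h S \<noteq> 0}"])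
    (auto simp: finite_ecoeff_support ecoeff_const_mult \<phi>.hom_mult ext_const_mult sum_distrib_left mult.assoc)

lemma ext_subst_1: "ext_subst \<phi> a 1 = 1"
  using ext_subst_base[of "{}"] by simp

lemma ext_subst_const: "ext_subst \<phi> a (ext_const c) = ext_const (\<phi> c)"
  using ext_subst_const_mult[of c 1] by (simp add: ext_subst_1)

lemma ext_subst_gen: "ext_subst \<phi> a (ext_gen i) = a i"
  using ext_subst_base[of "{i}"] by (simp add: ext_base_conv_prod_list)

text \<open>Multiplying e_T by one generator is the decisive case: e_i e_T and its image acquire the
  same sorting sign, or both vanish when i \<in> T. Induction on the left factor gives all
  products.\<close>

lemma ext_subst_mult:
  assumes anti: "\<And>i j. a i * a j = - (a j * a i)" and sq: "\<And>i. a i * a i = 0"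
  shows "ext_subst \<phi> a (g * h) = ext_subst \<phi> a g * ext_subst \<phi> a h"
proof -
  let ?F = "ext_subst \<phi> a"
  have gen_base: "?F (ext_gen i * ext_base T) = a i * ?F (ext_base T)" if T: "finite T" for i T
  proof (cases "i \<in> T")
    case True
    then show ?thesis
      using T by (simp add: ext_gen_mult_base ext_subst_0 ext_subst_base anticommute_prod_list_mem[of a, OF anti sq])
  next
    case False
    have s: "ext_const (\<phi> (koszul {i} T)) = (-1) ^ length (filter (\<lambda>t. t < i) (sorted_list_of_set T))"
      by (simp add: koszul_single T minus_one_power_iff \<phi>.hom_uminus ext_const_uminus ext_const_1)
    show ?thesis
      using False T
      by (simp add: ext_gen_mult_base ext_subst_const_mult ext_subst_base s
          anticommute_prod_list_insort[of a, OF anti sq])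
  qed
  have gen: "?F (ext_gen i * h) = a i * ?F h" for i h
  proof -
    let ?B = "{S. ecoeff h S \<noteq> 0}"
    have h: "h = (\<Sum>S\<in>?B. ext_const (ecoeff h S) * ext_base S)"
      by (rule ext_sum_base) (auto simp: finite_ecoeff_support)
    have "?F (ext_gen i * (\<Sum>S\<in>?B. ext_const (ecoeff h S) * ext_base S)) =
        a i * ?F (\<Sum>S\<in>?B. ext_const (ecoeff h S) * ext_base S)"
      by (simp add: sum_distrib_left ext_subst_sum ext_const_left_commute ext_subst_const_mult gen_base
          finite_if_ecoeff_nonzero)
    then show ?thesis by (simp only: h[symmetric])
  qed
  have "\<forall>h. ?F (g * h) = ?F g * ?F h"
    by (rule ext_induct_on[of g UNIV UNIV])
      (simp_all add: ext_subst_0 ext_subst_1 ext_subst_const_mult ext_subst_const gen ext_subst_gen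
        distrib_right ext_subst_add mult.assoc)
  then show ?thesis by blast
qed

end

definition ext_map :: "('a::comm_ring_1 \<Rightarrow> 'b::comm_ring_1) \<Rightarrow> 'a ext \<Rightarrow> 'b ext"
  where "ext_map \<phi> = ext_subst \<phi> ext_gen"

lemma ecoeff_ext_map:
  assumes "comm_ring_hom \<phi>" shows "ecoeff (ext_map \<phi> h) S = \<phi> (ecoeff h S)"
proof -
  interpret comm_ring_hom \<phi> by fact
  have "ext_map \<phi> h = (\<Sum>S | ecoeff h S \<noteq> 0. ext_const (\<phi> (ecoeff h S)) * ext_base S)"
    unfolding ext_map_def ext_subst_def
    by (rule sum.cong) (auto simp: ext_base_conv_prod_list finite_if_ecoeff_nonzero)
  also have "ecoeff \<dots> S = (\<Sum>T | ecoeff h T \<noteq> 0. if S = T then \<phi> (ecoeff h S) else 0)"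
    unfolding ecoeff_sum
    by (rule sum.cong) (auto simp: ecoeff_const_mult ecoeff_base finite_if_ecoeff_nonzero)
  also have "\<dots> = \<phi> (ecoeff h S)"
    by (auto simp: finite_ecoeff_support)
  finally show ?thesis .
qed

lemma ext_map_mult: "comm_ring_hom \<phi> \<Longrightarrow> ext_map \<phi> (g * h) = ext_map \<phi> g * ext_map \<phi> h"
  unfolding ext_map_def
  by (rule ext_subst_mult) (auto intro: ext_gen_anticommute ext_gen_square)

lemma ext_linear_comb_anticommute:
  "(\<Sum>j\<in>B. ext_const (c j) * ext_gen j) * ext_gen i = - (ext_gen i * (\<Sum>j\<in>B. ext_const (c j) * ext_gen j))"
proof -
  have "ext_const (c j) * ext_gen j * ext_gen i = - (ext_gen i * (ext_const (c j) * ext_gen j))" for j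
    by (simp add: ext_const_left_commute[of "ext_gen i"] mult.assoc ext_gen_anticommute[of j i])
  then show ?thesis
    by (simp add: sum_distrib_left sum_distrib_right sum_negf)
qed

lemma ext_linear_combs_anticommute:
  "(\<Sum>j\<in>B. ext_const (c j) * ext_gen j) * (\<Sum>j\<in>C. ext_const (d j) * ext_gen j) =
    - ((\<Sum>j\<in>C. ext_const (d j) * ext_gen j) * (\<Sum>j\<in>B. ext_const (c j) * ext_gen j))"
proof -
  define u where "u = (\<Sum>j\<in>B. ext_const (c j) * ext_gen j)"
  have "u * (ext_const (d j) * ext_gen j) = - (ext_const (d j) * ext_gen j * u)" for j
  proof -
    have "u * ext_gen j = - (ext_gen j * u)"
      unfolding u_def by (rule ext_linear_comb_anticommute)
    then show ?thesis
      by (simp add: ext_const_left_commute[of u] mult.assoc)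
  qed
  then have "u * (\<Sum>j\<in>C. ext_const (d j) * ext_gen j) = - ((\<Sum>j\<in>C. ext_const (d j) * ext_gen j) * u)"
    by (simp add: sum_distrib_left sum_distrib_right sum_negf)
  then show ?thesis by (simp add: u_def)
qed

text \<open>Anticommutation of the sum with itself would only kill twice the square; the induction
  instead cancels the two mixed terms against each other.\<close>

lemma ext_linear_comb_square:
  "(\<Sum>j\<in>B. ext_const (c j) * ext_gen j) * (\<Sum>j\<in>B. ext_const (c j) * ext_gen j) = 0"
proof (induction B rule: infinite_finite_induct)
  case (insert i B)
  let ?u = "\<Sum>j\<in>B. ext_const (c j) * ext_gen j" and ?e = "ext_const (c i) * ext_gen i"
  have "(?e + ?u) * (?e + ?u) = ?e * ?e + (?u * ?e + (?e * ?u + ?u * ?u))"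
    by (simp only: distrib_left distrib_right add.assoc)
  also have "?e * ?e = 0"
    by (simp add: ext_const_left_commute[of "ext_gen i"] mult.assoc ext_gen_square)
  also have "?u * ?e = - (?e * ?u)"
    by (rule ext_linear_combs_anticommute[of _ B _ "{i}", simplified])
  finally show ?case using insert by simp
qed simp_all

lemma act_mult: "act n A (g * h) = act n A g * act n A h"
  unfolding act_eq_ext_subst
  by (rule ext_subst_mult[OF comm_ring_hom_act_poly])
    (unfold act_gen_def, rule ext_linear_combs_anticommute, rule ext_linear_comb_square)

lemma act_const: "act n A (ext_const f) = ext_const (act_poly n A f)"
  unfolding act_eq_ext_subst by (rule ext_subst_const[OF comm_ring_hom_act_poly])

lemma act_1: "act n A 1 = 1"
  unfolding act_eq_ext_subst by (rule ext_subst_1[OF comm_ring_hom_act_poly])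

lemma act_add: "act n A (g + h) = act n A g + act n A h"
  unfolding act_eq_ext_subst by (rule ext_subst_add[OF comm_ring_hom_act_poly])

lemma act_0: "act n A 0 = 0"
  unfolding act_eq_ext_subst by (rule ext_subst_0[OF comm_ring_hom_act_poly])

lemma comm_ring_hom_to_fract: "comm_ring_hom to_fract"
  by unfold_locales simp_all

lemma to_loc_eq_ext_map: "to_loc = ext_map to_fract"
  by (rule ext, rule ext_eqI) (simp add: ecoeff_ext_map comm_ring_hom_to_fract to_loc.rep_eq)

lemma to_loc_mult: "to_loc (g * h) = to_loc g * to_loc h"
  by (simp add: to_loc_eq_ext_map ext_map_mult comm_ring_hom_to_fract)

section \<open>Dickson invariants\<close>

text \<open>The F_p-span of x_0, ..., x_{n-1}. The recursion splits off the last variable, which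
  suits both restriction to x_n = 0 and the normal form x_k - v of a line.\<close>

primrec lin_forms :: "nat \<Rightarrow> 'p::prime_card fp_poly set" where
  "lin_forms 0 = {0}"
| "lin_forms (Suc n) = (\<lambda>(v, c). v + poly_const c * poly_var n) ` (lin_forms n \<times> UNIV)"

lemma poly_const_0 [simp]: "poly_const 0 = 0"
  by (simp add: poly_const_def)

lemma lin_forms_in_polys: "v \<in> lin_forms n \<Longrightarrow> v \<in> polys n"
proof (induction n arbitrary: v)
  case (Suc n)
  then show ?case
    by (auto intro!: polys_add polys_mult polysI_var intro: polys_mono[of n "Suc n"])
qed simp

lemma finite_lin_forms: "finite (lin_forms n)"
  by (induction n) simp_all

lemma lookup_polys_var:
  assumes "v \<in> polys n" shows "Poly_Mapping.lookup v (Poly_Mapping.single n 1) = 0"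
proof (rule ccontr)
  assume "Poly_Mapping.lookup v (Poly_Mapping.single n 1) \<noteq> 0"
  then have "Poly_Mapping.single n 1 \<in> Poly_Mapping.keys v"
    by (simp add: in_keys_iff)
  then have "Poly_Mapping.keys (Poly_Mapping.single n (1 :: nat)) \<subseteq> {..<n}"
    using assms unfolding polys_def by blast
  then show False by simp
qed

lemma lookup_const_mult_var:
  "Poly_Mapping.lookup (poly_const c * poly_var n) (Poly_Mapping.single n 1) = c"
  by (simp add: poly_const_def poly_var_def mult_single)

lemma poly_var_notin_polys: "poly_var n \<notin> polys n"
  by (metis lookup_polys_var lookup_const_mult_var mult_1 poly_const_1 zero_neq_one)

lemma inj_on_lin_forms_Suc:
  "inj_on (\<lambda>(v, c). v + poly_const c * poly_var n) (lin_forms n \<times> UNIV)"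
proof (rule inj_onI, clarify)
  fix v w :: "'a fp_poly" and c d
  assume vw: "v \<in> lin_forms n" "w \<in> lin_forms n"
    and eq: "v + poly_const c * poly_var n = w + poly_const d * poly_var n"
  have "Poly_Mapping.lookup (v + poly_const c * poly_var n) (Poly_Mapping.single n 1) = c"
    "Poly_Mapping.lookup (w + poly_const d * poly_var n) (Poly_Mapping.single n 1) = d"
    using vw lookup_polys_var[of v n] lookup_polys_var[of w n] lookup_const_mult_var[of c n] lookup_const_mult_var[of d n]
    by (simp_all add: lookup_add lin_forms_in_polys)
  then have "c = d" using eq by simp
  then show "v = w \<and> c = d" using eq by simp
qed

lemma card_lin_forms: "card (lin_forms n :: 'p::prime_card fp_poly set) = CARD('p) ^ n"
  by (induction n) (simp_all add: card_image inj_on_lin_forms_Suc card_cartesian_product)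

section \<open>Moore determinants\<close>

lemma filter_neq_upt:
  assumes "i \<le> n" shows "filter (\<lambda>r. r \<noteq> i) [0..<Suc n] = [0..<i] @ [Suc i..<Suc n]"
proof -
  have "[0..<Suc n] = [0..<i] @ [i..<Suc n]" using assms by (metis le_Suc_eq le_add_diff_inverse upt_add_eq_append zero_le)
  moreover have "[i..<Suc n] = i # [Suc i..<Suc n]" using assms by (simp add: upt_conv_Cons)
  ultimately show ?thesis by (auto simp: filter_id_conv intro!: arg_cong2[of _ _ _ _ "(@)"])
qed

lemma length_filter_neq_upt: "i \<le> n \<Longrightarrow> length (filter (\<lambda>r. r \<noteq> i) [0..<Suc n]) = n"
  by (simp add: filter_neq_upt del: upt_Suc)

lemma nth_filter_neq_upt:
  "i \<le> n \<Longrightarrow> k < n \<Longrightarrow> filter (\<lambda>r. r \<noteq> i) [0..<Suc n] ! k = (if k < i then k else Suc k)"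
  by (auto simp add: filter_neq_upt nth_append simp del: upt_Suc)

text \<open>Arbitrary rows \<open>y\<close> allow a row to be replaced by an argument and
  homomorphisms to be applied row by row.\<close>

definition moore :: "(nat \<Rightarrow> 'p::prime_card fp_poly) \<Rightarrow> nat list \<Rightarrow> 'p fp_poly"
  where "moore y r = det (mat (length r) (length r) (\<lambda>(i, j). y i ^ (CARD('p) ^ (r ! j))))"

lemma bracket_eq_moore: "bracket r = moore poly_var r"
  by (simp add: bracket_def moore_def)

lemma moore_cong: "(\<And>i. i < length r \<Longrightarrow> y i = z i) \<Longrightarrow> moore y r = moore z r"
  unfolding moore_def by (rule arg_cong[of _ _ det], rule cong_mat) auto

lemma moore_hom:
  fixes \<alpha> :: "'p::prime_card fp_poly \<Rightarrow> 'p fp_poly"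
  assumes "comm_ring_hom \<alpha>"
  shows "\<alpha> (moore y r) = moore (\<lambda>i. \<alpha> (y i)) r"
proof -
  interpret comm_ring_hom \<alpha> by fact
  have "\<alpha> (moore y r) =
      det (map_mat \<alpha> (mat (length r) (length r) (\<lambda>(i, j). y i ^ (CARD('p) ^ (r ! j)))))"
    by (simp add: moore_def hom_det)
  also have "map_mat \<alpha> (mat (length r) (length r) (\<lambda>(i, j). y i ^ (CARD('p) ^ (r ! j)))) =
      mat (length r) (length r) (\<lambda>(i, j). \<alpha> (y i) ^ (CARD('p) ^ (r ! j)))"
    by (rule eq_matI) (auto simp: hom_power)
  finally show ?thesis by (simp add: moore_def)
qed

lemma moore_eq_rows:
  assumes "i < length r" "k < length r" "i \<noteq> k" "y i = y k"
  shows "moore y r = 0"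
  unfolding moore_def
  by (rule det_identical_rows[of _ "length r" i k]) (use assms in \<open>auto intro!: eq_vecI\<close>)

lemma moore_eq_columns:
  assumes "j < length r" "k < length r" "j \<noteq> k" "r ! j = r ! k"
  shows "moore y r = 0"
  unfolding moore_def
  by (rule det_identical_columns[of _ "length r" j k]) (use assms in \<open>auto intro!: eq_vecI\<close>)

text \<open>The minors omit one exponent and do not contain \<open>y n\<close>, so the determinant
  is a polynomial in \<open>y n\<close> with exponents p^j only.\<close>

lemma moore_laplace_last:
  "moore y [0..<Suc n] =
    (\<Sum>j\<le>n. (-1) ^ (n + j) * moore y (filter (\<lambda>r. r \<noteq> j) [0..<Suc n]) * y n ^ (CARD('p) ^ j))"
  for y :: "nat \<Rightarrow> 'p::prime_card fp_poly"
proof -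
  let ?M = "mat (Suc n) (Suc n) (\<lambda>(i, j). y i ^ (CARD('p) ^ j))"
  have "moore y [0..<Suc n] = det ?M"
    unfolding moore_def by (rule arg_cong[of _ _ det], rule eq_matI) (auto simp del: upt_Suc)
  also have "\<dots> = (\<Sum>j<Suc n. ?M $$ (n, j) * cofactor ?M n j)"
    by (rule laplace_expansion_row) auto
  also have "\<dots> = (\<Sum>j\<le>n. (-1) ^ (n + j) * moore y (filter (\<lambda>r. r \<noteq> j) [0..<Suc n]) * y n ^ (CARD('p) ^ j))"
    unfolding lessThan_Suc_atMost
  proof (rule sum.cong)
    fix j assume "j \<in> {..n}"
    then have "mat_delete ?M n j = mat (length (filter (\<lambda>r. r \<noteq> j) [0..<Suc n])) (length (filter (\<lambda>r. r \<noteq> j) [0..<Suc n]))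
        (\<lambda>(i, k). y i ^ (CARD('p) ^ (filter (\<lambda>r. r \<noteq> j) [0..<Suc n] ! k)))"
      by (intro eq_matI)
        (auto simp add: mat_delete_def length_filter_neq_upt nth_filter_neq_upt simp del: upt_Suc filter.simps)
    then show "?M $$ (n, j) * cofactor ?M n j =
        (-1) ^ (n + j) * moore y (filter (\<lambda>r. r \<noteq> j) [0..<Suc n]) * y n ^ (CARD('p) ^ j)"
      using \<open>j \<in> {..n}\<close> by (simp add: cofactor_def moore_def mult_ac del: upt_Suc)
  qed simp
  finally show ?thesis .
qed

lemma dickson_L_top: "dickson_L n n = bracket [0..<n]"
  by (simp add: dickson_L_def)

section \<open>Product formulas for L_n and the Dickson polynomial\<close>

text \<open>The Moore determinant whose last row belongs to an indeterminate, expanded along that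
  row.\<close>

definition dickson_w :: "nat \<Rightarrow> 'p::prime_card fp_poly poly"
  where "dickson_w n = (\<Sum>j\<le>n. Polynomial.monom ((-1) ^ (n + j) * dickson_L n j) (CARD('p) ^ j))"

definition lin_poly :: "nat \<Rightarrow> 'p::prime_card fp_poly poly"
  where "lin_poly n = (\<Prod>v\<in>lin_forms n. [:- v, 1:])"

lemma poly_dickson_w: "poly (dickson_w n) y = moore (poly_var(n := y)) [0..<Suc n]"
proof -
  have "dickson_L n j = moore (poly_var(n := y)) (filter (\<lambda>r. r \<noteq> j) [0..<Suc n])" if "j \<le> n" for j
    unfolding dickson_L_def bracket_eq_moore
    by (rule moore_cong) (use length_filter_neq_upt[OF that] in simp)
  then show ?thesis
    by (simp add: moore_laplace_last dickson_w_def poly_sum poly_monom cong: sum.cong_simp del: upt_Suc)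
qed

text \<open>Only exponents p^j occur, and raising to such a power is additive and fixes F_p.\<close>

lemma poly_dickson_w_linear:
  "poly (dickson_w n) (v + poly_const c * u) =
    poly (dickson_w n) v + poly_const c * poly (dickson_w n) u" for v u :: "'p::prime_card fp_poly"
proof -
  have "(v + poly_const c * u) ^ (CARD('p) ^ j) = v ^ (CARD('p) ^ j) + poly_const c * u ^ (CARD('p) ^ j)" for j
  proof -
    interpret F: comm_ring_hom "\<lambda>f :: 'p fp_poly. f ^ (CARD('p) ^ j)" by (rule comm_ring_hom_frobenius)
    show ?thesis by (simp add: F.hom_add power_mult_distrib poly_const_frobenius)
  qed
  then show ?thesis
    by (simp add: dickson_w_def poly_sum poly_monom algebra_simps sum.distrib sum_distrib_left)
qed

text \<open>At a variable x_i two rows of the determinant coincide; linearity extends the vanishing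
  to all forms.\<close>

lemma poly_dickson_w_lin_forms:
  assumes "v \<in> lin_forms n" shows "poly (dickson_w n) v = 0"
proof -
  have zero: "poly (dickson_w n) 0 = 0"
    using poly_dickson_w_linear[of n 0 "-1" 0] by (simp add: dickson_w_def poly_sum poly_monom zero_power)
  have var: "poly (dickson_w n) (poly_var i) = 0" if "i < n" for i
    unfolding poly_dickson_w by (rule moore_eq_rows[of i _ n]) (use that in auto)
  have "poly (dickson_w n) v = 0" if "k \<le> n" "v \<in> lin_forms k" for k v
    using that by (induction k arbitrary: v) (auto simp: zero poly_dickson_w_linear var)
  then show ?thesis using assms by blast
qed

text \<open>Subtracting the multiple cancels the top coefficient. The difference would have fewer
  than \<open>card B\<close> roots by degree, but it still vanishes on \<open>B\<close>.\<close>

lemma poly_eq_smult_prod_roots: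
  fixes f :: "'a::idom poly"
  assumes "finite B" "Polynomial.degree f \<le> card B" "\<And>b. b \<in> B \<Longrightarrow> poly f b = 0"
  shows "f = Polynomial.smult (Polynomial.coeff f (card B)) (\<Prod>b\<in>B. [:- b, 1:])"
proof -
  let ?P = "\<Prod>b\<in>B. [:- b, 1:]"
  have "Polynomial.degree (\<Prod>b\<in>C. [:- b, 1:]) = card C \<and> lead_coeff (\<Prod>b\<in>C. [:- b, 1:]) = 1" if "finite C" for C :: "'a set"
    using that
  proof (induction C)
    case (insert c C)
    then have "(\<Prod>b\<in>C. [:- b, 1:]) \<noteq> 0" by auto
    then have "degree ([:- c, 1:] * (\<Prod>b\<in>C. [:- b, 1:])) = Suc (card C)"
      using insert by (subst degree_mult_eq) auto
    moreover have "lead_coeff ([:- c, 1:] * (\<Prod>b\<in>C. [:- b, 1:])) = 1"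
      unfolding lead_coeff_mult using insert by (metis lead_coeff_pCons(1) mult_1 one_neq_zero coeff_pCons_0 lead_coeff_1 one_pCons)
    ultimately show ?case using insert by simp
  qed simp
  then have P: "Polynomial.degree ?P = card B" "Polynomial.coeff ?P (card B) = 1"
    using assms(1) by metis+
  define g where "g = f - Polynomial.smult (Polynomial.coeff f (card B)) ?P"
  have "g = 0"
  proof (rule ccontr)
    assume "g \<noteq> 0"
    have "Polynomial.degree g \<le> card B"
      unfolding g_def by (rule degree_diff_le) (use assms P in \<open>auto intro: order.trans[OF degree_smult_le]\<close>)
    moreover have "Polynomial.coeff g (card B) = 0"
      by (simp add: g_def P)
    ultimately have "Polynomial.degree g < card B"
      using \<open>g \<noteq> 0\<close> by (metis le_neq_implies_less leading_coeff_0_iff)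
    moreover have "B \<subseteq> {x. poly g x = 0}"
      using assms by (auto simp: g_def poly_prod)
    then have "card B \<le> Polynomial.degree g"
      using card_poly_roots_bound[OF \<open>g \<noteq> 0\<close>] card_mono[OF poly_roots_finite[OF \<open>g \<noteq> 0\<close>]] by (meson order.trans)
    ultimately show False by simp
  qed
  then show ?thesis by (simp add: g_def)
qed

lemma p_power_eq_iff: "CARD('p::prime_card) ^ i = CARD('p) ^ j \<longleftrightarrow> i = j"
  using prime_gt_1_nat[OF prime_card[where 'a='p]] by (simp add: power_inject_exp)

lemma p_power_mono: "i \<le> j \<Longrightarrow> CARD('p::prime_card) ^ i \<le> CARD('p) ^ j"
  by (rule power_increasing) (use prime_card[where 'a='p] prime_gt_1_nat in \<open>auto simp: Suc_le_eq\<close>)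

lemma coeff_dickson_w:
  "i \<le> n \<Longrightarrow> Polynomial.coeff (dickson_w n :: 'p::prime_card fp_poly poly) (CARD('p) ^ i) = (-1) ^ (n + i) * dickson_L n i"
  by (simp add: dickson_w_def coeff_sum p_power_eq_iff if_distrib cong: if_cong)

text \<open>A polynomial of degree at most p^n that vanishes at p^n points is determined by its top
  coefficient, here L_n. Comparing the other coefficients shows that L_n divides every
  L_{n,i}.\<close>

lemma dickson_w_eq: "dickson_w n = Polynomial.smult (dickson_L n n) (lin_poly n :: 'p::prime_card fp_poly poly)"
proof -
  have "Polynomial.degree (dickson_w n :: 'p fp_poly poly) \<le> CARD('p) ^ n"
    unfolding dickson_w_def
    by (rule degree_sum_le) (auto intro!: order.trans[OF degree_monom_le] p_power_mono)
  then have "dickson_w n = Polynomial.smult (Polynomial.coeff (dickson_w n) (CARD('p) ^ n)) (lin_poly n :: 'p fp_poly poly)"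
    using poly_eq_smult_prod_roots[OF finite_lin_forms[of n], of "dickson_w n :: 'p fp_poly poly"]
    by (simp add: card_lin_forms poly_dickson_w_lin_forms lin_poly_def)
  then show ?thesis by (simp add: coeff_dickson_w)
qed

lemma dickson_L_Suc:
  "dickson_L (Suc n) (Suc n) = dickson_L n n * (\<Prod>v\<in>lin_forms n. poly_var n - v)"
proof -
  have "dickson_L (Suc n) (Suc n) = poly (dickson_w n) (poly_var n)"
    unfolding dickson_L_top poly_dickson_w bracket_eq_moore by (rule moore_cong) simp
  then show ?thesis by (simp add: dickson_w_eq lin_poly_def poly_prod)
qed

text \<open>One factor for each line of linear forms, normalized to coefficient 1 at the variable of
  largest index.\<close>

lemma dickson_L_prod: "dickson_L n n = (\<Prod>k<n. \<Prod>v\<in>lin_forms k. poly_var k - v)"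
proof (induction n)
  case 0
  show ?case by (simp add: dickson_L_def bracket_def)
next
  case (Suc n)
  then show ?case by (simp add: dickson_L_Suc)
qed

lemma dickson_L_nonzero: "dickson_L n n \<noteq> 0"
  unfolding dickson_L_prod
  using poly_var_notin_polys lin_forms_in_polys by (auto simp: prod_zero_iff finite_lin_forms)

text \<open>The determinant is the image of \<open>bracket r\<close> under x_i \<mapsto>
  \<open>y i\<close>. Rows outside the matrix are set to 0, so that every variable has its image in
  \<open>polys n\<close>.\<close>

lemma moore_in_polys: "(\<And>i. i < length r \<Longrightarrow> y i \<in> polys n) \<Longrightarrow> moore y r \<in> polys n"
proof -
  assume "\<And>i. i < length r \<Longrightarrow> y i \<in> polys n"
  then have "moore (\<lambda>i. if i < length r then y i else 0) r = moore y r"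
    "\<And>i. (if i < length r then y i else 0) \<in> polys n"
    by (auto intro: moore_cong)
  moreover have "psubst poly_const (\<lambda>i. if i < length r then y i else 0) (bracket r) =
      moore (\<lambda>i. if i < length r then y i else 0) r"
    unfolding bracket_eq_moore moore_hom[OF psubst_hom] by (simp add: comm_ring_hom_poly_const)
  moreover obtain k where "(bracket r :: 'a fp_poly) \<in> polys k" by (rule polys_exhaust)
  ultimately show ?thesis using psubst_in_polys[of "bracket r" k "\<lambda>i. if i < length r then y i else 0" n] by simp
qed

lemma dickson_L_in_polys: "i \<le> n \<Longrightarrow> dickson_L n i \<in> polys n"
  unfolding dickson_L_def bracket_eq_moore
  by (rule moore_in_polys) (use length_filter_neq_upt[of i n] in simp)

text \<open>Up to sign, the \<open>q\<^bsub>n,i\<^esub>\<close> are the coefficients of the product of all \<open>X - v\<close>.\<close>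

definition dickson_Q :: "nat \<Rightarrow> nat \<Rightarrow> 'p::prime_card fp_poly"
  where "dickson_Q n i = (-1) ^ (n + i) * Polynomial.coeff (lin_poly n) (CARD('p) ^ i)"

lemma dickson_Q_mult_L:
  assumes "i \<le> n" shows "dickson_Q n i * dickson_L n n = (dickson_L n i :: 'p::prime_card fp_poly)"
proof -
  have "dickson_Q n i * dickson_L n n =
      (-1) ^ (n + i) * (dickson_L n n * Polynomial.coeff (lin_poly n) (CARD('p) ^ i) :: 'p fp_poly)"
    by (simp add: dickson_Q_def)
  also have "dickson_L n n * Polynomial.coeff (lin_poly n) (CARD('p) ^ i) =
      (-1) ^ (n + i) * (dickson_L n i :: 'p fp_poly)"
    using coeff_dickson_w[OF assms, where 'p='p] by (simp add: dickson_w_eq)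
  finally show ?thesis
    by (simp add: minus_one_power_iff)
qed

lemma dickson_q_eq:
  assumes "i \<le> n" shows "dickson_q n i = to_fract (dickson_Q n i :: 'p::prime_card fp_poly)"
proof -
  have "to_fract (dickson_L n i) =
      to_fract (dickson_Q n i) * to_fract (dickson_L n n :: 'p fp_poly)"
    by (simp add: assms dickson_Q_mult_L flip: to_fract_mult)
  then show ?thesis
    using dickson_L_nonzero[of n, where 'a='p] by (simp add: dickson_q_def)
qed

lemma lin_poly_eq:
  "(lin_poly n :: 'p::prime_card fp_poly poly) = (\<Sum>j\<le>n. Polynomial.monom ((-1) ^ (n + j) * dickson_Q n j) (CARD('p) ^ j))"
proof -
  have "Polynomial.smult (dickson_L n n) (lin_poly n) =
      (\<Sum>j\<le>n. Polynomial.monom ((-1) ^ (n + j) * (dickson_Q n j * dickson_L n n)) (CARD('p) ^ j) :: 'p fp_poly poly)"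
    unfolding dickson_w_eq[symmetric] dickson_w_def
    by (rule sum.cong) (simp_all add: dickson_Q_mult_L)
  also have "\<dots> = Polynomial.smult (dickson_L n n)
      (\<Sum>j\<le>n. Polynomial.monom ((-1) ^ (n + j) * dickson_Q n j) (CARD('p) ^ j) :: 'p fp_poly poly)"
    by (simp add: smult_sum2 smult_monom mult_ac)
  finally have "Polynomial.smult (dickson_L n n) (lin_poly n -
      (\<Sum>j\<le>n. Polynomial.monom ((-1) ^ (n + j) * dickson_Q n j) (CARD('p) ^ j) :: 'p fp_poly poly)) = 0"
    by (simp add: smult_diff_right)
  then show ?thesis
    unfolding smult_eq_0_iff using dickson_L_nonzero[of n, where 'a='p] by simp
qed

text \<open>By Frobenius L_n^p is the Moore determinant with all exponents raised by one, which is
  L_{n,0}; now divide by L_n.\<close>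

lemma dickson_Q_0: "dickson_Q n 0 = (dickson_L n n :: 'p::prime_card fp_poly) ^ (CARD('p) - 1)"
proof -
  have p: "CARD('p) \<noteq> 0" by simp
  have "dickson_L n n ^ CARD('p) = moore (\<lambda>i. poly_var i ^ CARD('p) :: 'p fp_poly) [0..<n]"
    using moore_hom[OF comm_ring_hom_frobenius[of 1, where 'p='p], of poly_var "[0..<n]"]
    by (simp add: dickson_L_top bracket_eq_moore)
  also have "\<dots> = dickson_L n 0"
  proof -
    have shift: "filter (\<lambda>r. r \<noteq> 0) [0..<Suc n] = map Suc [0..<n]"
      by (subst filter_neq_upt) (simp_all add: map_Suc_upt del: upt_Suc)
    show ?thesis
      unfolding dickson_L_def bracket_eq_moore moore_def shift
      by (intro arg_cong[of _ _ det] eq_matI) (auto simp flip: power_mult)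
  qed
  finally have "dickson_Q n 0 * dickson_L n n = (dickson_L n n ^ (CARD('p) - 1)) * (dickson_L n n :: 'p fp_poly)"
    using p by (simp add: dickson_Q_mult_L flip: power_Suc2)
  then show ?thesis
    using dickson_L_nonzero[of n, where 'a='p] by simp
qed

lemma dickson_Q_in_polys: "dickson_Q n i \<in> polys n"
proof -
  have "\<forall>k. Polynomial.coeff (\<Prod>v\<in>B. [:- v, 1:]) k \<in> polys n" if "finite B" "B \<subseteq> lin_forms n" for B
    using that
  proof (induction B)
    case (insert v B)
    have "\<forall>k. Polynomial.coeff [:- v, 1:] k \<in> polys n"
      using insert.prems by (auto simp: coeff_pCons lin_forms_in_polys polys_uminus split: nat.split)
    moreover have "\<forall>k. Polynomial.coeff (\<Prod>v\<in>B. [:- v, 1:]) k \<in> polys n"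
      using insert by simp
    ultimately have "\<forall>k. Polynomial.coeff ([:- v, 1:] * (\<Prod>v\<in>B. [:- v, 1:])) k \<in> polys n"
      unfolding coeff_mult by (auto intro!: polys_sum polys_mult)
    then show ?case by (simp only: prod.insert[OF insert.hyps] simp_thms)
  qed (simp add: coeff_pCons split: nat.split)
  from this[OF finite_lin_forms order.refl] show ?thesis
    unfolding dickson_Q_def lin_poly_def
    by (intro polys_mult polys_power polys_uminus polys_1) auto
qed

section \<open>Restriction to the hyperplane x_n = 0\<close>

definition zero_var :: "nat \<Rightarrow> 'p::prime_card fp_poly \<Rightarrow> 'p fp_poly"
  where "zero_var k = psubst poly_const (poly_var(k := 0))"

lemma comm_ring_hom_zero_var: "comm_ring_hom (zero_var k)"
  unfolding zero_var_def by (rule psubst_hom)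

lemma zero_var_const [simp]: "zero_var k (poly_const c) = poly_const c"
  by (simp add: zero_var_def comm_ring_hom_poly_const)

lemma zero_var_var [simp]: "zero_var k (poly_var i) = (if i = k then 0 else poly_var i)"
  by (simp add: zero_var_def comm_ring_hom_poly_const)

lemma zero_var_polys: "f \<in> polys n \<Longrightarrow> n \<le> k \<Longrightarrow> zero_var k f = f"
  unfolding zero_var_def by (rule psubst_id) auto

text \<open>Restriction merges the p forms v + c x_n into the single form v.\<close>

lemma map_poly_zero_var_lin_poly:
  "map_poly (zero_var n) (lin_poly (Suc n)) = (lin_poly n :: 'p::prime_card fp_poly poly) ^ CARD('p)"
proof -
  interpret z: comm_ring_hom "zero_var n" by (rule comm_ring_hom_zero_var)
  interpret zp: map_poly_comm_ring_hom "zero_var n" ..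
  have lin: "zero_var n v = v" if "v \<in> lin_forms n" for v :: "'p fp_poly"
    by (rule zero_var_polys[OF lin_forms_in_polys[OF that]]) simp
  have "map_poly (zero_var n) (lin_poly (Suc n) :: 'p fp_poly poly) =
      (\<Prod>(v, c)\<in>lin_forms n \<times> (UNIV :: 'p mod_ring set). map_poly (zero_var n) [:- (v + poly_const c * poly_var n), 1:])"
    unfolding lin_poly_def lin_forms.simps zp.hom_prod
    by (subst prod.reindex[OF inj_on_lin_forms_Suc]) (simp add: case_prod_unfold)
  also have "\<dots> = (\<Prod>(v, c)\<in>lin_forms n \<times> (UNIV :: 'p mod_ring set). [:- v, 1:])"
    by (rule prod.cong)
      (auto simp: z.hom_add z.hom_minus z.hom_mult z.hom_uminus lin)
  also have "\<dots> = (\<Prod>v\<in>lin_forms n. [:- v, 1:] ^ CARD('p))"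
    by (simp add: prod.cartesian_product[symmetric])
  finally show ?thesis
    by (simp add: lin_poly_def prod_power_distrib)
qed

lemma coeff_lin_poly_power:
  assumes "odd CARD('p)"
  shows "(lin_poly n :: 'p::prime_card fp_poly poly) ^ CARD('p) =
    (\<Sum>j\<le>n. Polynomial.monom ((-1) ^ (n + j) * dickson_Q n j ^ CARD('p)) (CARD('p) ^ Suc j))"
proof -
  have "(\<Sum>j\<le>n. Polynomial.monom ((-1) ^ (n + j) * dickson_Q n j) (CARD('p) ^ j)) ^ CARD('p) =
      (\<Sum>j\<le>n. Polynomial.monom ((-1) ^ (n + j) * dickson_Q n j) (CARD('p) ^ j) ^ CARD('p) :: 'p fp_poly poly)"
    by (rule freshmans_dream_sum) (simp_all add: char_fp_poly prime_card)
  also have "\<dots> = (\<Sum>j\<le>n. Polynomial.monom ((-1) ^ (n + j) * dickson_Q n j ^ CARD('p)) (CARD('p) ^ Suc j))"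
    using assms by (intro sum.cong) (simp_all add: monom_power power_mult_distrib mult_ac minus_one_power_iff)
  finally show ?thesis by (simp add: lin_poly_eq[of n])
qed

text \<open>By Frobenius only exponents p^(j+1) occur in the p-th power of
  \<open>lin_poly n\<close>. The coefficient at p^(i+1) comes from q_{n,i}^p, and there is none at
  p^0.\<close>

lemma zero_var_dickson_Q:
  assumes "odd CARD('p::prime_card)"
  shows zero_var_dickson_Q_Suc: "i \<le> n \<Longrightarrow>
      zero_var n (dickson_Q (Suc n) (Suc i)) = (dickson_Q n i :: 'p fp_poly) ^ CARD('p)"
    and zero_var_dickson_Q_0: "zero_var n (dickson_Q (Suc n) 0 :: 'p fp_poly) = 0"
proof -
  interpret z: comm_ring_hom "zero_var n" by (rule comm_ring_hom_zero_var)
  have eq: "zero_var n (dickson_Q (Suc n) i :: 'p fp_poly) =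
      (-1) ^ (Suc n + i) * Polynomial.coeff (lin_poly n ^ CARD('p)) (CARD('p) ^ i)" for i
    by (simp add: dickson_Q_def z.hom_mult z.hom_power z.hom_uminus coeff_map_poly
        flip: map_poly_zero_var_lin_poly)
  have "CARD('p) ^ Suc j \<noteq> 1" for j
    using p_power_eq_iff[of "Suc j" 0, where 'p='p] by simp
  then show "zero_var n (dickson_Q (Suc n) 0 :: 'p fp_poly) = 0"
    unfolding eq coeff_lin_poly_power[OF assms] by (simp add: coeff_sum del: power_Suc)
  assume i: "i \<le> n"
  have "Polynomial.coeff (lin_poly n ^ CARD('p)) (CARD('p) ^ Suc i) =
      (-1) ^ (n + i) * (dickson_Q n i :: 'p fp_poly) ^ CARD('p)"
    unfolding coeff_lin_poly_power[OF assms] coeff_sum coeff_monom p_power_eq_iff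
    using i by (simp add: if_distrib cong: if_cong)
  then show "zero_var n (dickson_Q (Suc n) (Suc i)) = (dickson_Q n i :: 'p fp_poly) ^ CARD('p)"
    unfolding eq by (simp add: minus_one_power_iff del: power_Suc)
qed

section \<open>General linear substitutions\<close>

lemma general_linear_det:
  assumes "A \<in> general_linear n" shows "A \<in> carrier_mat n n" "det A \<noteq> 0"
proof -
  show A: "A \<in> carrier_mat n n" using assms by (simp add: general_linear_def)
  obtain B where B: "A * B = 1\<^sub>m n" "B * A = 1\<^sub>m (dim_row B)"
    using assms by (auto simp: general_linear_def invertible_mat_def inverts_mat_def)
  have "dim_col (A * B) = n" "dim_col (B * A) = dim_row B" using B by simp_all
  then have "B \<in> carrier_mat n n" using A by auto
  then have "det A * det B = 1" using det_mult[OF A, of B] B by simp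
  then show "det A \<noteq> 0" by auto
qed

text \<open>Frobenius fixes the matrix entries, so every column of powers x_i^(p^r) is transformed
  by the same matrix, the transpose of \<open>A\<close>.\<close>

lemma act_bracket:
  fixes A :: "'p::prime_card mod_ring mat"
  assumes A: "A \<in> carrier_mat n n" and r: "length r = n"
  shows "act_poly n A (bracket r) = poly_const (det A) * bracket r"
proof -
  interpret c: comm_ring_hom "poly_const :: 'p mod_ring \<Rightarrow> _" by (rule comm_ring_hom_poly_const)
  let ?X = "mat n n (\<lambda>(i, j). poly_var i ^ (CARD('p) ^ (r ! j))) :: 'p fp_poly mat"
  let ?B = "transpose_mat (map_mat poly_const A)"
  have "act_poly n A (bracket r) = moore (act_var n A) r"
    unfolding bracket_eq_moore moore_hom[OF comm_ring_hom_act_poly] by (simp add: act_poly_var)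
  also have "\<dots> = det (?B * ?X)"
    unfolding moore_def
  proof (rule arg_cong[of _ _ det], rule eq_matI)
    fix s j assume "s < dim_row (?B * ?X)" "j < dim_col (?B * ?X)"
    then have sj: "s < n" "j < n" using A by auto
    interpret F: comm_ring_hom "\<lambda>f :: 'p fp_poly. f ^ (CARD('p) ^ (r ! j))"
      by (rule comm_ring_hom_frobenius)
    have "act_var n A s ^ (CARD('p) ^ (r ! j)) =
        (\<Sum>i<n. poly_const (A $$ (i, s)) * poly_var i ^ (CARD('p) ^ (r ! j)))"
      unfolding act_var_def F.hom_sum power_mult_distrib poly_const_frobenius ..
    also have "\<dots> = (?B * ?X) $$ (s, j)"
      using A sj by (auto simp: scalar_prod_def atLeast0LessThan intro!: sum.cong)
    finally show "mat (length r) (length r) (\<lambda>(i, j). act_var n A i ^ (CARD('p) ^ (r ! j))) $$ (s, j) =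
        (?B * ?X) $$ (s, j)"
      using sj r by simp
  qed (use A r in auto)
  also have "\<dots> = det ?B * det ?X"
    by (rule det_mult) (use A in auto)
  also have "det ?B = poly_const (det A)"
    using A by (simp add: det_transpose[of _ n] c.hom_det)
  finally show ?thesis by (simp add: bracket_def r)
qed

lemma act_dickson_L:
  "A \<in> carrier_mat n n \<Longrightarrow> i \<le> n \<Longrightarrow> act_poly n A (dickson_L n i) = poly_const (det A) * dickson_L n i"
  unfolding dickson_L_def by (rule act_bracket) (auto simp: length_filter_neq_upt simp del: upt_Suc)

lemma poly_const_eq_0_iff [simp]: "poly_const c = 0 \<longleftrightarrow> c = 0"
  by (metis poly_const_0 lookup_single_eq lookup_zero poly_const_def)

lemma act_dickson_Q:
  assumes A: "A \<in> general_linear n" and i: "i \<le> n"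
  shows "act_poly n A (dickson_Q n i) = (dickson_Q n i :: 'p::prime_card fp_poly)"
proof -
  interpret a: comm_ring_hom "act_poly n A" by (rule comm_ring_hom_act_poly)
  have "act_poly n A (dickson_Q n i) * act_poly n A (dickson_L n n) = act_poly n A (dickson_L n i)"
    by (simp add: dickson_Q_mult_L i flip: a.hom_mult)
  then have "act_poly n A (dickson_Q n i) * (poly_const (det A) * dickson_L n n) =
      poly_const (det A) * dickson_L n i"
    using general_linear_det(1)[OF A] i by (simp add: act_dickson_L)
  also have "\<dots> = dickson_Q n i * (poly_const (det A) * dickson_L n n)"
    by (simp add: mult.left_commute[of "dickson_Q n i"] dickson_Q_mult_L i)
  finally have "act_poly n A (dickson_Q n i) * (poly_const (det A) * dickson_L n n) =
      dickson_Q n i * (poly_const (det A) * dickson_L n n)" .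
  then show ?thesis
    using general_linear_det(2)[OF A] dickson_L_nonzero[of n, where 'a='p] by simp
qed

section \<open>Substitutions of a single variable\<close>

text \<open>The substitution x_k \<mapsto> sum of the \<open>c i\<close> x_i that fixes the other
  variables. Apart from block extensions, invariance is exploited only through these
  matrices.\<close>

definition column_mat :: "nat \<Rightarrow> nat \<Rightarrow> (nat \<Rightarrow> 'p::prime_card mod_ring) \<Rightarrow> 'p mod_ring mat"
  where "column_mat n k c = mat n n (\<lambda>(i, j). if j = k then c i else if i = j then 1 else 0)"

lemma column_mat_mult:
  assumes k: "k < n" and ck: "c k * d k = 1" and cd: "\<And>i. i \<noteq> k \<Longrightarrow> d i + c i * d k = 0"
  shows "column_mat n k c * column_mat n k d = 1\<^sub>m n"
proof (rule eq_matI)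
  fix i j assume "i < dim_row (1\<^sub>m n :: 'a mod_ring mat)" "j < dim_col (1\<^sub>m n :: 'a mod_ring mat)"
  then have ij: "i < n" "j < n" by auto
  have "(column_mat n k c * column_mat n k d) $$ (i, j) =
      (\<Sum>l<n. column_mat n k c $$ (i, l) * column_mat n k d $$ (l, j))"
    using ij by (auto simp: column_mat_def scalar_prod_def atLeast0LessThan intro!: sum.cong)
  also have "\<dots> = (\<Sum>l<n. (if l = k then c i * column_mat n k d $$ (k, j) else 0) +
      (if l = i then if i = k then 0 else column_mat n k d $$ (i, j) else 0))"
    using ij k by (intro sum.cong) (auto simp: column_mat_def)
  also have "\<dots> = c i * column_mat n k d $$ (k, j) + (if i = k then 0 else column_mat n k d $$ (i, j))"
    using ij k by (simp add: sum.distrib)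
  also have "\<dots> = 1\<^sub>m n $$ (i, j)"
    using ij k ck cd[of i] by (auto simp: column_mat_def add.commute)
  finally show "(column_mat n k c * column_mat n k d) $$ (i, j) = 1\<^sub>m n $$ (i, j)" .
qed (simp_all add: column_mat_def)

lemma column_mat_general_linear:
  assumes "k < n" "c k \<noteq> 0" shows "column_mat n k c \<in> general_linear n"
proof -
  \<comment> \<open>The inverse substitution, found by solving the image of x_k for x_k.\<close>
  define d where "d i = (if i = k then 1 / c k else - c i / c k)" for i
  have "column_mat n k c * column_mat n k d = 1\<^sub>m n" "column_mat n k d * column_mat n k c = 1\<^sub>m n"
    using assms by (auto intro!: column_mat_mult simp: d_def)
  moreover have "column_mat n k e \<in> carrier_mat n n" for e :: "nat \<Rightarrow> 'a mod_ring"
    by (simp add: column_mat_def)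
  ultimately show ?thesis
    unfolding general_linear_def invertible_mat_def inverts_mat_def square_mat.simps
    by (metis (mono_tags, lifting) carrier_matD mem_Collect_eq)
qed

lemma act_var_column_mat:
  assumes "s < n"
  shows "act_var n (column_mat n k c) s = (if s = k then \<Sum>i<n. poly_const (c i) * poly_var i else poly_var s)"
proof (cases "s = k")
  case True
  then show ?thesis using assms by (simp add: act_var_def column_mat_def)
next
  case False
  then have "act_var n (column_mat n k c) s = (\<Sum>i<n. if i = s then poly_var i else 0)"
    unfolding act_var_def using assms by (intro sum.cong) (auto simp: column_mat_def poly_const_1)
  then show ?thesis using False assms by simp
qed

lemma act_gen_column_mat:
  assumes "s < n"
  shows "act_gen n (column_mat n k c) s =
    (if s = k then \<Sum>i<n. ext_const (poly_const (c i)) * ext_gen i else ext_gen s)"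
proof (cases "s = k")
  case True
  then show ?thesis using assms by (simp add: act_gen_def column_mat_def)
next
  case False
  then have "act_gen n (column_mat n k c) s = (\<Sum>i<n. if i = s then ext_gen i else 0)"
    unfolding act_gen_def using assms
    by (intro sum.cong) (auto simp: column_mat_def poly_const_1 ext_const_1)
  then show ?thesis using False assms by simp
qed

lemma lin_forms_coeffs:
  "v \<in> lin_forms k \<Longrightarrow> \<exists>a. v = (\<Sum>i<k. poly_const (a i) * poly_var i)"
proof (induction k arbitrary: v)
  case (Suc k)
  then obtain w c a where v: "v = w + poly_const c * poly_var k" "w = (\<Sum>i<k. poly_const (a i) * poly_var i)"
    by force
  have "w = (\<Sum>i<k. poly_const ((a(k := c)) i) * poly_var i)"
    unfolding v(2) by (rule sum.cong) auto
  then show ?case using v(1) by (intro exI[of _ "a(k := c)"]) simp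
qed simp

section \<open>Divisibility by linear forms\<close>

text \<open>As \<open>v\<close> does not involve x_k, reduction modulo x_k - v is the substitution
  x_k \<mapsto> v. Divisibility thus means vanishing in a domain, whence primality.\<close>

lemma minus_var_dvd_iff:
  assumes v: "v \<in> lin_forms k"
  shows "poly_var k - v dvd f \<longleftrightarrow> psubst poly_const (poly_var(k := v)) f = 0"
proof -
  let ?h = "psubst poly_const (poly_var(k := v))"
  interpret h: comm_ring_hom ?h by (rule psubst_hom)
  have "?h v = v"
    by (rule psubst_id[OF lin_forms_in_polys[OF v]]) simp
  then have zero: "?h (poly_var k - v) = 0"
    by (simp add: h.hom_minus comm_ring_hom_poly_const)
  obtain n where "f \<in> polys n" by (rule polys_exhaust)
  then have "poly_var k - v dvd f - ?h f"
    by (rule dvd_diff_psubst) simp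
  then show ?thesis using zero by (auto simp: dvd_def h.hom_mult)
qed

lemma minus_var_prime:
  assumes "v \<in> lin_forms k" "poly_var k - v dvd f * g"
  shows "poly_var k - v dvd f \<or> poly_var k - v dvd g"
  using assms(2) unfolding minus_var_dvd_iff[OF assms(1)] psubst_mult[OF comm_ring_hom_poly_const] by simp

text \<open>Reduce the second form modulo the first. If l \<noteq> k, its leading variable x_l
  survives and cannot cancel against the reduced \<open>w\<close>, which lies in
  \<open>polys l\<close>; if l = k, there remains v - w.\<close>

lemma minus_var_not_dvd:
  assumes v: "v \<in> lin_forms k" and w: "w \<in> lin_forms l" and neq: "(k, v) \<noteq> (l, w)"
  shows "\<not> poly_var k - v dvd poly_var l - w"
proof
  let ?h = "psubst poly_const (poly_var(k := v))"
  interpret h: comm_ring_hom ?h by (rule psubst_hom)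
  assume "poly_var k - v dvd poly_var l - w"
  then have "?h (poly_var l - w) = 0"
    using minus_var_dvd_iff[OF v] by simp
  then have eq: "(if l = k then v else poly_var l) = ?h w"
    by (auto simp: h.hom_minus comm_ring_hom_poly_const split: if_splits)
  have id: "?h w = w" if "l \<le> k"
    by (rule psubst_id[OF lin_forms_in_polys[OF w]]) (use that in auto)
  consider "l = k" | "l < k" | "k < l" by linarith
  then show False
  proof cases
    case 1
    then show False using eq id neq by simp
  next
    case 2
    then have "poly_var l = w" using eq id by simp
    then show False using lin_forms_in_polys[OF w] poly_var_notin_polys by metis
  next
    case 3
    have "?h w \<in> polys l"
      by (rule psubst_in_polys[OF lin_forms_in_polys[OF w]])
        (use 3 v in \<open>auto intro: polys_mono[of k l] lin_forms_in_polys\<close>)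
    moreover have "?h w = poly_var l" using eq 3 by simp
    ultimately show False using poly_var_notin_polys by metis
  qed
qed

lemma minus_var_nonzero: "v \<in> lin_forms k \<Longrightarrow> poly_var k - v \<noteq> 0"
  using poly_var_notin_polys lin_forms_in_polys by (metis eq_iff_diff_eq_0)

text \<open>Only one factor is peeled off at a time: after cancelling the power already found,
  primality moves the next factor from \<open>D\<close> to the quotient.\<close>

lemma minus_var_power_dvd_mult:
  assumes v: "v \<in> lin_forms k" and D: "\<not> poly_var k - v dvd D"
  shows "(poly_var k - v) ^ m dvd D * g \<Longrightarrow> (poly_var k - v) ^ m dvd g"
proof (induction m)
  case (Suc m)
  let ?l = "poly_var k - v"
  have "?l ^ m dvd D * g" using Suc.prems by (metis dvd_trans le_imp_power_dvd lessI less_imp_le)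
  then obtain g1 where g1: "g = ?l ^ m * g1" using Suc.IH by blast
  obtain q where "D * g = ?l ^ Suc m * q" using Suc.prems by blast
  then have "?l ^ m * (D * g1) = ?l ^ m * (?l * q)" by (simp add: g1 mult_ac)
  then have "D * g1 = ?l * q" using minus_var_nonzero[OF v] by simp
  then have "?l dvd D * g1" by simp
  then have "?l dvd g1" using minus_var_prime[OF v] D by blast
  then show ?case by (auto simp: g1)
qed simp

lemma minus_var_not_dvd_prod:
  assumes "finite B" "\<And>k v. (k, v) \<in> B \<Longrightarrow> v \<in> lin_forms k" "v \<in> lin_forms k" "(k, v) \<notin> B"
  shows "\<not> poly_var k - v dvd (\<Prod>(l, w)\<in>B. (poly_var l - w) ^ m)"
  using assms
proof (induction B)
  case empty
  have "poly_var k - v dvd 1 \<Longrightarrow> False"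
  proof -
    assume "poly_var k - v dvd 1"
    then have "psubst poly_const (poly_var(k := v)) 1 = 0"
      using minus_var_dvd_iff[OF empty(2)] by blast
    then show False
      using psubst_const[OF comm_ring_hom_poly_const, of "poly_var(k := v)" 1] by (simp add: poly_const_1)
  qed
  then show ?case by auto
next
  case (insert x B)
  obtain l w where x: "x = (l, w)" by fastforce
  have "\<not> poly_var k - v dvd (poly_var l - w) ^ m" for m
  proof (induction m)
    case 0
    have "poly_var k - v dvd 1 \<Longrightarrow> poly_var k - v dvd poly_var l - w"
      by (metis dvd_trans one_dvd)
    moreover have "\<not> poly_var k - v dvd poly_var l - w"
      by (rule minus_var_not_dvd) (use insert.prems x in auto)
    ultimately show ?case by auto
  next
    case (Suc m)
    then show ?case
      using minus_var_prime[OF insert.prems(2)] minus_var_not_dvd[of v k w l] insert.prems x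
      by (metis insertI1 power_Suc)
  qed
  moreover have "\<not> poly_var k - v dvd (\<Prod>(l, w)\<in>B. (poly_var l - w) ^ m)"
    using insert by simp
  ultimately show ?case
    using insert.hyps minus_var_prime[OF insert.prems(2)] by (auto simp: x)
qed

lemma prod_minus_var_dvd:
  assumes "finite B" "\<And>k v. (k, v) \<in> B \<Longrightarrow> v \<in> lin_forms k \<and> (poly_var k - v) ^ m dvd f"
  shows "(\<Prod>(k, v)\<in>B. (poly_var k - v) ^ m) dvd f"
  using assms
proof (induction B)
  case (insert x B)
  obtain k v where x: "x = (k, v)" by fastforce
  let ?D = "\<Prod>(k, v)\<in>B. (poly_var k - v) ^ m"
  obtain g where g: "f = ?D * g" using insert by (auto simp: dvd_def)
  have v: "v \<in> lin_forms k" and "(poly_var k - v) ^ m dvd ?D * g"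
    using insert.prems x g by auto
  moreover have "\<not> poly_var k - v dvd ?D"
    by (rule minus_var_not_dvd_prod) (use insert x in auto)
  ultimately have "(poly_var k - v) ^ m dvd g"
    using minus_var_power_dvd_mult by blast
  then show ?case
    using insert.hyps by (auto simp: x g)
qed simp

lemma dickson_L_power_dvd:
  assumes "\<And>k v. k < n \<Longrightarrow> v \<in> lin_forms k \<Longrightarrow> (poly_var k - v) ^ m dvd f"
  shows "dickson_L n n ^ m dvd f"
proof -
  have "dickson_L n n ^ m = (\<Prod>(k, v)\<in>Sigma {..<n} lin_forms. (poly_var k - v) ^ m)"
    by (simp add: dickson_L_prod prod_power_distrib[symmetric] prod.Sigma finite_lin_forms case_prod_unfold)
  also have "\<dots> dvd f"
    by (rule prod_minus_var_dvd) (use assms in \<open>auto simp: finite_lin_forms\<close>)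
  finally show ?thesis .
qed

lemma ext_const_dvd:
  assumes "\<And>S. d dvd ecoeff h S" obtains g where "h = ext_const d * g"
proof -
  let ?B = "{S. ecoeff h S \<noteq> 0}"
  have "\<forall>S. \<exists>q. ecoeff h S = d * q" using assms by (auto simp: dvd_def)
  then obtain q where q: "\<And>S. ecoeff h S = d * q S" by metis
  have "h = (\<Sum>S\<in>?B. ext_const (d * q S) * ext_base S)"
    using ext_sum_base[of ?B h] by (simp add: finite_ecoeff_support flip: q)
  then have "h = ext_const d * (\<Sum>S\<in>?B. ext_const (q S) * ext_base S)"
    by (simp add: ext_const_mult sum_distrib_left mult.assoc)
  then show ?thesis by (rule that)
qed

text \<open>The general linear group permutes the linear forms up to scalars transitively, and \<open>L\<^sub>n\<close> is
  the product of pairwise coprime representatives.\<close>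

lemma dickson_L_dvd_semiinvariant:
  fixes h :: "'p::prime_card fp_poly ext"
  assumes semi: "\<And>A. A \<in> general_linear (Suc n) \<Longrightarrow>
      \<exists>c. c \<noteq> 0 \<and> act (Suc n) A h = ext_const (poly_const c) * h"
    and dvd: "\<And>S. poly_var n ^ m dvd ecoeff h S"
  shows "dickson_L (Suc n) (Suc n) ^ m dvd ecoeff h S"
proof -
  \<comment> \<open>Applying \<open>A\<close> to h = l^m g replaces \<open>l\<close> by its image,
    while \<open>h\<close> changes only by a unit constant.\<close>
  have move: "\<forall>S. act_poly (Suc n) A l ^ m dvd ecoeff h S"
    if A: "A \<in> general_linear (Suc n)" and l: "\<forall>S. l ^ m dvd ecoeff h S" for A l
  proof
    fix S
    interpret a: comm_ring_hom "act_poly (Suc n) A" by (rule comm_ring_hom_act_poly)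
    obtain c where c: "c \<noteq> 0" "act (Suc n) A h = ext_const (poly_const c) * h"
      using semi A by blast
    obtain g where "h = ext_const (l ^ m) * g" using ext_const_dvd l by metis
    then have "ext_const (poly_const c) * h = ext_const (act_poly (Suc n) A l ^ m) * act (Suc n) A g"
      using c(2) by (simp add: act_mult act_const a.hom_power)
    then have "poly_const c * ecoeff h S = act_poly (Suc n) A l ^ m * ecoeff (act (Suc n) A g) S"
      by (metis ecoeff_const_mult)
    then have "act_poly (Suc n) A l ^ m dvd poly_const (inverse c) * (poly_const c * ecoeff h S)"
      by simp
    then show "act_poly (Suc n) A l ^ m dvd ecoeff h S"
      using c(1) by (simp flip: mult.assoc poly_const_mult add: poly_const_1)
  qed
  show ?thesis
  proof (rule dickson_L_power_dvd)
    fix k and v :: "'p fp_poly" assume k: "k < Suc n" and v: "v \<in> lin_forms k"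
    obtain a where a: "v = (\<Sum>i<k. poly_const (a i) * poly_var i)" using lin_forms_coeffs[OF v] by blast
    define b where "b i = (if i < k then - a i else 0)" for i
    have neg: "poly_const (- x) = - (poly_const x :: 'p fp_poly)" for x
      by (simp add: poly_const_def single_uminus)
    have sum_b: "(\<Sum>i<Suc n. poly_const (b i) * poly_var i) = - v"
    proof -
      have "(\<Sum>i<Suc n. poly_const (b i) * poly_var i) = (\<Sum>i<k. poly_const (b i) * poly_var i)"
        by (rule sum.mono_neutral_right) (use k in \<open>auto simp: b_def\<close>)
      then show ?thesis by (simp add: b_def a neg sum_negf)
    qed
    have upd: "(\<Sum>i<Suc n. poly_const ((d(j := x)) i) * poly_var i) =
        (\<Sum>i<Suc n. poly_const (d i) * poly_var i) + poly_const x * poly_var j"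
      if "j < Suc n" "d j = 0" for d :: "nat \<Rightarrow> 'p mod_ring" and j x
    proof -
      have "(\<Sum>i<Suc n. poly_const ((d(j := x)) i) * poly_var i) =
          (\<Sum>i<Suc n. poly_const (d i) * poly_var i + (if i = j then poly_const x * poly_var j else 0))"
        by (rule sum.cong) (use that in auto)
      then show ?thesis using that by (simp add: sum.distrib)
    qed
    have start: "\<forall>S. poly_var n ^ m dvd ecoeff h S" using dvd by blast
    show "(poly_var k - v) ^ m dvd ecoeff h S"
    proof (cases "k = n")
      case True
      let ?A = "column_mat (Suc n) n (b(n := 1))"
      have "act_poly (Suc n) ?A (poly_var n) = poly_var k - v"
        using True upd[of n b 1] sum_b by (simp add: act_poly_var act_var_column_mat b_def poly_const_1)
      then show ?thesis
        using move[OF column_mat_general_linear start, of n "b(n := 1)"] by simp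
    next
      case False
      \<comment> \<open>An invertible single-column substitution for x_n keeps x_n in its image, so
        two are used: x_n \<mapsto> x_n + x_k, and then x_k \<mapsto> x_k - x_n - v, which cancels
        x_n.\<close>
      let ?A = "column_mat (Suc n) n ((\<lambda>_. 0)(n := 1, k := 1))"
      let ?B = "column_mat (Suc n) k (b(n := -1, k := 1))"
      interpret B: comm_ring_hom "act_poly (Suc n) ?B" by (rule comm_ring_hom_act_poly)
      have "act_poly (Suc n) ?A (poly_var n) = (poly_var n + poly_var k :: 'p fp_poly)"
        using False k upd[of k "(\<lambda>_. 0)(n := 1)" 1] upd[of n "\<lambda>_. 0" 1]
        by (simp add: act_poly_var act_var_column_mat poly_const_1 fun_upd_other del: fun_upd_apply sum.lessThan_Suc)
      then have 1: "\<forall>S. (poly_var n + poly_var k) ^ m dvd ecoeff h S"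
        using move[OF column_mat_general_linear start, of n "(\<lambda>_. 0)(n := 1, k := 1)"] False by simp
      have "act_poly (Suc n) ?B (poly_var n + poly_var k) = poly_var k - v"
        using False k upd[of k "b(n := -1)" 1] upd[of n b "-1"] sum_b
        by (simp add: B.hom_add act_poly_var act_var_column_mat poly_const_1 neg b_def fun_upd_other
            del: fun_upd_apply sum.lessThan_Suc)
      then show ?thesis
        using move[OF column_mat_general_linear 1, of k "b(n := -1, k := 1)"] k by simp
    qed
  qed
qed

section \<open>Invariant polynomials\<close>

definition poly_invariants :: "nat \<Rightarrow> 'p::prime_card fp_poly set"
  where "poly_invariants n = {f \<in> polys n. \<forall>A\<in>general_linear n. act_poly n A f = f}"

lemma poly_var_power: "poly_var k ^ d = Poly_Mapping.single (Poly_Mapping.single k d) 1"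
  by (simp add: single_conv_poly_var poly_const_1)

lemma poly_invariants_act_var:
  assumes "f \<in> poly_invariants n" "k < n" "c k \<noteq> 0"
  shows "psubst poly_const (poly_var(k := \<Sum>i<n. poly_const (c i) * poly_var i)) f = f"
proof -
  have "psubst poly_const (poly_var(k := \<Sum>i<n. poly_const (c i) * poly_var i)) f =
      act_poly n (column_mat n k c) f"
    using assms
    by (intro comm_ring_hom_eq_on_polys[OF psubst_hom comm_ring_hom_act_poly, of f n])
      (auto simp: poly_invariants_def comm_ring_hom_poly_const act_poly_var act_var_column_mat
        act_poly_eq_psubst)
  then show ?thesis
    using assms column_mat_general_linear[of k n c] by (simp add: poly_invariants_def)
qed

text \<open>For other \<open>a\<close> the nonzero polynomial X^a - 1 would have all p - 1 units as
  roots, more than its degree.\<close>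

lemma power_eq_1_for_all_units:
  assumes "\<And>c :: 'p::prime_card mod_ring. c \<noteq> 0 \<Longrightarrow> c ^ a = 1"
  shows "a = 0 \<or> CARD('p) - 1 \<le> a"
proof (rule ccontr)
  assume "\<not> ?thesis"
  then have a: "0 < a" "a < CARD('p) - 1" by auto
  let ?f = "Polynomial.monom 1 a - 1 :: 'p mod_ring poly"
  have "Polynomial.coeff ?f a = 1" using a by (simp add: coeff_1)
  then have "?f \<noteq> 0" by (metis coeff_0 zero_neq_one)
  have "UNIV - {0} \<subseteq> {x. poly ?f x = 0}" using assms by (auto simp: poly_monom)
  then have "card (UNIV - {0 :: 'p mod_ring}) \<le> card {x. poly ?f x = 0}"
    by (intro card_mono) auto
  also have "\<dots> \<le> Polynomial.degree ?f" by (rule card_poly_roots_bound[OF \<open>?f \<noteq> 0\<close>])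
  also have "\<dots> \<le> a" by (rule degree_diff_le) (auto simp: degree_monom_le)
  finally show False using a by (simp add: card_Diff_singleton)
qed

text \<open>Scaling x_k by \<open>c\<close> multiplies each monomial by a power of \<open>c\<close>,
  so invariance can be read off monomial by monomial.\<close>

lemma poly_invariants_exponent:
  fixes f :: "'p::prime_card fp_poly"
  assumes f: "f \<in> poly_invariants n" and k: "k < n" and m: "m \<in> Poly_Mapping.keys f"
  shows "Poly_Mapping.lookup m k = 0 \<or> CARD('p) - 1 \<le> Poly_Mapping.lookup m k"
proof (rule power_eq_1_for_all_units)
  fix c :: "'p mod_ring" assume "c \<noteq> 0"
  let ?d = "(\<lambda>_. 0)(k := c)"
  let ?\<sigma> = "poly_var(k := \<Sum>i<n. poly_const (?d i) * poly_var i)"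
  have "(\<Sum>i<n. poly_const (?d i) * poly_var i) = (\<Sum>i<n. if i = k then poly_const c * poly_var k else 0)"
    by (rule sum.cong) auto
  then have \<sigma>: "?\<sigma> = (\<lambda>s. (if s = k then poly_const c else 1) * poly_var s)"
    using k by auto
  have mon: "monomial_eval ?\<sigma> m' = poly_const (c ^ Poly_Mapping.lookup m' k) * monomial_eval poly_var m'"
    if "m' \<in> Poly_Mapping.keys f" for m'
  proof -
    have m': "Poly_Mapping.keys m' \<subseteq> {..<n}"
      using f that by (auto simp: poly_invariants_def polys_def)
    have "(\<Prod>s<n. (if s = k then poly_const c else 1) ^ Poly_Mapping.lookup m' s) =
        (\<Prod>s<n. if s = k then poly_const c ^ Poly_Mapping.lookup m' k else 1)"
      by (rule prod.cong) auto
    then show ?thesis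
      using k by (simp only: monomial_eval_superset[OF _ m'] finite_lessThan \<sigma> power_mult_distrib prod.distrib)
        (simp add: poly_const_power)
  qed
  have "psubst poly_const ?\<sigma> f = f"
    by (rule poly_invariants_act_var) (use assms \<open>c \<noteq> 0\<close> in auto)
  moreover have "psubst poly_const ?\<sigma> f =
      (\<Sum>m'\<in>Poly_Mapping.keys f. Poly_Mapping.single m' (c ^ Poly_Mapping.lookup m' k * Poly_Mapping.lookup f m'))"
    unfolding psubst_def
    by (rule sum.cong, rule refl, subst mon, assumption)
      (simp add: single_conv_poly_var[of _ "_ * _"] poly_const_mult mult_ac)
  ultimately have "f = (\<Sum>m'\<in>Poly_Mapping.keys f.
      Poly_Mapping.single m' (c ^ Poly_Mapping.lookup m' k * Poly_Mapping.lookup f m'))"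
    by simp
  then have "Poly_Mapping.lookup f m = Poly_Mapping.lookup (\<Sum>m'\<in>Poly_Mapping.keys f.
      Poly_Mapping.single m' (c ^ Poly_Mapping.lookup m' k * Poly_Mapping.lookup f m')) m"
    by (rule arg_cong)
  also have "\<dots> = (\<Sum>m'\<in>Poly_Mapping.keys f.
      if m' = m then c ^ Poly_Mapping.lookup m k * Poly_Mapping.lookup f m else 0)"
    unfolding lookup_sum by (rule sum.cong) (auto simp: lookup_single when_def)
  finally have "Poly_Mapping.lookup f m = c ^ Poly_Mapping.lookup m k * Poly_Mapping.lookup f m"
    using m by simp
  then show "c ^ Poly_Mapping.lookup m k = 1"
    using m by (simp add: in_keys_iff)
qed

lemma poly_var_power_dvd:
  assumes "\<And>m. m \<in> Poly_Mapping.keys f \<Longrightarrow> d \<le> Poly_Mapping.lookup m k"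
  shows "poly_var k ^ d dvd f"
proof -
  have "poly_var k ^ d dvd (\<Sum>m\<in>Poly_Mapping.keys f. Poly_Mapping.single m (Poly_Mapping.lookup f m))"
  proof (rule dvd_sum)
    fix m assume "m \<in> Poly_Mapping.keys f"
    then have m: "m = Poly_Mapping.single k d + (m - Poly_Mapping.single k d)"
      using assms by (intro poly_mapping_eqI) (auto simp: lookup_add lookup_minus lookup_single when_def)
    have "Poly_Mapping.single m (Poly_Mapping.lookup f m) =
        poly_var k ^ d * Poly_Mapping.single (m - Poly_Mapping.single k d) (Poly_Mapping.lookup f m)"
      by (simp add: poly_var_power mult_single flip: m)
    then show "poly_var k ^ d dvd Poly_Mapping.single m (Poly_Mapping.lookup f m)" by simp
  qed
  then show ?thesis by (simp add: sum_single_lookup)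
qed

lemma zero_var_eq_sum:
  "zero_var k f = (\<Sum>m\<in>Poly_Mapping.keys f.
    if Poly_Mapping.lookup m k = 0 then Poly_Mapping.single m (Poly_Mapping.lookup f m) else 0)"
  unfolding zero_var_def psubst_def
proof (rule sum.cong)
  fix m assume "m \<in> Poly_Mapping.keys f"
  have "monomial_eval (poly_var(k := 0)) m =
      (if Poly_Mapping.lookup m k = 0 then monomial_eval poly_var m else (0 :: 'a fp_poly))"
  proof (cases "Poly_Mapping.lookup m k = 0")
    case True
    then show ?thesis
      unfolding monomial_eval_def by (auto intro!: prod.cong simp: in_keys_iff)
  next
    case False
    then have "k \<in> Poly_Mapping.keys m" by (simp add: in_keys_iff)
    then show ?thesis
      using False unfolding monomial_eval_def
      by (auto simp: prod_zero_iff zero_power intro!: bexI[of _ k])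
  qed
  then show "poly_const (Poly_Mapping.lookup f m) * monomial_eval (poly_var(k := 0)) m =
      (if Poly_Mapping.lookup m k = 0 then Poly_Mapping.single m (Poly_Mapping.lookup f m) else 0)"
    by (simp add: single_conv_poly_var)
qed simp

lemma lookup_zero_var:
  "Poly_Mapping.lookup (zero_var k f) m = (if Poly_Mapping.lookup m k = 0 then Poly_Mapping.lookup f m else 0)"
proof -
  have "Poly_Mapping.lookup (zero_var k f) m =
      (\<Sum>m'\<in>Poly_Mapping.keys f. if m' = m then (if Poly_Mapping.lookup m k = 0 then Poly_Mapping.lookup f m else 0) else 0)"
    unfolding zero_var_eq_sum lookup_sum by (rule sum.cong) (auto simp: lookup_single when_def)
  then show ?thesis by (auto simp: in_keys_iff)
qed

text \<open>Setting all further variables to 0 fixes \<open>d\<close> and the product, hence by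
  cancellation also the other factor.\<close>

lemma polys_factor:
  assumes "d \<in> polys n" "d \<noteq> 0" "d * g \<in> polys n" shows "g \<in> polys n"
proof -
  let ?h = "psubst poly_const (\<lambda>i. if i < n then poly_var i else 0)"
  interpret h: comm_ring_hom ?h by (rule psubst_hom)
  have "d * ?h g = d * g"
    using psubst_id[OF assms(1), of "\<lambda>i. if i < n then poly_var i else 0"]
      psubst_id[OF assms(3), of "\<lambda>i. if i < n then poly_var i else 0"] by (simp add: h.hom_mult)
  then have "?h g = g" using assms(2) by simp
  moreover obtain k where "g \<in> polys k" by (rule polys_exhaust)
  ultimately show ?thesis
    using psubst_in_polys[of g k "\<lambda>i. if i < n then poly_var i else 0" n] by auto
qed

lemma dickson_Q_0_nonzero: "dickson_Q n 0 \<noteq> 0"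
  by (simp add: dickson_Q_0 dickson_L_nonzero)

lemma poly_invariants_dvd_L_power:
  assumes f: "f \<in> poly_invariants (Suc n)" and dvd: "poly_var n dvd f"
  shows "dickson_Q (Suc n) 0 dvd (f :: 'p::prime_card fp_poly)"
proof -
  interpret z: comm_ring_hom "zero_var n" by (rule comm_ring_hom_zero_var)
  have zero: "zero_var n f = 0" using dvd by (auto simp: dvd_def z.hom_mult)
  have "CARD('p) - 1 \<le> Poly_Mapping.lookup m n" if "m \<in> Poly_Mapping.keys f" for m
    using poly_invariants_exponent[OF f _ that, of n] lookup_zero_var[of n f m] that zero
    by (auto simp: in_keys_iff)
  then have "poly_var n ^ (CARD('p) - 1) dvd f"
    by (rule poly_var_power_dvd)
  \<comment> \<open>Semi-invariants are treated as exterior elements; a polynomial enters as the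
    coefficient at \<open>{}\<close>.\<close>
  then have "dickson_L (Suc n) (Suc n) ^ (CARD('p) - 1) dvd ecoeff (ext_const f) {}"
  proof (intro dickson_L_dvd_semiinvariant)
    fix A :: "'p mod_ring mat" assume "A \<in> general_linear (Suc n)"
    then show "\<exists>c. c \<noteq> 0 \<and> act (Suc n) A (ext_const f) = ext_const (poly_const c) * ext_const f"
      using f by (intro exI[of _ 1]) (simp add: act_const poly_invariants_def poly_const_1 ext_const_1)
  qed (simp add: ext_const.rep_eq)
  then show ?thesis by (simp add: ext_const.rep_eq dickson_Q_0)
qed

lemma dvd_poly_var_if_zero_var:
  assumes "zero_var k f = 0" shows "poly_var k dvd f"
proof -
  have "poly_var k ^ 1 dvd f"
    by (rule poly_var_power_dvd)
      (use assms lookup_zero_var[of k f] in \<open>force simp: in_keys_iff split: if_splits\<close>)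
  then show ?thesis by simp
qed

lemma poly_invariants_add: "f \<in> poly_invariants n \<Longrightarrow> g \<in> poly_invariants n \<Longrightarrow> f + g \<in> poly_invariants n"
  by (auto simp: poly_invariants_def polys_add act_poly_eq_psubst psubst_add comm_ring_hom_poly_const)

lemma poly_invariants_mult: "f \<in> poly_invariants n \<Longrightarrow> g \<in> poly_invariants n \<Longrightarrow> f * g \<in> poly_invariants n"
  by (auto simp: poly_invariants_def polys_mult act_poly_eq_psubst psubst_mult comm_ring_hom_poly_const)

lemma poly_invariants_const: "poly_const c \<in> poly_invariants n"
  by (auto simp: poly_invariants_def act_poly_eq_psubst comm_ring_hom_poly_const)

lemma poly_invariants_1: "1 \<in> poly_invariants n"
  using poly_invariants_const[of 1] by (simp add: poly_const_1)

lemma poly_invariants_diff: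
  assumes "f \<in> poly_invariants n" "g \<in> poly_invariants n" shows "f - g \<in> poly_invariants n"
proof -
  have "poly_const (-1) = (-1 :: 'a fp_poly)"
    by (metis poly_const_1 poly_const_def single_uminus)
  then have "f - g = f + poly_const (-1) * g" by simp
  then show ?thesis
    using assms by (metis poly_invariants_add poly_invariants_mult poly_invariants_const)
qed

lemma poly_invariants_power: "f \<in> poly_invariants n \<Longrightarrow> f ^ k \<in> poly_invariants n"
  by (induction k) (auto intro: poly_invariants_mult poly_invariants_1)

lemma poly_invariants_prod:
  "(\<And>x. x \<in> B \<Longrightarrow> h x \<in> poly_invariants n) \<Longrightarrow> prod h B \<in> poly_invariants n"
  by (induction B rule: infinite_finite_induct) (auto intro: poly_invariants_mult poly_invariants_1)

lemma dickson_Q_in_poly_invariants: "i \<le> n \<Longrightarrow> dickson_Q n i \<in> poly_invariants n"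
  by (simp add: poly_invariants_def dickson_Q_in_polys act_dickson_Q)

lemma poly_invariants_factor:
  assumes d: "d \<in> poly_invariants n" "d \<noteq> 0" and dg: "d * g \<in> poly_invariants n"
  shows "g \<in> poly_invariants n"
proof -
  have "act_poly n A g = g" if "A \<in> general_linear n" for A
  proof -
    interpret a: comm_ring_hom "act_poly n A" by (rule comm_ring_hom_act_poly)
    have "d * act_poly n A g = d * g"
      using d dg that a.hom_mult[of d g] by (simp add: poly_invariants_def)
    then show ?thesis using d by simp
  qed
  then show ?thesis
    using assms polys_factor by (auto simp: poly_invariants_def)
qed

section \<open>Restrictions of invariants are p-th powers\<close>

lemma coeff_1_linear_power:
  "Polynomial.coeff ([:a, 1:] ^ k) 1 = of_nat k * a ^ (k - 1)" for a :: "'a::{comm_ring_1,semiring_no_zero_divisors}"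
proof -
  have "Polynomial.coeff ([:a, 1:] ^ k) 1 = Polynomial.coeff (pderiv ([:a, 1:] ^ k)) 0"
    by (simp add: coeff_pderiv)
  also have "\<dots> = poly (pderiv ([:a, 1:] ^ k)) 0"
    by (simp add: poly_0_coeff_0)
  also have "\<dots> = of_nat k * a ^ (k - 1)"
    by (simp add: pderiv_power pderiv_pCons)
  finally show ?thesis .
qed

text \<open>Compare the coefficients of \<open>x\<^sub>n\<close> in \<open>f\<close> and in its image under \<open>x\<^sub>i \<mapsto> x\<^sub>i + x\<^sub>n\<close>. As
  \<open>p > 2\<close>, no monomial of \<open>f\<close> is linear in \<open>x\<^sub>n\<close>, so the partial derivative with respect to \<open>x\<^sub>i\<close> of
  the part of \<open>f\<close> not involving \<open>x\<^sub>n\<close> vanishes.\<close>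

lemma poly_invariants_p_dvd_exponent:
  fixes f :: "'p::prime_card fp_poly"
  assumes odd: "odd CARD('p)" and f: "f \<in> poly_invariants (Suc n)" and i: "i < n"
    and m: "m \<in> Poly_Mapping.keys f" "Poly_Mapping.lookup m n = 0"
  shows "CARD('p) dvd Poly_Mapping.lookup m i"
proof (cases "Poly_Mapping.lookup m i = 0")
  case False
  \<comment> \<open>\<open>?X\<close> makes x_n the formal variable, and \<open>?Y\<close> is
    \<open>?X\<close> after x_i \<mapsto> x_i + x_n. Hence both agree on \<open>f\<close>, and their
    coefficients of degree 1 can be compared.\<close>
  let ?X = "\<lambda>s. if s = n then [:0, 1:] else [:poly_var s:] :: 'p fp_poly poly"
  let ?Y = "?X(i := [:poly_var i, 1:])"
  let ?C = "\<lambda>c :: 'p mod_ring. [:poly_const c:]"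
  have C: "comm_ring_hom ?C"
    by unfold_locales (simp_all add: poly_const_add poly_const_mult poly_const_1 one_pCons)
  interpret X: comm_ring_hom "psubst ?C ?X" by (rule comm_ring_hom_psubst[OF C])
  interpret Y: comm_ring_hom "psubst ?C ?Y" by (rule comm_ring_hom_psubst[OF C])
  let ?d = "(\<lambda>_. 0)(i := 1, n := 1) :: nat \<Rightarrow> 'p mod_ring"
  define \<sigma> where "\<sigma> = poly_var(i := poly_var i + (poly_var n :: 'p fp_poly))"
  interpret s: comm_ring_hom "psubst poly_const \<sigma>" by (rule psubst_hom)
  have "(\<Sum>j<n. poly_const (?d j) * poly_var j) = (\<Sum>j<n. if j = i then poly_var i else 0)"
    by (rule sum.cong) (auto simp: poly_const_1)
  then have lin: "(\<Sum>j<Suc n. poly_const (?d j) * poly_var j) = poly_var i + poly_var n"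
    using i by (simp add: poly_const_1)
  have "psubst ?C ?X f = psubst ?C ?X (psubst poly_const \<sigma> f)"
    using poly_invariants_act_var[OF f, of i ?d, unfolded lin] i by (simp add: \<sigma>_def)
  also have "\<dots> = psubst ?C ?Y f"
  proof (rule comm_ring_hom_eq_on_polys)
    show "comm_ring_hom (\<lambda>f. psubst ?C ?X (psubst poly_const \<sigma> f))"
      by unfold_locales (simp_all add: X.hom_add s.hom_add X.hom_mult s.hom_mult)
    show "f \<in> polys (Suc n)" using f by (simp add: poly_invariants_def)
    show "psubst ?C ?X (psubst poly_const \<sigma> (poly_var j)) = psubst ?C ?Y (poly_var j)" for j
      using i by (simp add: C comm_ring_hom_poly_const X.hom_add \<sigma>_def)
  qed (rule Y.comm_ring_hom_axioms, simp add: C comm_ring_hom_poly_const)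
  finally have eq: "psubst ?C ?X f = psubst ?C ?Y f" .
  have keys: "Poly_Mapping.keys m' \<subseteq> {..<Suc n}" "Poly_Mapping.lookup m' n \<noteq> 1"
    if "m' \<in> Poly_Mapping.keys f" for m'
  proof -
    show "Poly_Mapping.keys m' \<subseteq> {..<Suc n}" using f that by (auto simp: poly_invariants_def polys_def)
    have "CARD('p) \<noteq> 2" using odd by auto
    then have "2 < CARD('p)" using prime_ge_2_nat[OF prime_card[where 'a='p]] by simp
    then show "Poly_Mapping.lookup m' n \<noteq> 1"
      using poly_invariants_exponent[OF f _ that, of n] by auto
  qed
  define R where "R m' = (\<Prod>s\<in>{..<n} - {i}. poly_var s ^ Poly_Mapping.lookup m' s :: 'p fp_poly)" for m'
  have split: "monomial_eval \<sigma> m' = (\<Prod>s\<in>{..<n} - {i}. \<sigma> s ^ Poly_Mapping.lookup m' s) *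
      \<sigma> i ^ Poly_Mapping.lookup m' i * \<sigma> n ^ Poly_Mapping.lookup m' n"
    if "m' \<in> Poly_Mapping.keys f" for m' and \<sigma> :: "nat \<Rightarrow> 'b::comm_ring_1"
    unfolding monomial_eval_superset[OF finite_lessThan keys(1)[OF that]]
    using i by (simp add: prod.remove[of "{..<n}" i] mult_ac)
  have const_power: "[:a:] ^ k = [:a ^ k:]" for a :: "'p fp_poly" and k
    by (induction k) (simp_all add: one_pCons)
  have const_prod: "(\<Prod>s\<in>B. [:h s:]) = [:\<Prod>s\<in>B. h s:]" for h :: "nat \<Rightarrow> 'p fp_poly" and B
    by (induction B rule: infinite_finite_induct) (simp_all add: one_pCons)
  have t_power: "[:0, 1:] ^ k = (Polynomial.monom 1 k :: 'p fp_poly poly)" for k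
    by (simp add: monom_altdef)
  have R: "(\<Prod>s\<in>{..<n} - {i}. \<sigma> s ^ Poly_Mapping.lookup m' s) = [:R m':]"
    if "\<And>s. s \<in> {..<n} - {i} \<Longrightarrow> \<sigma> s = [:poly_var s:]" for \<sigma> m'
    unfolding R_def const_prod[symmetric] const_power[symmetric]
    by (rule prod.cong) (simp_all add: that)
  have X1: "Polynomial.coeff (monomial_eval ?X m') 1 = 0" if "m' \<in> Poly_Mapping.keys f" for m'
    unfolding split[OF that]
    by (subst R) (use i keys(2)[OF that] in \<open>simp_all add: const_power t_power smult_monom\<close>)
  have Y1: "Polynomial.coeff (monomial_eval ?Y m') 1 =
      (if Poly_Mapping.lookup m' n = 0 then of_nat (Poly_Mapping.lookup m' i) * (R m' * poly_var i ^ (Poly_Mapping.lookup m' i - 1)) else 0)"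
    if "m' \<in> Poly_Mapping.keys f" for m'
  proof -
    have "monomial_eval ?Y m' = Polynomial.monom 1 (Poly_Mapping.lookup m' n) *
        Polynomial.smult (R m') ([:poly_var i, 1:] ^ Poly_Mapping.lookup m' i)"
      unfolding split[OF that] by (subst R) (use i in \<open>simp_all add: t_power mult_ac\<close>)
    then show ?thesis
      using keys(2)[OF that] coeff_1_linear_power[of "poly_var i :: 'p fp_poly" "Poly_Mapping.lookup m' i"]
      by (auto simp: coeff_monom_mult)
  qed
  have single: "of_nat (Poly_Mapping.lookup m' i) * (R m' * poly_var i ^ (Poly_Mapping.lookup m' i - 1)) =
      Poly_Mapping.single (m' - Poly_Mapping.single i 1) (of_nat (Poly_Mapping.lookup m' i) :: 'p mod_ring)"
    if "m' \<in> Poly_Mapping.keys f" "Poly_Mapping.lookup m' n = 0" for m'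
  proof -
    let ?m = "m' - Poly_Mapping.single i 1"
    have "Poly_Mapping.keys ?m \<subseteq> {..<n}"
    proof
      fix s assume "s \<in> Poly_Mapping.keys ?m"
      then have s: "s \<in> Poly_Mapping.keys m'" by (auto simp: in_keys_iff lookup_minus)
      then have "s < Suc n" "s \<noteq> n"
        using keys(1)[OF that(1)] that(2) by (blast, auto simp: in_keys_iff)
      then show "s \<in> {..<n}" by simp
    qed
    then have "monomial_eval poly_var ?m = (\<Prod>s<n. poly_var s ^ Poly_Mapping.lookup ?m s :: 'p fp_poly)"
      by (simp add: monomial_eval_superset)
    also have "\<dots> = poly_var i ^ Poly_Mapping.lookup ?m i *
        (\<Prod>s\<in>{..<n} - {i}. poly_var s ^ Poly_Mapping.lookup ?m s)"
      by (rule prod.remove) (use i in auto)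
    also have "(\<Prod>s\<in>{..<n} - {i}. poly_var s ^ Poly_Mapping.lookup ?m s) = R m'"
      unfolding R_def by (rule prod.cong) (auto simp: lookup_minus lookup_single when_def)
    finally have "monomial_eval poly_var ?m = poly_var i ^ (Poly_Mapping.lookup m' i - 1) * R m'"
      by (simp add: lookup_minus)
    moreover have "poly_const (of_nat k) = (of_nat k :: 'p fp_poly)" for k
      by (simp add: poly_const_def)
    ultimately show ?thesis
      by (simp only: single_conv_poly_var mult_ac)
  qed
  have "Polynomial.coeff (psubst ?C ?X f) 1 = 0"
    unfolding psubst_def by (simp add: coeff_sum X1 del: One_nat_def)
  moreover have "Polynomial.coeff (psubst ?C ?Y f) 1 =
      (\<Sum>m'\<in>Poly_Mapping.keys f. if Poly_Mapping.lookup m' n = 0 then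
        Poly_Mapping.single (m' - Poly_Mapping.single i 1)
          (Poly_Mapping.lookup f m' * of_nat (Poly_Mapping.lookup m' i)) else 0)"
    unfolding psubst_def coeff_sum
    by (rule sum.cong) (simp_all add: Y1 single poly_const_def mult_single del: One_nat_def)
  ultimately have "0 = (\<Sum>m'\<in>Poly_Mapping.keys f. if Poly_Mapping.lookup m' n = 0 then
        Poly_Mapping.single (m' - Poly_Mapping.single i 1)
          (Poly_Mapping.lookup f m' * of_nat (Poly_Mapping.lookup m' i)) else 0)"
    using eq by simp
  then have "0 = Poly_Mapping.lookup (\<Sum>m'\<in>Poly_Mapping.keys f. if Poly_Mapping.lookup m' n = 0 then
        Poly_Mapping.single (m' - Poly_Mapping.single i 1)
          (Poly_Mapping.lookup f m' * of_nat (Poly_Mapping.lookup m' i)) else 0) (m - Poly_Mapping.single i 1)"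
    by (metis lookup_zero)
  also have "\<dots> = (\<Sum>m'\<in>Poly_Mapping.keys f. if m' = m then
      Poly_Mapping.lookup f m * of_nat (Poly_Mapping.lookup m i) else 0)"
    unfolding lookup_sum
  proof (rule sum.cong)
    fix m' assume m': "m' \<in> Poly_Mapping.keys f"
    \<comment> \<open>Subtraction of exponents is truncated, so m' can be recovered only if its
      exponent at \<open>i\<close> is positive; for the other m' the coefficient is 0.\<close>
    have "m' = m" if eq: "m' - Poly_Mapping.single i 1 = m - Poly_Mapping.single i 1"
      and nz: "Poly_Mapping.lookup m' i \<noteq> 0"
    proof (rule poly_mapping_eqI)
      fix s
      have "Poly_Mapping.lookup (m' - Poly_Mapping.single i 1) s = Poly_Mapping.lookup (m - Poly_Mapping.single i 1) s"
        using eq by simp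
      then show "Poly_Mapping.lookup m' s = Poly_Mapping.lookup m s"
        using nz False by (auto simp: lookup_minus lookup_single when_def split: if_splits)
    qed
    then show "Poly_Mapping.lookup (if Poly_Mapping.lookup m' n = 0 then
        Poly_Mapping.single (m' - Poly_Mapping.single i 1)
          (Poly_Mapping.lookup f m' * of_nat (Poly_Mapping.lookup m' i)) else 0) (m - Poly_Mapping.single i 1) =
        (if m' = m then Poly_Mapping.lookup f m * of_nat (Poly_Mapping.lookup m i) else 0)"
      using m(2) by (cases "Poly_Mapping.lookup m' i = 0") (auto simp: lookup_single when_def)
  qed simp
  also have "\<dots> = Poly_Mapping.lookup f m * of_nat (Poly_Mapping.lookup m i)"
    using m by simp
  finally have "of_nat (Poly_Mapping.lookup m i) = (0 :: 'p mod_ring)"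
    using m by (simp add: in_keys_iff)
  then show ?thesis by (rule of_nat_0_mod_ring_dvd)
qed simp

text \<open>Coefficients in F_p are their own p-th powers, so only the exponents have to be divided
  by p.\<close>

lemma p_th_root:
  fixes f :: "'p::prime_card fp_poly"
  assumes f: "f \<in> polys n" and dvd: "\<And>m i. m \<in> Poly_Mapping.keys f \<Longrightarrow> CARD('p) dvd Poly_Mapping.lookup m i"
  obtains g where "g \<in> polys n" "f = g ^ CARD('p)"
proof
  interpret F: comm_ring_hom "\<lambda>f :: 'p fp_poly. f ^ CARD('p)"
    using comm_ring_hom_frobenius[of 1, where 'p='p] by simp
  define M :: "(nat \<Rightarrow>\<^sub>0 nat) \<Rightarrow> 'p fp_poly"
    where "M m = (\<Prod>s\<in>Poly_Mapping.keys m. poly_var s ^ (Poly_Mapping.lookup m s div CARD('p)))" for m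
  let ?g = "\<Sum>m\<in>Poly_Mapping.keys f. poly_const (Poly_Mapping.lookup f m) * M m"
  have M: "M m ^ CARD('p) = monomial_eval poly_var m" if "m \<in> Poly_Mapping.keys f" for m
    unfolding M_def monomial_eval_def prod_power_distrib
    by (rule prod.cong) (use dvd[OF that] in \<open>simp_all add: dvd_div_mult_self flip: power_mult\<close>)
  have "?g ^ CARD('p) = (\<Sum>m\<in>Poly_Mapping.keys f. Poly_Mapping.single m (Poly_Mapping.lookup f m))"
    unfolding F.hom_sum
    using poly_const_frobenius[of _ 1, where 'p='p]
    by (intro sum.cong) (simp_all add: power_mult_distrib M single_conv_poly_var)
  then show "f = ?g ^ CARD('p)" by (simp add: sum_single_lookup)
  show "?g \<in> polys n"
  proof -
    have "s < n" if "m \<in> Poly_Mapping.keys f" "s \<in> Poly_Mapping.keys m" for m s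
      using f that unfolding polys_def by blast
    then show ?thesis
      by (auto simp: M_def intro!: polys_sum polys_mult polys_prod polys_power polysI_var)
  qed
qed

text \<open>Block sum with the identity of size 1. It fixes x_n and preserves the span of the other
  variables, so that it is compatible with restriction to x_n = 0.\<close>

definition extend_mat :: "nat \<Rightarrow> 'p::prime_card mod_ring mat \<Rightarrow> 'p mod_ring mat"
  where "extend_mat n A = mat (Suc n) (Suc n) (\<lambda>(i, j). if i < n \<and> j < n then A $$ (i, j) else if i = j then 1 else 0)"

lemma extend_mat_mult:
  assumes A: "A \<in> carrier_mat n n" and B: "B \<in> carrier_mat n n"
  shows "extend_mat n A * extend_mat n B = extend_mat n (A * B)"
proof (rule eq_matI)
  fix i j assume "i < dim_row (extend_mat n (A * B))" "j < dim_col (extend_mat n (A * B))"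
  then have ij: "i < Suc n" "j < Suc n" by (simp_all add: extend_mat_def)
  have "(extend_mat n A * extend_mat n B) $$ (i, j) =
      (\<Sum>l<n. extend_mat n A $$ (i, l) * extend_mat n B $$ (l, j)) +
        extend_mat n A $$ (i, n) * extend_mat n B $$ (n, j)"
    using ij by (simp add: extend_mat_def scalar_prod_def atLeast0LessThan)
  also have "\<dots> = extend_mat n (A * B) $$ (i, j)"
  proof (cases "i < n \<and> j < n")
    case True
    then show ?thesis
      using A B by (auto simp: extend_mat_def scalar_prod_def atLeast0LessThan intro!: sum.cong)
  next
    case False
    then have "(\<Sum>l<n. extend_mat n A $$ (i, l) * extend_mat n B $$ (l, j)) = 0"
      using ij by (intro sum.neutral) (auto simp: extend_mat_def)
    then show ?thesis using False ij by (auto simp: extend_mat_def)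
  qed
  finally show "(extend_mat n A * extend_mat n B) $$ (i, j) = extend_mat n (A * B) $$ (i, j)" .
qed (simp_all add: extend_mat_def)

lemma extend_mat_general_linear:
  assumes "A \<in> general_linear n" shows "extend_mat n A \<in> general_linear (Suc n)"
proof -
  have A: "A \<in> carrier_mat n n" using general_linear_det(1)[OF assms] .
  obtain B where B: "A * B = 1\<^sub>m n" "B * A = 1\<^sub>m (dim_row B)"
    using assms by (auto simp: general_linear_def invertible_mat_def inverts_mat_def)
  have "dim_col (A * B) = n" "dim_col (B * A) = dim_row B" using B by simp_all
  then have Bc: "B \<in> carrier_mat n n" and row: "dim_row B = n" using A by auto
  have one: "extend_mat n (1\<^sub>m n) = (1\<^sub>m (Suc n) :: 'a mod_ring mat)"
    by (rule eq_matI) (auto simp: extend_mat_def)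
  have "extend_mat n A * extend_mat n B = 1\<^sub>m (Suc n)" "extend_mat n B * extend_mat n A = 1\<^sub>m (Suc n)"
    using extend_mat_mult[OF A Bc] extend_mat_mult[OF Bc A] B one row by simp_all
  moreover have "extend_mat n C \<in> carrier_mat (Suc n) (Suc n)" for C :: "'a mod_ring mat"
    by (simp add: extend_mat_def)
  ultimately show ?thesis
    unfolding general_linear_def invertible_mat_def inverts_mat_def square_mat.simps
    by (metis (mono_tags, lifting) carrier_matD mem_Collect_eq)
qed

lemma zero_var_act_extend_mat:
  assumes f: "f \<in> polys (Suc n)"
  shows "zero_var n (act_poly (Suc n) (extend_mat n A) f) = act_poly n A (zero_var n f)"
proof -
  interpret z: comm_ring_hom "zero_var n" by (rule comm_ring_hom_zero_var)
  interpret a: comm_ring_hom "act_poly n A" by (rule comm_ring_hom_act_poly)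
  interpret b: comm_ring_hom "act_poly (Suc n) (extend_mat n A)" by (rule comm_ring_hom_act_poly)
  show ?thesis
  proof (rule comm_ring_hom_eq_on_polys[OF _ _ f])
    show "comm_ring_hom (\<lambda>f. zero_var n (act_poly (Suc n) (extend_mat n A) f))"
      by unfold_locales (simp_all add: z.hom_add b.hom_add z.hom_mult b.hom_mult)
    show "comm_ring_hom (\<lambda>f. act_poly n A (zero_var n f))"
      by unfold_locales (simp_all add: z.hom_add a.hom_add z.hom_mult a.hom_mult)
    show "zero_var n (act_poly (Suc n) (extend_mat n A) (poly_const c)) =
        act_poly n A (zero_var n (poly_const c))" for c
      by (simp add: act_poly_eq_psubst comm_ring_hom_poly_const)
    fix s assume s: "s < Suc n"
    have "zero_var n (act_var (Suc n) (extend_mat n A) s) =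
        (\<Sum>i<n. poly_const (extend_mat n A $$ (i, s)) * poly_var i)"
      by (simp add: act_var_def z.hom_add z.hom_sum z.hom_mult)
    also have "\<dots> = (if s < n then act_var n A s else 0)"
      using s by (auto simp: act_var_def extend_mat_def intro!: sum.cong sum.neutral)
    finally show "zero_var n (act_poly (Suc n) (extend_mat n A) (poly_var s)) =
        act_poly n A (zero_var n (poly_var s))"
      using s by (auto simp: act_poly_var)
  qed
qed

lemma zero_var_in_polys: "f \<in> polys (Suc n) \<Longrightarrow> zero_var n f \<in> polys n"
  unfolding zero_var_def by (rule psubst_in_polys) auto

text \<open>The root inherits invariance from the restriction, because p-th powers determine their
  roots and block matrices act compatibly.\<close>

lemma zero_var_invariant_root:
  fixes f :: "'p::prime_card fp_poly"
  assumes odd: "odd CARD('p)" and f: "f \<in> poly_invariants (Suc n)"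
  obtains g where "g \<in> poly_invariants n" "zero_var n f = g ^ CARD('p)"
proof -
  interpret F: comm_ring_hom "\<lambda>f :: 'p fp_poly. f ^ CARD('p)"
    using comm_ring_hom_frobenius[of 1, where 'p='p] by simp
  have fp: "f \<in> polys (Suc n)" using f by (simp add: poly_invariants_def)
  have "CARD('p) dvd Poly_Mapping.lookup m i" if m: "m \<in> Poly_Mapping.keys (zero_var n f)" for m i
  proof (cases "i < n")
    case True
    then show ?thesis
      using poly_invariants_p_dvd_exponent[OF odd f True, of m] m lookup_zero_var[of n f m]
      by (auto simp: in_keys_iff split: if_splits)
  next
    case False
    then have "Poly_Mapping.lookup m i = 0"
      using zero_var_in_polys[OF fp] m by (fastforce simp: polys_def in_keys_iff)
    then show ?thesis by simp
  qed
  then obtain g where g: "g \<in> polys n" "zero_var n f = g ^ CARD('p)"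
    using p_th_root[OF zero_var_in_polys[OF fp]] by blast
  have "act_poly n A g = g" if A: "A \<in> general_linear n" for A
  proof -
    interpret a: comm_ring_hom "act_poly n A" by (rule comm_ring_hom_act_poly)
    have "act_poly (Suc n) (extend_mat n A) f = f"
      using f extend_mat_general_linear[OF A] by (simp add: poly_invariants_def)
    then have "act_poly n A (g ^ CARD('p)) = g ^ CARD('p)"
      using zero_var_act_extend_mat[OF fp, of A] g(2) by simp
    then have "(act_poly n A g - g) ^ CARD('p) = 0"
      by (simp add: F.hom_minus a.hom_power)
    then show ?thesis by simp
  qed
  then have "g \<in> poly_invariants n" using g by (simp add: poly_invariants_def)
  then show ?thesis using that g(2) by blast
qed

text \<open>The total degree is the degree in \<open>t\<close> after substituting \<open>t x\<^sub>i\<close> for \<open>x\<^sub>i\<close>.\<close>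

definition homogenize :: "'p::prime_card fp_poly \<Rightarrow> 'p fp_poly poly"
  where "homogenize = psubst (\<lambda>c. [:poly_const c:]) (\<lambda>s. [:0, poly_var s:])"

lemma comm_ring_hom_const_poly: "comm_ring_hom (\<lambda>c. [:poly_const c:])"
  by unfold_locales (simp_all add: poly_const_add poly_const_mult poly_const_1 one_pCons)

lemma comm_ring_hom_homogenize: "comm_ring_hom homogenize"
  unfolding homogenize_def by (rule comm_ring_hom_psubst[OF comm_ring_hom_const_poly])

lemma homogenize_const [simp]: "homogenize (poly_const c) = [:poly_const c:]"
  and homogenize_var [simp]: "homogenize (poly_var i) = [:0, poly_var i:]"
  by (simp_all add: homogenize_def comm_ring_hom_const_poly)

definition total_degree :: "'p::prime_card fp_poly \<Rightarrow> nat"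
  where "total_degree f = Polynomial.degree (homogenize f)"

text \<open>Evaluation at t = 1 recovers \<open>f\<close>.\<close>

lemma homogenize_eq_0_iff [simp]: "homogenize f = 0 \<longleftrightarrow> f = 0"
proof -
  interpret h: comm_ring_hom homogenize by (rule comm_ring_hom_homogenize)
  obtain n where n: "f \<in> polys n" by (rule polys_exhaust)
  have "poly (homogenize f) 1 = f"
    by (rule comm_ring_hom_eq_on_polys[OF _ _ n, of "\<lambda>f. poly (homogenize f) 1" "\<lambda>f. f"])
      (unfold_locales, simp_all add: h.hom_add h.hom_mult)
  then show ?thesis using h.hom_zero by (metis poly_0)
qed

lemma total_degree_mult: "f \<noteq> 0 \<Longrightarrow> g \<noteq> 0 \<Longrightarrow> total_degree (f * g) = total_degree f + total_degree g"
  by (simp add: total_degree_def homogenize_def psubst_mult[OF comm_ring_hom_const_poly] degree_mult_eq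
      homogenize_eq_0_iff[unfolded homogenize_def])

lemma total_degree_mult_le: "total_degree (f * g) \<le> total_degree f + total_degree g"
  by (simp add: total_degree_def homogenize_def psubst_mult[OF comm_ring_hom_const_poly] degree_mult_le)

lemma total_degree_add_le: "total_degree f \<le> d \<Longrightarrow> total_degree g \<le> d \<Longrightarrow> total_degree (f + g) \<le> d"
  by (simp add: total_degree_def homogenize_def psubst_add[OF comm_ring_hom_const_poly] degree_add_le)

lemma total_degree_const [simp]: "total_degree (poly_const c) = 0"
  by (simp add: total_degree_def)

lemma total_degree_0 [simp]: "total_degree 0 = 0"
  using total_degree_const[of 0] by simp

lemma total_degree_power: "total_degree (f ^ k) = k * total_degree f"
proof (cases "f = 0")
  case False
  then show ?thesis
    using total_degree_const[of 1]
    by (induction k) (simp_all add: total_degree_mult poly_const_1)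
next
  case True
  then show ?thesis using total_degree_const[of 1] by (cases k) (simp_all add: poly_const_1)
qed

lemma homogenize_lin_forms: "v \<in> lin_forms n \<Longrightarrow> homogenize v = [:0, v:]"
proof (induction n arbitrary: v)
  case 0
  interpret h: comm_ring_hom homogenize by (rule comm_ring_hom_homogenize)
  show ?case using 0 by simp
next
  case (Suc n)
  interpret h: comm_ring_hom homogenize by (rule comm_ring_hom_homogenize)
  show ?case using Suc by (auto simp: h.hom_add h.hom_mult)
qed

lemma total_degree_zero_var: "total_degree (zero_var n f) \<le> total_degree f"
proof -
  interpret h: comm_ring_hom homogenize by (rule comm_ring_hom_homogenize)
  interpret z: comm_ring_hom "zero_var n" by (rule comm_ring_hom_zero_var)
  interpret zp: map_poly_comm_ring_hom "zero_var n" ..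
  obtain k where k: "f \<in> polys k" by (rule polys_exhaust)
  have "homogenize (zero_var n f) = map_poly (zero_var n) (homogenize f)"
  proof (rule comm_ring_hom_eq_on_polys[OF _ _ k])
    show "comm_ring_hom (\<lambda>f. homogenize (zero_var n f))"
      by unfold_locales (simp_all add: h.hom_add z.hom_add h.hom_mult z.hom_mult)
    show "comm_ring_hom (\<lambda>f. map_poly (zero_var n) (homogenize f))"
      by unfold_locales (simp_all add: h.hom_add zp.hom_add h.hom_mult zp.hom_mult)
  qed (auto simp: z.map_poly_pCons_hom)
  then show ?thesis by (simp add: total_degree_def degree_map_poly_le)
qed

text \<open>The coefficient at X^k in a product of p^n factors X - v is a sum of products of p^n - k
  linear forms.\<close>

lemma total_degree_dickson_Q: "total_degree (dickson_Q n i :: 'p::prime_card fp_poly) \<le> CARD('p) ^ n - CARD('p) ^ i"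
proof -
  interpret h: comm_ring_hom homogenize by (rule comm_ring_hom_homogenize)
  \<comment> \<open>\<open>total_degree 0\<close> is 0, so coefficients beyond the degree in X have
    to be exempted from the bound.\<close>
  have "Polynomial.coeff (\<Prod>v\<in>B. [:- v, 1:]) k = 0 \<or>
      total_degree (Polynomial.coeff (\<Prod>v\<in>B. [:- v, 1:]) k) + k \<le> card B"
    if "finite B" "B \<subseteq> lin_forms n" for B :: "'p fp_poly set" and k
    using that
  proof (induction B arbitrary: k)
    case empty
    then show ?case using total_degree_const[of "1 :: 'p mod_ring"] by (cases k) (simp_all add: poly_const_1)
  next
    case (insert v B)
    let ?f = "\<Prod>v\<in>B. [:- v, 1:]"
    have add: "a + b = 0 \<or> total_degree (a + b) + k \<le> N"
      if "a = 0 \<or> total_degree a + k \<le> N" "b = 0 \<or> total_degree b + k \<le> N" for a b :: "'p fp_poly" and N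
      using that total_degree_add_le[of a "N - k" b] by (cases "k \<le> N") (auto simp: le_diff_conv2)
    have v: "total_degree v \<le> 1"
      using insert.prems by (simp add: total_degree_def homogenize_lin_forms[of v n])
    have minus: "total_degree (- (v * c)) \<le> 1 + total_degree c" for c
      using total_degree_mult_le[of v c] v by (simp add: total_degree_def h.hom_uminus)
    have eq: "Polynomial.coeff (\<Prod>v\<in>insert v B. [:- v, 1:]) k =
        - (v * Polynomial.coeff ?f k) + (case k of 0 \<Rightarrow> 0 | Suc j \<Rightarrow> Polynomial.coeff ?f j)"
      using insert.hyps by (simp add: coeff_pCons split: nat.split)
    show ?case
      unfolding eq
    proof (rule add)
      show "- (v * Polynomial.coeff ?f k) = 0 \<or> total_degree (- (v * Polynomial.coeff ?f k)) + k \<le> card (insert v B)"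
        using insert.IH[of k] insert.prems insert.hyps minus[of "Polynomial.coeff ?f k"] by auto
      show "(case k of 0 \<Rightarrow> 0 | Suc j \<Rightarrow> Polynomial.coeff ?f j) = 0 \<or>
          total_degree (case k of 0 \<Rightarrow> 0 | Suc j \<Rightarrow> Polynomial.coeff ?f j) + k \<le> card (insert v B)"
        using insert.IH[of "k - 1"] insert.prems insert.hyps by (auto split: nat.split)
    qed
  qed
  from this[OF finite_lin_forms order.refl, of "CARD('p) ^ i"] show ?thesis
    by (auto simp: dickson_Q_def lin_poly_def card_lin_forms minus_one_power_iff total_degree_def h.hom_uminus)
qed

lemma sum_p_powers: "(\<Sum>k<n. CARD('p::prime_card) ^ k) * (CARD('p) - 1) = CARD('p) ^ n - 1"
  by (induction n) (simp_all add: algebra_simps)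

text \<open>Here the exact value matters, since division by q_{n,0} has to lower the degree. L_n is
  a product of p^0 + ... + p^(n-1) linear forms, and q_{n,0} is its power with exponent p -
  1.\<close>

lemma total_degree_dickson_Q_0: "total_degree (dickson_Q n 0 :: 'p::prime_card fp_poly) = CARD('p) ^ n - 1"
proof -
  have one: "total_degree (1 :: 'p fp_poly) = 0"
    using total_degree_const[of "1 :: 'p mod_ring"] by (simp add: poly_const_1)
  have prod: "total_degree (\<Prod>x\<in>B. f x) = (\<Sum>x\<in>B. total_degree (f x))"
    if "finite B" "\<And>x. x \<in> B \<Longrightarrow> f x \<noteq> 0" for f :: "'c \<Rightarrow> 'p fp_poly" and B
    using that by (induction B) (simp_all add: one total_degree_mult)
  have "total_degree (poly_var k - v) = 1" if "v \<in> lin_forms k" for k and v :: "'p fp_poly"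
  proof -
    interpret h: comm_ring_hom homogenize by (rule comm_ring_hom_homogenize)
    show ?thesis
      using minus_var_nonzero[OF that] that
      by (simp add: total_degree_def h.hom_minus homogenize_lin_forms)
  qed
  moreover have neq: "poly_var k \<noteq> v" if "v \<in> lin_forms k" for k and v :: "'p fp_poly"
    using minus_var_nonzero[OF that] by auto
  ultimately have "total_degree (\<Prod>v\<in>lin_forms k. poly_var k - v :: 'p fp_poly) = CARD('p) ^ k" for k
    by (subst prod) (simp_all add: finite_lin_forms card_lin_forms)
  then have "total_degree (dickson_L n n :: 'p fp_poly) = (\<Sum>k<n. CARD('p) ^ k)"
    unfolding dickson_L_prod
    by (subst prod) (auto simp: finite_lin_forms prod_zero_iff dest: neq)
  then show ?thesis
    using sum_p_powers[of n, where 'p='p] by (simp add: dickson_Q_0 total_degree_power mult.commute)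
qed

section \<open>Dickson monomials span the invariant polynomials\<close>

definition dickson_monomial :: "nat \<Rightarrow> (nat \<Rightarrow> nat) \<Rightarrow> 'p::prime_card fp_poly"
  where "dickson_monomial n a = (\<Prod>i<n. dickson_Q n i ^ a i)"

text \<open>The index \<open>d\<close> bounds the weights of the monomials and thereby the total
  degree. Zero arises from \<open>const_mult\<close> with c = 0.\<close>

inductive dickson_span :: "nat \<Rightarrow> nat \<Rightarrow> 'p::prime_card fp_poly \<Rightarrow> bool" for n where
  monomial: "(\<Sum>i<n. a i * (CARD('p) ^ n - CARD('p) ^ i)) \<le> d \<Longrightarrow>
    dickson_span n d (dickson_monomial n a :: 'p fp_poly)"
| add: "dickson_span n d f \<Longrightarrow> dickson_span n d g \<Longrightarrow> dickson_span n d (f + g)"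
| const_mult: "dickson_span n d f \<Longrightarrow> dickson_span n d (poly_const c * f)"

lemma dickson_span_mono: "dickson_span n d f \<Longrightarrow> d \<le> e \<Longrightarrow> dickson_span n e f"
  by (induction rule: dickson_span.induct) (auto intro: dickson_span.intros)

lemma dickson_monomial_in_poly_invariants: "dickson_monomial n a \<in> poly_invariants n"
  unfolding dickson_monomial_def
  by (intro poly_invariants_prod poly_invariants_power dickson_Q_in_poly_invariants) simp

lemma dickson_span_in_poly_invariants: "dickson_span n d f \<Longrightarrow> f \<in> poly_invariants n"
  by (induction rule: dickson_span.induct)
    (auto intro: dickson_monomial_in_poly_invariants poly_invariants_add poly_invariants_mult poly_invariants_const)

lemma total_degree_prod_le: "total_degree (\<Prod>x\<in>B. f x) \<le> (\<Sum>x\<in>B. total_degree (f x))"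
proof (induction B rule: infinite_finite_induct)
  case (insert x B)
  then show ?case using total_degree_mult_le[of "f x" "prod f B"] by simp
qed (use total_degree_const[of 1] in \<open>simp_all add: poly_const_1\<close>)

lemma dickson_span_total_degree: "dickson_span n d f \<Longrightarrow> total_degree (f :: 'p::prime_card fp_poly) \<le> d"
proof (induction rule: dickson_span.induct)
  case (monomial a d)
  have "total_degree (dickson_monomial n a :: 'p fp_poly) \<le> (\<Sum>i<n. total_degree (dickson_Q n i ^ a i :: 'p fp_poly))"
    unfolding dickson_monomial_def by (rule total_degree_prod_le)
  also have "\<dots> \<le> (\<Sum>i<n. a i * (CARD('p) ^ n - CARD('p) ^ i))"
    by (rule sum_mono) (simp add: total_degree_power total_degree_dickson_Q)
  finally show ?case using monomial by simp
next
  case (add d f g)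
  then show ?case by (simp add: total_degree_add_le)
next
  case (const_mult d f c)
  then show ?case using total_degree_mult_le[of "poly_const c" f] by simp
qed

lemma dickson_span_mult_Q_0:
  "dickson_span (Suc n) e f \<Longrightarrow>
    dickson_span (Suc n) (e + (CARD('p) ^ Suc n - 1)) (dickson_Q (Suc n) 0 * f :: 'p::prime_card fp_poly)"
proof (induction rule: dickson_span.induct)
  case (monomial a d)
  let ?a = "a(0 := Suc (a 0))"
  have "dickson_Q (Suc n) 0 * dickson_monomial (Suc n) a = (dickson_monomial (Suc n) ?a :: 'p fp_poly)"
    by (simp add: dickson_monomial_def prod.lessThan_Suc_shift mult_ac del: prod.lessThan_Suc)
  moreover have "(\<Sum>i<Suc n. ?a i * (CARD('p) ^ Suc n - CARD('p) ^ i)) \<le> d + (CARD('p) ^ Suc n - 1)"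
  proof -
    define w where "w i = CARD('p) ^ Suc n - CARD('p) ^ i" for i
    have "(\<Sum>i<Suc n. ?a i * w i) = (\<Sum>i<Suc n. a i * w i + (if i = 0 then w 0 else 0))"
      by (rule sum.cong) auto
    also have "\<dots> = (\<Sum>i<Suc n. a i * w i) + w 0"
      by (simp add: sum.distrib sum.delta del: sum.lessThan_Suc)
    finally show ?thesis
      using monomial by (simp add: w_def del: sum.lessThan_Suc power_Suc)
  qed
  ultimately show ?case by (metis dickson_span.monomial)
qed (auto simp: distrib_left mult.left_commute intro: dickson_span.intros)

text \<open>q_{n+1,i+1} restricts to q_{n,i}^p, and its weight p^(n+1) - p^(i+1) is p times that of
  q_{n,i}. Sums and constants are respected by Frobenius.\<close>

lemma dickson_span_lift:
  assumes odd: "odd CARD('p)"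
  shows "dickson_span n e g \<Longrightarrow> \<exists>f. dickson_span (Suc n) (CARD('p) * e) f \<and>
    zero_var n f = (g :: 'p::prime_card fp_poly) ^ CARD('p)"
proof (induction rule: dickson_span.induct)
  case (monomial a d)
  interpret z: comm_ring_hom "zero_var n" by (rule comm_ring_hom_zero_var)
  let ?a = "\<lambda>i. if i = 0 then 0 else a (i - 1)"
  have "(\<Sum>i<Suc n. ?a i * (CARD('p) ^ Suc n - CARD('p) ^ i)) =
      CARD('p) * (\<Sum>i<n. a i * (CARD('p) ^ n - CARD('p) ^ i))"
    by (simp add: sum.lessThan_Suc_shift sum_distrib_left diff_mult_distrib2 mult_ac del: sum.lessThan_Suc)
  also have "\<dots> \<le> CARD('p) * d" using monomial by simp
  finally have "dickson_span (Suc n) (CARD('p) * d) (dickson_monomial (Suc n) ?a :: 'p fp_poly)"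
    by (rule dickson_span.monomial)
  moreover have "zero_var n (dickson_monomial (Suc n) ?a) = (dickson_monomial n a :: 'p fp_poly) ^ CARD('p)"
    unfolding dickson_monomial_def
    by (simp add: prod.lessThan_Suc_shift z.hom_prod z.hom_power zero_var_dickson_Q_Suc[OF odd]
        prod_power_distrib mult.commute flip: power_mult del: prod.lessThan_Suc)
  ultimately show ?case by blast
next
  case (add d f g)
  interpret z: comm_ring_hom "zero_var n" by (rule comm_ring_hom_zero_var)
  interpret F: comm_ring_hom "\<lambda>f :: 'p fp_poly. f ^ CARD('p)"
    using comm_ring_hom_frobenius[of 1, where 'p='p] by simp
  obtain f' g' where "dickson_span (Suc n) (CARD('p) * d) f'" "zero_var n f' = f ^ CARD('p)"
    "dickson_span (Suc n) (CARD('p) * d) g'" "zero_var n g' = g ^ CARD('p)"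
    using add.IH by blast
  then show ?case
    by (intro exI[of _ "f' + g'"]) (simp add: dickson_span.add z.hom_add F.hom_add)
next
  case (const_mult d f c)
  interpret z: comm_ring_hom "zero_var n" by (rule comm_ring_hom_zero_var)
  have "poly_const c ^ CARD('p) = (poly_const c :: 'p fp_poly)"
    using poly_const_frobenius[of c 1] by simp
  moreover obtain f' where "dickson_span (Suc n) (CARD('p) * d) f'" "zero_var n f' = f ^ CARD('p)"
    using const_mult.IH by blast
  ultimately show ?case
    by (intro exI[of _ "poly_const c * f'"]) (simp add: dickson_span.const_mult z.hom_mult power_mult_distrib)
qed

lemma polys_0_const: "f \<in> polys 0 \<Longrightarrow> f = poly_const (Poly_Mapping.lookup f 0)"
proof (rule poly_mapping_eqI)
  fix m assume "f \<in> polys 0"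
  then have "Poly_Mapping.lookup f m \<noteq> 0 \<Longrightarrow> m = 0"
    by (auto simp: polys_def in_keys_iff poly_mapping_eq_iff fun_eq_iff)
  then show "Poly_Mapping.lookup f m = Poly_Mapping.lookup (poly_const (Poly_Mapping.lookup f 0)) m"
    by (auto simp: poly_const_def lookup_single when_def)
qed

theorem dickson_invariants:
  assumes odd: "odd CARD('p::prime_card)"
  shows "f \<in> poly_invariants n \<Longrightarrow> dickson_span n (total_degree f) (f :: 'p fp_poly)"
proof (induction n arbitrary: f)
  case 0
  have "dickson_span 0 (total_degree f) (poly_const (Poly_Mapping.lookup f 0) * dickson_monomial 0 (\<lambda>_. 0))"
    by (intro dickson_span.const_mult dickson_span.monomial) simp
  then show ?case
    using 0 polys_0_const[of f] by (simp add: poly_invariants_def dickson_monomial_def)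
next
  case (Suc n)
  note IH = Suc.IH
  show ?case using Suc.prems
  proof (induction "total_degree f" arbitrary: f rule: less_induct)
    case less
    interpret z: comm_ring_hom "zero_var n" by (rule comm_ring_hom_zero_var)
    obtain g where g: "g \<in> poly_invariants n" "zero_var n f = g ^ CARD('p)"
      using zero_var_invariant_root[OF odd less.prems] by blast
    obtain h where h: "dickson_span (Suc n) (CARD('p) * total_degree g) h" "zero_var n h = g ^ CARD('p)"
      using dickson_span_lift[OF odd IH[OF g(1)]] by blast
    \<comment> \<open>Restriction does not raise the degree, so the lift \<open>h\<close> stays
      within the degree of \<open>f\<close> and the difference f - h does too.\<close>
    have "CARD('p) * total_degree g \<le> total_degree f"
      using total_degree_zero_var[of n f] by (simp add: g total_degree_power)
    then have hf: "dickson_span (Suc n) (total_degree f) h"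
      using h(1) dickson_span_mono by blast
    have inv: "f - h \<in> poly_invariants (Suc n)"
      using less.prems dickson_span_in_poly_invariants[OF hf] by (rule poly_invariants_diff)
    have "zero_var n (f - h) = 0" by (simp add: z.hom_minus g h)
    then have "dickson_Q (Suc n) 0 dvd f - h"
      by (intro poly_invariants_dvd_L_power[OF inv] dvd_poly_var_if_zero_var)
    then obtain r where r: "f - h = dickson_Q (Suc n) 0 * r" by blast
    have "dickson_span (Suc n) (total_degree f) (f - h)"
    proof (cases "r = 0")
      case True
      have "dickson_span (Suc n) (total_degree f) (poly_const 0 * h)"
        by (rule dickson_span.const_mult[OF hf])
      then show ?thesis using True r by simp
    next
      case False
      have "total_degree (f - h) \<le> total_degree f"
      proof -
        have "dickson_span (Suc n) (total_degree f) (poly_const (-1) * h)"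
          by (rule dickson_span.const_mult[OF hf])
        then have "total_degree (poly_const (-1) * h) \<le> total_degree f"
          by (rule dickson_span_total_degree)
        moreover have "poly_const (-1) * h = - h"
          by (metis poly_const_1 poly_const_def single_uminus mult_minus1)
        ultimately show ?thesis
          using total_degree_add_le[of f "total_degree f" "- h"] by simp
      qed
      then have deg: "total_degree r + (CARD('p) ^ Suc n - 1) \<le> total_degree f"
        using False by (simp add: r total_degree_mult dickson_Q_0_nonzero total_degree_dickson_Q_0 del: power_Suc)
      have "1 < CARD('p) ^ Suc n"
        using prime_gt_1_nat[OF prime_card[where 'a='p]] by (rule one_less_power) simp
      then have "total_degree r < total_degree f" using deg by linarith
      moreover have "r \<in> poly_invariants (Suc n)"
        by (rule poly_invariants_factor[of "dickson_Q (Suc n) 0"])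
          (use inv r dickson_Q_0_nonzero in \<open>auto intro: dickson_Q_in_poly_invariants\<close>)
      ultimately have "dickson_span (Suc n) (total_degree r) r"
        by (rule less.hyps)
      then show ?thesis
        unfolding r using dickson_span_mult_Q_0 dickson_span_mono deg by blast
    qed
    then have "dickson_span (Suc n) (total_degree f) (h + (f - h))"
      using hf dickson_span.add by blast
    then show ?case by simp
  qed
qed

section \<open>Algebraic independence of the Dickson invariants\<close>

text \<open>At x_n = 0 the monomials containing q_{n+1,0} vanish and the others become p-th powers
  of Dickson monomials in one variable less; extracting the root leads to smaller \<open>n\<close>.
  The remaining terms share a factor q_{n+1,0}, and cancelling it lowers the sum of its exponents.
  Exponents beyond \<open>n\<close> are required to be 0 so that different functions stand for
  different monomials.\<close>

lemma dickson_monomials_independent: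
  assumes odd: "odd CARD('p::prime_card)"
  shows "finite T \<Longrightarrow> (\<And>a i. a \<in> T \<Longrightarrow> n \<le> i \<Longrightarrow> a i = 0) \<Longrightarrow>
    (\<Sum>a\<in>T. poly_const (c a) * dickson_monomial n a) = (0 :: 'p fp_poly) \<Longrightarrow> \<forall>a\<in>T. c a = 0"
proof (induction n arbitrary: T c)
  case 0
  then have T: "T \<subseteq> {\<lambda>_. 0}" by auto
  show ?case
  proof
    fix a assume "a \<in> T"
    then have "T = {a}" "a = (\<lambda>_. 0)" using T by blast+
    then show "c a = 0" using 0 by (simp add: dickson_monomial_def)
  qed
next
  case (Suc n)
  note IH = Suc.IH
  show ?case using Suc.prems
  proof (induction "\<Sum>a\<in>T. a 0" arbitrary: T c rule: less_induct)
    case less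
    interpret z: comm_ring_hom "zero_var n" by (rule comm_ring_hom_zero_var)
    interpret F: comm_ring_hom "\<lambda>f :: 'p fp_poly. f ^ CARD('p)"
      using comm_ring_hom_frobenius[of 1, where 'p='p] by simp
    define T0 where "T0 = {a \<in> T. a 0 = 0}"
    define T1 where "T1 = {a \<in> T. a 0 \<noteq> 0}"
    have fin: "finite T0" "finite T1" using less.prems(1) by (simp_all add: T0_def T1_def)
    \<comment> \<open>\<open>un\<close> undoes the index shift \<open>sh\<close> on
      \<open>T0\<close>, as \<open>up\<close> below undoes the division \<open>dn\<close> on
      \<open>T1\<close>. These inverses transport the coefficients \<open>c\<close> to the reindexed
      sums.\<close>
    define sh where "sh a i = a (Suc i)" for a :: "nat \<Rightarrow> nat" and i
    define un where "un b i = (if i = 0 then 0 else b (i - 1))" for b :: "nat \<Rightarrow> nat" and i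
    have un_sh: "un (sh a) = a" if "a \<in> T0" for a
      using that by (auto simp: T0_def fun_eq_iff sh_def un_def)
    have zm: "zero_var n (dickson_monomial (Suc n) a) =
        (if a 0 = 0 then (dickson_monomial n (sh a) :: 'p fp_poly) ^ CARD('p) else 0)" for a
      unfolding dickson_monomial_def
      by (simp add: sh_def prod.lessThan_Suc_shift z.hom_mult z.hom_prod z.hom_power zero_var_dickson_Q_Suc[OF odd]
          zero_var_dickson_Q_0[OF odd] prod_power_distrib mult.commute zero_power flip: power_mult del: prod.lessThan_Suc)
    have cp: "poly_const x ^ CARD('p) = (poly_const x :: 'p fp_poly)" for x
      using poly_const_frobenius[of x 1] by simp
    have "0 = zero_var n (\<Sum>a\<in>T. poly_const (c a) * dickson_monomial (Suc n) a :: 'p fp_poly)"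
      using less.prems(3) by simp
    also have "\<dots> = (\<Sum>a\<in>T. if a 0 = 0 then (poly_const (c a) * dickson_monomial n (sh a) :: 'p fp_poly) ^ CARD('p) else 0)"
      unfolding z.hom_sum by (rule sum.cong) (simp_all add: z.hom_mult zm power_mult_distrib cp)
    also have "\<dots> = (\<Sum>a\<in>T0. (poly_const (c a) * dickson_monomial n (sh a) :: 'p fp_poly) ^ CARD('p))"
      unfolding T0_def using less.prems(1) by (simp add: sum.inter_filter)
    also have "\<dots> = (\<Sum>a\<in>T0. poly_const (c a) * dickson_monomial n (sh a) :: 'p fp_poly) ^ CARD('p)"
      by (rule F.hom_sum[symmetric])
    finally have "(\<Sum>a\<in>T0. poly_const (c a) * dickson_monomial n (sh a) :: 'p fp_poly) ^ CARD('p) = 0"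
      by (rule sym)
    then have zero0: "(\<Sum>a\<in>T0. poly_const (c a) * dickson_monomial n (sh a) :: 'p fp_poly) = 0"
      by (rule power_eq_0_iff[THEN iffD1, THEN conjunct1])
    have "(\<Sum>a\<in>T0. poly_const (c a) * dickson_monomial n (sh a) :: 'p fp_poly) =
        (\<Sum>b\<in>sh ` T0. poly_const (c (un b)) * dickson_monomial n b)"
    proof (subst sum.reindex)
      show "inj_on sh T0" by (rule inj_on_inverseI[of _ un]) (rule un_sh)
      show "(\<Sum>a\<in>T0. poly_const (c a) * dickson_monomial n (sh a) :: 'p fp_poly) =
          sum ((\<lambda>b. poly_const (c (un b)) * dickson_monomial n b) \<circ> sh) T0"
        by (rule sum.cong) (simp_all only: o_def un_sh)
    qed
    then have "(\<Sum>b\<in>sh ` T0. poly_const (c (un b)) * dickson_monomial n b :: 'p fp_poly) = 0"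
      using zero0 by (rule trans[OF sym])
    then have "\<forall>b\<in>sh ` T0. c (un b) = 0"
      using fin less.prems(2) by (intro IH) (auto simp: T0_def sh_def)
    then have c0: "c a = 0" if "a \<in> T0" for a
      using that un_sh[OF that] by (metis imageI)
    define dn where "dn a = a(0 := a 0 - 1)" for a :: "nat \<Rightarrow> nat"
    define up where "up a = a(0 := Suc (a 0))" for a :: "nat \<Rightarrow> nat"
    have up_dn: "up (dn a) = a" if "a \<in> T1" for a
      using that by (auto simp: T1_def dn_def up_def)
    have mon: "dickson_monomial (Suc n) a = dickson_Q (Suc n) 0 * (dickson_monomial (Suc n) (dn a) :: 'p fp_poly)"
      if "a \<in> T1" for a
    proof -
      obtain k where "a 0 = Suc k" using \<open>a \<in> T1\<close> by (auto simp: T1_def gr0_conv_Suc)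
      then show ?thesis
        by (simp add: dickson_monomial_def dn_def prod.lessThan_Suc_shift mult.assoc del: prod.lessThan_Suc)
    qed
    have "0 = (\<Sum>a\<in>T0. poly_const (c a) * dickson_monomial (Suc n) a :: 'p fp_poly) +
        (\<Sum>a\<in>T1. poly_const (c a) * dickson_monomial (Suc n) a)"
    proof -
      have "T = T0 \<union> T1" "T0 \<inter> T1 = {}" by (auto simp: T0_def T1_def)
      then show ?thesis using less.prems(3) fin by (simp add: sum.union_disjoint)
    qed
    also have "\<dots> = dickson_Q (Suc n) 0 * (\<Sum>a\<in>T1. poly_const (c a) * dickson_monomial (Suc n) (dn a))"
      by (simp add: c0 sum_distrib_left mon mult.left_commute)
    finally have zero1: "(\<Sum>a\<in>T1. poly_const (c a) * dickson_monomial (Suc n) (dn a) :: 'p fp_poly) = 0"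
      using dickson_Q_0_nonzero[of "Suc n", where 'a='p] by simp
    have inj: "inj_on dn T1" by (rule inj_on_inverseI[of _ up]) (rule up_dn)
    have "(\<Sum>a\<in>T1. poly_const (c a) * dickson_monomial (Suc n) (dn a) :: 'p fp_poly) =
        (\<Sum>b\<in>dn ` T1. poly_const (c (up b)) * dickson_monomial (Suc n) b)"
      by (subst sum.reindex[OF inj], rule sum.cong) (simp_all only: o_def up_dn)
    then have zero: "(\<Sum>b\<in>dn ` T1. poly_const (c (up b)) * dickson_monomial (Suc n) b :: 'p fp_poly) = 0"
      using zero1 by (rule trans[OF sym])
    have "\<forall>b\<in>dn ` T1. c (up b) = 0"
    proof (cases "T1 = {}")
      case False
      have "(\<Sum>b\<in>dn ` T1. b 0) = (\<Sum>a\<in>T1. a 0 - 1)"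
        by (subst sum.reindex[OF inj]) (simp add: dn_def)
      also have "\<dots> < (\<Sum>a\<in>T1. a 0)"
        by (rule sum_strict_mono) (use False fin in \<open>auto simp: T1_def\<close>)
      also have "\<dots> \<le> (\<Sum>a\<in>T. a 0)"
        by (rule sum_mono2) (use less.prems(1) in \<open>auto simp: T1_def\<close>)
      finally show ?thesis
        using zero fin less.prems(2) by (intro less.hyps) (auto simp: T1_def dn_def)
    qed simp
    then have c1: "c a = 0" if "a \<in> T1" for a
      using that up_dn[OF that] by (metis imageI)
    show ?case
    proof
      fix a assume "a \<in> T"
      then have "a \<in> T0 \<or> a \<in> T1" by (auto simp: T0_def T1_def)
      then show "c a = 0" using c0 c1 by blast
    qed
  qed
qed

section \<open>Linear changes of exterior generators\<close>

lemma comm_ring_hom_id: "comm_ring_hom (\<lambda>x. x)"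
  by unfold_locales simp_all

definition ext_lin :: "nat \<Rightarrow> (nat \<Rightarrow> nat \<Rightarrow> 'a::comm_ring_1) \<Rightarrow> 'a ext \<Rightarrow> 'a ext"
  where "ext_lin n X = ext_subst (\<lambda>x. x) (\<lambda>j. \<Sum>s<n. ext_const (X j s) * ext_gen s)"

lemma ext_lin_mult: "ext_lin n X (g * h) = ext_lin n X g * ext_lin n X h"
  unfolding ext_lin_def
  by (rule ext_subst_mult[OF comm_ring_hom_id])
    (rule ext_linear_combs_anticommute, rule ext_linear_comb_square)

lemma ext_lin_const [simp]: "ext_lin n X (ext_const c) = ext_const c"
  unfolding ext_lin_def by (rule ext_subst_const[OF comm_ring_hom_id])

lemma ext_lin_gen [simp]: "ext_lin n X (ext_gen j) = (\<Sum>s<n. ext_const (X j s) * ext_gen s)"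
  unfolding ext_lin_def by (rule ext_subst_gen[OF comm_ring_hom_id])

lemma ext_lin_add: "ext_lin n X (g + h) = ext_lin n X g + ext_lin n X h"
  unfolding ext_lin_def by (rule ext_subst_add[OF comm_ring_hom_id])

lemma ext_lin_0 [simp]: "ext_lin n X 0 = 0"
  unfolding ext_lin_def by (rule ext_subst_0[OF comm_ring_hom_id])

lemma ext_lin_1 [simp]: "ext_lin n X 1 = 1"
  unfolding ext_lin_def by (rule ext_subst_1[OF comm_ring_hom_id])

lemma ext_lin_sum: "ext_lin n X (sum h B) = (\<Sum>x\<in>B. ext_lin n X (h x))"
  unfolding ext_lin_def by (rule ext_subst_sum[OF comm_ring_hom_id])

lemma ext_lin_const_mult: "ext_lin n X (ext_const c * h) = ext_const c * ext_lin n X h"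
  by (simp add: ext_lin_mult)

lemma ext_lin_diff: "ext_lin n X (g - h) = ext_lin n X g - ext_lin n X h"
  using ext_lin_add[of n X "g - h" h] by simp

lemma ext_lin_prod_list: "ext_lin n X (prod_list hs) = prod_list (map (ext_lin n X) hs)"
  by (induction hs) (simp_all add: ext_lin_mult)

definition ext_on :: "nat \<Rightarrow> 'a::comm_ring_1 ext set"
  where "ext_on n = {h. \<forall>S. ecoeff h S \<noteq> 0 \<longrightarrow> S \<subseteq> {..<n}}"

lemma ext_on_alt: "h \<in> ext_on n \<longleftrightarrow> (\<forall>S. \<not> S \<subseteq> {..<n} \<longrightarrow> ecoeff h S = 0)"
  unfolding ext_on_def by blast

lemma ext_on_const [simp]: "ext_const c \<in> ext_on n"
  by (simp add: ext_on_def ext_const.rep_eq)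

lemma ext_on_mult:
  assumes "g \<in> ext_on n" "h \<in> ext_on n" shows "g * h \<in> ext_on n"
proof -
  have "U \<subseteq> {..<n}" if "ecoeff (g * h) U \<noteq> 0" for U
  proof -
    obtain S where "S \<in> Pow U" "koszul S (U - S) * ecoeff g S * ecoeff h (U - S) \<noteq> 0"
      using \<open>ecoeff (g * h) U \<noteq> 0\<close> unfolding ecoeff_mult by (meson sum.neutral)
    then have "S \<subseteq> U" "ecoeff g S \<noteq> 0" "ecoeff h (U - S) \<noteq> 0" by auto
    then have "S \<subseteq> {..<n}" "U - S \<subseteq> {..<n}"
      using assms unfolding ext_on_def by blast+
    then show ?thesis by blast
  qed
  then show ?thesis by (simp add: ext_on_def)
qed

lemma ext_on_1 [simp]: "1 \<in> ext_on n"
  using ext_on_const[of 1] by (simp add: ext_const_1)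

lemma ext_on_power: "h \<in> ext_on n \<Longrightarrow> h ^ k \<in> ext_on n"
  by (induction k) (auto intro: ext_on_mult)

lemma ext_on_prod_list: "(\<And>h. h \<in> set hs \<Longrightarrow> h \<in> ext_on n) \<Longrightarrow> prod_list hs \<in> ext_on n"
  by (induction hs) (auto intro: ext_on_mult)

lemma ext_on_diff: "g \<in> ext_on n \<Longrightarrow> h \<in> ext_on n \<Longrightarrow> g - h \<in> ext_on n"
  by (simp add: ext_on_alt)

lemma ext_const_mult_ext_gen_anticommute:
  "ext_const d * ext_gen i * (ext_const d * ext_gen j) = - (ext_const d * ext_gen j * (ext_const d * ext_gen i))"
  using ext_linear_combs_anticommute[of "\<lambda>_. d" "{i}" "\<lambda>_. d" "{j}"] by simp

lemma ecoeff_ext_subst_scale: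
  "ecoeff (ext_subst (\<lambda>x. x) (\<lambda>j. ext_const d * ext_gen j) h) S = d ^ card S * ecoeff h S"
proof -
  have scale: "prod_list (map (\<lambda>j. ext_const d * ext_gen j) xs) = ext_const (d ^ length xs) * prod_list (map ext_gen xs)" for xs
    by (induction xs) (simp_all add: ext_const_1 ext_const_mult ext_const_left_commute[of "ext_gen _"] mult.assoc)
  have "ecoeff (ext_subst (\<lambda>x. x) (\<lambda>j. ext_const d * ext_gen j) h) S =
      (\<Sum>T | ecoeff h T \<noteq> 0. ecoeff h T * (d ^ card T * ecoeff (ext_base T) S))"
    unfolding ext_subst_def ecoeff_sum
    by (rule sum.cong)
      (simp_all add: scale ecoeff_const_mult ext_base_conv_prod_list finite_if_ecoeff_nonzero)
  also have "\<dots> = (\<Sum>T | ecoeff h T \<noteq> 0. if T = S then d ^ card S * ecoeff h S else 0)"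
    by (rule sum.cong) (auto simp: ecoeff_base finite_if_ecoeff_nonzero)
  also have "\<dots> = d ^ card S * ecoeff h S"
    by (auto simp: finite_ecoeff_support)
  finally show ?thesis .
qed

text \<open>Following with the substitution of \<open>Y\<close> multiplies each generator by
  \<open>d\<close>, hence e_S by d^|S|, which is injective over a domain. An inverse up to a factor
  is what the adjugate provides.\<close>

lemma ext_lin_injective:
  fixes X Y :: "nat \<Rightarrow> nat \<Rightarrow> 'a::idom"
  assumes XY: "\<And>i j. i < n \<Longrightarrow> j < n \<Longrightarrow> (\<Sum>s<n. X j s * Y s i) = (if i = j then d else 0)"
    and d: "d \<noteq> 0" and h: "h \<in> ext_on n" "ext_lin n X h = 0"
  shows "h = 0"
proof -
  let ?D = "ext_subst (\<lambda>x. x) (\<lambda>j. ext_const d * ext_gen j)"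
  have D_mult: "?D (f * g) = ?D f * ?D g" for f g
    using ext_linear_comb_square[of "\<lambda>_. d" "{_}"]
    by (intro ext_subst_mult[OF comm_ring_hom_id]) (rule ext_const_mult_ext_gen_anticommute, simp)
  have "ext_lin n Y (ext_lin n X h) = ?D h"
  proof (rule ext_induct_on[of h "{..<n}" UNIV])
    fix j assume "j \<in> {..<n}"
    have "ext_lin n Y (ext_lin n X (ext_gen j)) =
        (\<Sum>s<n. ext_const (X j s) * (\<Sum>i<n. ext_const (Y s i) * ext_gen i))"
      by (simp add: ext_lin_sum ext_lin_const_mult)
    also have "\<dots> = (\<Sum>i<n. \<Sum>s<n. ext_const (X j s * Y s i) * ext_gen i)"
      by (subst sum.swap) (simp add: sum_distrib_left ext_const_mult mult.assoc)
    also have "\<dots> = (\<Sum>i<n. ext_const (\<Sum>s<n. X j s * Y s i) * ext_gen i)"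
      by (simp add: ext_const_sum sum_distrib_right)
    also have "\<dots> = (\<Sum>i<n. if i = j then ext_const d * ext_gen j else 0)"
      by (rule sum.cong) (use XY \<open>j \<in> _\<close> in auto)
    also have "\<dots> = ?D (ext_gen j)"
      using \<open>j \<in> _\<close> by (simp add: ext_subst_gen[OF comm_ring_hom_id])
    finally show "ext_lin n Y (ext_lin n X (ext_gen j)) = ?D (ext_gen j)" .
  qed (use h(1) in \<open>simp_all add: ext_on_def ext_lin_add ext_lin_mult D_mult
      ext_subst_0[OF comm_ring_hom_id] ext_subst_1[OF comm_ring_hom_id] ext_subst_add[OF comm_ring_hom_id]
      ext_subst_const[OF comm_ring_hom_id]\<close>)
  then have "d ^ card S * ecoeff h S = 0" for S
    using ecoeff_ext_subst_scale[of d h S] h(2) by simp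
  then show ?thesis using d by (intro ext_eqI) simp
qed

lemma ext_map_const [simp]: "comm_ring_hom \<phi> \<Longrightarrow> ext_map \<phi> (ext_const c) = ext_const (\<phi> c)"
  unfolding ext_map_def by (rule ext_subst_const)

lemma ext_map_gen [simp]: "comm_ring_hom \<phi> \<Longrightarrow> ext_map \<phi> (ext_gen i) = ext_gen i"
  unfolding ext_map_def by (rule ext_subst_gen)

lemma ext_map_add: "comm_ring_hom \<phi> \<Longrightarrow> ext_map \<phi> (g + h) = ext_map \<phi> g + ext_map \<phi> h"
  unfolding ext_map_def by (rule ext_subst_add)

lemma ext_map_sum: "comm_ring_hom \<phi> \<Longrightarrow> ext_map \<phi> (sum h B) = (\<Sum>x\<in>B. ext_map \<phi> (h x))"
  unfolding ext_map_def by (rule ext_subst_sum)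

lemma ext_map_1: "comm_ring_hom \<phi> \<Longrightarrow> ext_map \<phi> 1 = 1"
  unfolding ext_map_def by (rule ext_subst_1)

lemma ext_map_0: "comm_ring_hom \<phi> \<Longrightarrow> ext_map \<phi> 0 = 0"
  unfolding ext_map_def by (rule ext_subst_0)

lemma ext_map_ext_lin:
  assumes "comm_ring_hom \<phi>"
  shows "ext_map \<phi> (ext_lin n X h) = ext_lin n (\<lambda>j s. \<phi> (X j s)) (ext_map \<phi> h)"
  by (rule ext_induct_on[of h UNIV UNIV])
    (simp_all add: assms ext_map_add ext_map_sum ext_map_1 ext_map_0 ext_map_mult ext_lin_add ext_lin_mult)

section \<open>The cohomology ring\<close>

lemma cohomology_alt: "cohomology n = {h \<in> ext_on n. \<forall>S. ecoeff h S \<in> polys n}"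
proof -
  have "ecoeff h S \<in> polys n" if "h \<in> cohomology n" for h :: "'a fp_poly ext" and S
    using that by (cases "ecoeff h S = 0") (simp_all add: cohomology_def polys_def)
  moreover have "h \<in> cohomology n \<Longrightarrow> h \<in> ext_on n" for h :: "'a fp_poly ext"
    by (simp add: cohomology_def ext_on_def)
  moreover have "h \<in> ext_on n \<Longrightarrow> \<forall>S. ecoeff h S \<in> polys n \<Longrightarrow> h \<in> cohomology n" for h :: "'a fp_poly ext"
    by (simp add: cohomology_def ext_on_def polys_def)
  ultimately show ?thesis by blast
qed

lemma cohomology_const: "f \<in> polys n \<Longrightarrow> ext_const f \<in> cohomology n"
  by (simp add: cohomology_alt ext_const.rep_eq)

lemma cohomology_gen: "i < n \<Longrightarrow> ext_gen i \<in> cohomology n"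
  by (simp add: cohomology_alt ext_on_def ext_gen.rep_eq)

lemma cohomology_add: "g \<in> cohomology n \<Longrightarrow> h \<in> cohomology n \<Longrightarrow> g + h \<in> cohomology n"
  by (simp add: cohomology_alt ext_on_alt polys_add)

lemma cohomology_mult: "g \<in> cohomology n \<Longrightarrow> h \<in> cohomology n \<Longrightarrow> g * h \<in> cohomology n"
  by (auto simp: cohomology_alt ext_on_mult ecoeff_mult koszul_def
      intro!: polys_sum polys_mult polys_power polys_uminus)

lemma cohomology_0: "0 \<in> cohomology n" by (simp add: cohomology_def)

lemma cohomology_1: "1 \<in> cohomology n"
  using cohomology_const[of 1 n] by (simp add: ext_const_1)

lemma cohomology_sum: "(\<And>x. x \<in> B \<Longrightarrow> h x \<in> cohomology n) \<Longrightarrow> sum h B \<in> cohomology n"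
  by (induction B rule: infinite_finite_induct) (auto intro: cohomology_add cohomology_0)

lemma cohomology_prod_list: "(\<And>h. h \<in> set hs \<Longrightarrow> h \<in> cohomology n) \<Longrightarrow> prod_list hs \<in> cohomology n"
  by (induction hs) (auto intro: cohomology_mult cohomology_1)

lemma cohomology_subset_ext_on: "h \<in> cohomology n \<Longrightarrow> h \<in> ext_on n"
  by (simp add: cohomology_alt)

lemma cohomology_induct [consumes 1, case_names zero one const gen add mult]:
  assumes "h \<in> cohomology n" "P 0" "P 1" "\<And>f. f \<in> polys n \<Longrightarrow> P (ext_const f)"
    "\<And>i. i < n \<Longrightarrow> P (ext_gen i)" "\<And>f g. P f \<Longrightarrow> P g \<Longrightarrow> P (f + g)" "\<And>f g. P f \<Longrightarrow> P g \<Longrightarrow> P (f * g)"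
  shows "P h"
  by (rule ext_induct_on[of h "{..<n}" "polys n"])
    (use assms in \<open>simp_all add: cohomology_alt ext_on_def\<close>)

lemma act_in_cohomology: "h \<in> cohomology n \<Longrightarrow> act n A h \<in> cohomology n"
proof (induction rule: cohomology_induct)
  case (const f)
  have "act_var n A i \<in> polys n" for i
    unfolding act_var_def by (auto intro!: polys_sum polys_mult)
  then show ?case
    using const by (auto simp: act_const act_poly_eq_psubst intro!: cohomology_const psubst_in_polys)
next
  case (gen i)
  show ?case
    unfolding act_ext_gen act_gen_def
    by (auto intro!: cohomology_sum cohomology_mult cohomology_const cohomology_gen)
qed (simp_all add: act_0 act_1 act_add act_mult cohomology_0 cohomology_1 cohomology_add cohomology_mult)

text \<open>The signs are those of the cofactor expansion of \<open>M\<^bsub>n;s\<^esub>\<close> along its row \<open>(e\<^sub>1, \<dots>, e\<^sub>n)\<close>.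
  \<open>frob_map\<close> turns the action on \<open>e\<^sub>j\<close> and \<open>x\<^sub>j\<close> into the action on the coefficients alone, because
  \<open>(x\<^sub>j^(p\<^sup>s))\<^sub>j\<close> transforms like \<open>(e\<^sub>j)\<^sub>j\<close>.\<close>

definition frob_coeff :: "nat \<Rightarrow> nat \<Rightarrow> 'p::prime_card fp_poly"
  where "frob_coeff j s = (-1) ^ s * poly_var j ^ (CARD('p) ^ s)"

abbreviation frob_map :: "nat \<Rightarrow> 'p::prime_card fp_poly ext \<Rightarrow> 'p fp_poly ext"
  where "frob_map n \<equiv> ext_lin n frob_coeff"

text \<open>\<open>Y\<close> is the adjugate of the Moore matrix, whose determinant is L_n; its
  additional signs (-1)^s cancel those in \<open>frob_coeff\<close>.\<close>

lemma frob_coeff_inverse: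
  obtains Y where "\<And>i j. i < n \<Longrightarrow> j < n \<Longrightarrow>
    (\<Sum>s<n. frob_coeff j s * Y s i) = (if i = j then dickson_L n n else (0 :: 'p::prime_card fp_poly))"
proof -
  let ?A = "mat n n (\<lambda>(i, j). poly_var i ^ (CARD('p) ^ ([0..<n] ! j))) :: 'p fp_poly mat"
  have A: "?A \<in> carrier_mat n n" by simp
  have adj: "adj_mat ?A \<in> carrier_mat n n" "?A * adj_mat ?A = det ?A \<cdot>\<^sub>m 1\<^sub>m n"
    using adj_mat[OF A] by simp_all
  have det: "det ?A = dickson_L n n" by (simp add: dickson_L_top bracket_def)
  show ?thesis
  proof (rule that[of "\<lambda>s i. (-1) ^ s * adj_mat ?A $$ (s, i)"])
    fix i j assume ij: "i < n" "j < n"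
    have "(\<Sum>s<n. frob_coeff j s * ((-1) ^ s * adj_mat ?A $$ (s, i))) = (?A * adj_mat ?A) $$ (j, i)"
      using ij adj(1)
      by (auto simp: frob_coeff_def scalar_prod_def atLeast0LessThan minus_one_power_iff intro!: sum.cong)
    also have "\<dots> = (if i = j then dickson_L n n else 0)"
      unfolding adj(2) det using ij by auto
    finally show "(\<Sum>s<n. frob_coeff j s * ((-1) ^ s * adj_mat ?A $$ (s, i))) =
        (if i = j then dickson_L n n else 0)" .
  qed
qed

lemma frob_map_injective:
  assumes "g \<in> ext_on n" "h \<in> ext_on n" "frob_map n g = frob_map n h"
  shows "g = h"
proof -
  obtain Y where Y: "\<And>i j. i < n \<Longrightarrow> j < n \<Longrightarrow>
      (\<Sum>s<n. frob_coeff j s * Y s i) = (if i = j then dickson_L n n else (0 :: 'a fp_poly))"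
    using frob_coeff_inverse by blast
  have "g - h = 0"
    by (rule ext_lin_injective[OF Y dickson_L_nonzero]) (use assms in \<open>simp_all add: ext_on_diff ext_lin_diff\<close>)
  then show ?thesis by simp
qed

lemma frob_map_fract_injective:
  fixes g h :: "'p::prime_card fp_poly fract ext"
  assumes "g \<in> ext_on n" "h \<in> ext_on n"
    "ext_lin n (\<lambda>j s. to_fract (frob_coeff j s)) g = ext_lin n (\<lambda>j s. to_fract (frob_coeff j s)) h"
  shows "g = h"
proof -
  interpret f: comm_ring_hom "to_fract :: 'p fp_poly \<Rightarrow> _" by (rule comm_ring_hom_to_fract)
  obtain Y where Y: "\<And>i j. i < n \<Longrightarrow> j < n \<Longrightarrow>
      (\<Sum>s<n. frob_coeff j s * Y s i) = (if i = j then dickson_L n n else (0 :: 'p fp_poly))"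
    using frob_coeff_inverse by blast
  have Y': "(\<Sum>s<n. to_fract (frob_coeff j s) * to_fract (Y s i)) =
      (if i = j then to_fract (dickson_L n n :: 'p fp_poly) else 0)" if "i < n" "j < n" for i j
    using Y[OF that, THEN arg_cong, of to_fract] by (simp add: f.hom_sum f.hom_mult)
  have "g - h = 0"
    by (rule ext_lin_injective[OF Y']) (use assms dickson_L_nonzero in \<open>simp_all add: ext_on_diff ext_lin_diff\<close>)
  then show ?thesis by simp
qed

lemma frob_map_act: "frob_map n (act n A h) = ext_map (act_poly n A) (frob_map n h)"
proof (rule ext_induct_on[of h UNIV UNIV])
  fix j
  interpret a: comm_ring_hom "act_poly n A" by (rule comm_ring_hom_act_poly)
  have coeff: "(\<Sum>i<n. poly_const (A $$ (i, j)) * frob_coeff i s) = act_poly n A (frob_coeff j s)" for s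
  proof -
    interpret F: comm_ring_hom "\<lambda>f :: 'a fp_poly. f ^ (CARD('a) ^ s)" by (rule comm_ring_hom_frobenius)
    have "act_poly n A (frob_coeff j s) = (-1) ^ s * act_var n A j ^ (CARD('a) ^ s)"
      by (simp add: frob_coeff_def a.hom_mult a.hom_power a.hom_uminus act_poly_var)
    also have "act_var n A j ^ (CARD('a) ^ s) =
        (\<Sum>i<n. poly_const (A $$ (i, j)) * poly_var i ^ (CARD('a) ^ s))"
      unfolding act_var_def F.hom_sum power_mult_distrib poly_const_frobenius ..
    finally show ?thesis by (simp add: frob_coeff_def sum_distrib_left mult_ac)
  qed
  have "frob_map n (act n A (ext_gen j)) =
      (\<Sum>i<n. ext_const (poly_const (A $$ (i, j))) * (\<Sum>s<n. ext_const (frob_coeff i s) * ext_gen s))"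
    by (simp add: act_ext_gen act_gen_def ext_lin_sum ext_lin_const_mult)
  also have "\<dots> = (\<Sum>s<n. \<Sum>i<n. ext_const (poly_const (A $$ (i, j)) * frob_coeff i s) * ext_gen s)"
    by (subst sum.swap) (simp add: sum_distrib_left ext_const_mult mult.assoc)
  also have "\<dots> = (\<Sum>s<n. ext_const (act_poly n A (frob_coeff j s)) * ext_gen s)"
    by (simp add: ext_const_sum sum_distrib_right flip: coeff)
  also have "\<dots> = ext_map (act_poly n A) (frob_map n (ext_gen j))"
    by (simp add: ext_map_sum ext_map_mult comm_ring_hom_act_poly)
  finally show "frob_map n (act n A (ext_gen j)) = ext_map (act_poly n A) (frob_map n (ext_gen j))" .
qed (simp_all add: act_0 act_1 act_const act_add act_mult ext_lin_add ext_lin_mult ext_map_0 ext_map_1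
    ext_map_add ext_map_mult comm_ring_hom_act_poly)

lemma frob_map_in_cohomology: "h \<in> cohomology n \<Longrightarrow> frob_map n h \<in> cohomology n"
proof (induction rule: cohomology_induct)
  case (gen i)
  then show ?case
    by (auto simp: frob_coeff_def intro!: cohomology_sum cohomology_mult cohomology_const cohomology_gen
        polys_mult polys_power polys_uminus)
qed (simp_all add: cohomology_0 cohomology_1 cohomology_const ext_lin_add ext_lin_mult cohomology_add cohomology_mult)

lemma frob_map_invariant_coeff:
  assumes "h \<in> invariants n" shows "ecoeff (frob_map n h) S \<in> poly_invariants n"
proof -
  have "act_poly n A (ecoeff (frob_map n h) S) = ecoeff (frob_map n h) S" if "A \<in> general_linear n" for A
    using frob_map_act[of n A h] assms that
    by (simp add: invariants_def flip: ecoeff_ext_map[OF comm_ring_hom_act_poly])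
  moreover have "ecoeff (frob_map n h) S \<in> polys n"
    using frob_map_in_cohomology[of h n] assms by (simp add: invariants_def cohomology_alt)
  ultimately show ?thesis by (simp add: poly_invariants_def)
qed

text \<open>Converse to \<open>frob_map_invariant_coeff\<close>: invariant coefficients give
  \<open>h\<close> and its transform the same image, and the map is injective.\<close>

lemma invariantsI:
  assumes h: "h \<in> cohomology n" and "\<And>S. ecoeff (frob_map n h) S \<in> poly_invariants n"
  shows "h \<in> invariants n"
proof -
  have "act n A h = h" if "A \<in> general_linear n" for A
  proof (rule frob_map_injective)
    show "frob_map n (act n A h) = frob_map n h"
      using assms(2) that
      by (intro ext_eqI) (simp add: frob_map_act ecoeff_ext_map comm_ring_hom_act_poly poly_invariants_def)
  qed (use h in \<open>simp_all add: cohomology_subset_ext_on act_in_cohomology\<close>)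
  then show ?thesis using h by (simp add: invariants_def)
qed

lemma prod_list_zero_mem: "0 \<in> set xs \<Longrightarrow> prod_list xs = (0 :: 'a::ring_1)"
  by (induction xs) auto

text \<open>Up to signs, e_j and e_k can be pulled to the front of e_T; there their equal images
  multiply to a square, which is zero.\<close>

lemma prod_list_equal_images:
  fixes a :: "nat \<Rightarrow> 'b::comm_ring_1 ext"
  assumes a: "\<And>i j. a i * a j = - (a j * a i)" "\<And>i. a i * a i = 0"
    and jk: "j \<in> T" "k \<in> T" "j \<noteq> k" "a j = a k" and fin: "finite T"
  shows "prod_list (map a (sorted_list_of_set T)) = 0"
proof -
  let ?F = "ext_subst (\<lambda>x. x) a"
  let ?T = "T - {j}" and ?U = "T - {j} - {k}"
  have insert: "ext_const (koszul {i} V * koszul {i} V) * ext_base (insert i V) =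
      ext_const (koszul {i} V) * (ext_gen i * ext_base V :: 'b ext)" if "i \<notin> V" for i and V :: "nat set"
    using that by (simp add: ext_gen_mult_base ext_const_mult mult.assoc)
  have sq: "koszul {i} V * koszul {i} V = (1 :: 'b)" for i V
    by (simp add: koszul_def flip: power_add mult_2)
  have base: "ext_base (insert i V) = ext_const (koszul {i} V) * (ext_gen i * ext_base V :: 'b ext)" if "i \<notin> V" for i V
    using insert[OF that] by (simp add: sq ext_const_1)
  have "ext_base T = ext_const (koszul {j} ?T) * (ext_gen j * (ext_const (koszul {k} ?U) * (ext_gen k * ext_base ?U :: 'b ext)))"
    using base[of j ?T] base[of k ?U] jk by (simp add: insert_absorb)
  also have "?F \<dots> = ext_const (koszul {j} ?T) * (a j * (ext_const (koszul {k} ?U) * (a k * ?F (ext_base ?U))))"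
    by (simp add: ext_subst_mult[OF comm_ring_hom_id a] ext_subst_const[OF comm_ring_hom_id]
        ext_subst_gen[OF comm_ring_hom_id])
  also have "\<dots> = ext_const (koszul {j} ?T) * (ext_const (koszul {k} ?U) * ((a j * a k) * ?F (ext_base ?U)))"
    by (simp add: ext_const_left_commute[of "a j"] mult.assoc)
  also have "a j * a k = 0" using jk(4) a(2)[of k] by simp
  finally have "?F (ext_base T) = 0" by simp
  then show ?thesis by (simp add: ext_subst_base[OF comm_ring_hom_id fin])
qed

text \<open>The substitution \<open>x\<^sub>j \<mapsto> x\<^sub>j + x\<^sub>k\<close>, \<open>e\<^sub>j \<mapsto> e\<^sub>j + e\<^sub>k\<close> fixes polynomials modulo \<open>x\<^sub>k\<close>. After
  composing with \<open>e\<^sub>k \<mapsto> e\<^sub>j\<close>, \<open>e\<^sub>j \<mapsto> 0\<close> the invariance modulo \<open>x\<^sub>k\<close> reads off the coefficients of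
  the \<open>e\<^sub>T\<close> with \<open>j \<in> T\<close>, \<open>k \<notin> T\<close>.\<close>

lemma invariant_coeff_zero_var:
  assumes h: "h \<in> invariants n" and jk: "j < n" "k < n" "j \<noteq> k" and T: "j \<in> T" "k \<notin> T"
  shows "zero_var k (ecoeff h T) = (0 :: 'p::prime_card fp_poly)"
proof (cases "finite T")
  case True
  interpret z: comm_ring_hom "zero_var k" by (rule comm_ring_hom_zero_var)
  let ?d = "(\<lambda>_. 0)(j := 1, k := 1) :: nat \<Rightarrow> 'p mod_ring"
  let ?A = "column_mat n j ?d"
  let ?H = "{S. ecoeff h S \<noteq> 0}"
  interpret a: comm_ring_hom "act_poly n ?A" by (rule comm_ring_hom_act_poly)
  have hc: "h \<in> cohomology n" using h by (simp add: invariants_def)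
  have inv: "act n ?A h = h"
    using h column_mat_general_linear[of j n ?d] jk by (simp add: invariants_def)
  have sum_d: "(\<Sum>i<n. f (?d i) * g i) = f 1 * g j + f 1 * g k"
    if "f 0 = 0" for f :: "_ \<Rightarrow> 'c::ring_1" and g
  proof -
    have "(\<Sum>i<n. f (?d i) * g i) = (\<Sum>i<n. (if i = j then f 1 * g j else 0) + (if i = k then f 1 * g k else 0))"
      by (rule sum.cong) (use jk that in auto)
    then show ?thesis using jk by (simp add: sum.distrib)
  qed
  have av: "zero_var k (act_var n ?A i) = zero_var k (poly_var i)" if "i < n" for i
    using that jk sum_d[of poly_const poly_var] by (simp add: act_var_column_mat poly_const_1 z.hom_add)
  have za: "zero_var k (act_poly n ?A f) = zero_var k f" if "f \<in> polys n" for f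
  proof (rule comm_ring_hom_eq_on_polys[OF _ comm_ring_hom_zero_var that])
    show "comm_ring_hom (\<lambda>f. zero_var k (act_poly n ?A f))"
      by unfold_locales (simp_all add: z.hom_add a.hom_add z.hom_mult a.hom_mult)
    show "zero_var k (act_poly n ?A (poly_var i)) = zero_var k (poly_var i)" if "i < n" for i
      unfolding act_poly_var by (rule av[OF that])
  qed (simp add: act_poly_eq_psubst comm_ring_hom_poly_const)
  have ag: "act_gen n ?A i = (if i = j then ext_gen j + ext_gen k else ext_gen i)" if "i < n" for i
    using that sum_d[of "\<lambda>c. ext_const (poly_const c)" ext_gen]
    by (simp add: act_gen_column_mat poly_const_1 ext_const_1)
  \<comment> \<open>Applied to the transformed generators, \<psi> becomes \<open>\<phi>\<close>:
    both e_j + e_k and e_k are sent to e_j.\<close>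
  define \<psi> :: "nat \<Rightarrow> 'p fp_poly ext" where "\<psi> i = (if i = j then 0 else if i = k then ext_gen j else ext_gen i)" for i
  define \<phi> :: "nat \<Rightarrow> 'p fp_poly ext" where "\<phi> i = (if i = k then ext_gen j else ext_gen i)" for i
  let ?\<Psi> = "ext_subst (zero_var k) \<psi>"
  have \<psi>: "\<psi> i * \<psi> i' = - (\<psi> i' * \<psi> i)" "\<psi> i * \<psi> i = 0" for i i'
    by (auto simp: \<psi>_def ext_gen_square intro: ext_gen_anticommute)
  have \<phi>: "\<phi> i * \<phi> i' = - (\<phi> i' * \<phi> i)" "\<phi> i * \<phi> i = 0" for i i'
    by (auto simp: \<phi>_def ext_gen_square intro: ext_gen_anticommute)
  have subset: "S \<subseteq> {..<n}" "finite S" if "S \<in> ?H" for S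
    using hc that finite_if_ecoeff_nonzero[of h S] by (auto simp: cohomology_def)
  have \<Psi>_prod: "?\<Psi> (prod_list gs) = prod_list (map ?\<Psi> gs)" for gs
    by (induction gs)
      (simp_all add: ext_subst_1[OF comm_ring_hom_zero_var] ext_subst_mult[OF comm_ring_hom_zero_var \<psi>])
  have \<Psi>_gen: "?\<Psi> (act_gen n ?A i) = \<phi> i" if "i < n" for i
    using that jk
    by (simp add: ag ext_subst_add[OF comm_ring_hom_zero_var] ext_subst_gen[OF comm_ring_hom_zero_var] \<psi>_def \<phi>_def)
  have "?\<Psi> h = ?\<Psi> (act n ?A h)" by (simp add: inv)
  also have "\<dots> = (\<Sum>S\<in>?H. ext_const (zero_var k (ecoeff h S)) * prod_list (map \<phi> (sorted_list_of_set S)))"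
    unfolding act_def ext_subst_sum[OF comm_ring_hom_zero_var]
  proof (rule sum.cong)
    fix S assume S: "S \<in> ?H"
    have "map ?\<Psi> (map (act_gen n ?A) (sorted_list_of_set S)) = map \<phi> (sorted_list_of_set S)"
      using subset[OF S] by (auto simp: \<Psi>_gen)
    then show "?\<Psi> (ext_const (act_poly n ?A (ecoeff h S)) * prod_list (map (act_gen n ?A) (sorted_list_of_set S))) =
        ext_const (zero_var k (ecoeff h S)) * prod_list (map \<phi> (sorted_list_of_set S))"
      using hc by (simp add: ext_subst_const_mult[OF comm_ring_hom_zero_var] \<Psi>_prod za cohomology_alt del: map_map)
  qed simp
  finally have "(\<Sum>S\<in>?H. ext_const (zero_var k (ecoeff h S)) * prod_list (map \<psi> (sorted_list_of_set S))) =
      (\<Sum>S\<in>?H. ext_const (zero_var k (ecoeff h S)) * prod_list (map \<phi> (sorted_list_of_set S)))"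
    unfolding ext_subst_def .
  then have "0 = (\<Sum>S\<in>?H. ext_const (zero_var k (ecoeff h S)) *
      (prod_list (map \<phi> (sorted_list_of_set S)) - prod_list (map \<psi> (sorted_list_of_set S))))"
    by (simp add: right_diff_distrib sum_subtractf)
  also have "\<dots> = (\<Sum>S\<in>?H. if j \<in> S \<and> k \<notin> S then ext_const (zero_var k (ecoeff h S)) * ext_base S else 0)"
  proof (rule sum.cong)
    fix S assume S: "S \<in> ?H"
    note fin = subset(2)[OF S]
    have psi0: "prod_list (map \<psi> (sorted_list_of_set S)) = 0" if "j \<in> S"
    proof (rule prod_list_zero_mem)
      have "\<psi> j \<in> set (map \<psi> (sorted_list_of_set S))" using that fin by simp
      moreover have "\<psi> j = 0" by (simp add: \<psi>_def)
      ultimately show "0 \<in> set (map \<psi> (sorted_list_of_set S))" by metis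
    qed
    \<comment> \<open>\<open>\<phi>\<close> and \<open>\<psi>\<close> differ only at
      \<open>j\<close>. If j \<in> S, then \<open>\<psi>\<close> gives 0, while
      \<open>\<phi>\<close> gives 0 for k \<in> S because of a repeated factor, and e_S
      otherwise.\<close>
    consider "j \<notin> S" | "j \<in> S" "k \<in> S" | "j \<in> S" "k \<notin> S" by blast
    then have "prod_list (map \<phi> (sorted_list_of_set S)) - prod_list (map \<psi> (sorted_list_of_set S)) =
        (if j \<in> S \<and> k \<notin> S then ext_base S else 0)"
    proof cases
      case 1
      then have "map \<phi> (sorted_list_of_set S) = map \<psi> (sorted_list_of_set S)"
        using fin by (auto simp: \<phi>_def \<psi>_def)
      then show ?thesis using 1 by (simp del: map_eq_conv)
    next
      case 2
      then show ?thesis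
        using prod_list_equal_images[of \<phi> j S k, OF \<phi>] fin jk by (simp add: psi0 \<phi>_def)
    next
      case 3
      then have "map \<phi> (sorted_list_of_set S) = map ext_gen (sorted_list_of_set S)"
        using fin by (auto simp: \<phi>_def)
      then show ?thesis using 3 fin by (simp add: psi0 ext_base_conv_prod_list del: map_eq_conv)
    qed
    then show "ext_const (zero_var k (ecoeff h S)) *
        (prod_list (map \<phi> (sorted_list_of_set S)) - prod_list (map \<psi> (sorted_list_of_set S))) =
        (if j \<in> S \<and> k \<notin> S then ext_const (zero_var k (ecoeff h S)) * ext_base S else 0)"
      by simp
  qed simp
  finally have "0 = ecoeff (\<Sum>S\<in>?H. if j \<in> S \<and> k \<notin> S then ext_const (zero_var k (ecoeff h S)) * ext_base S else 0) T"
    by (metis ecoeff_0)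
  also have "\<dots> = (\<Sum>S\<in>?H. if S = T then zero_var k (ecoeff h T) else 0)"
    unfolding ecoeff_sum
    by (rule sum.cong) (use T True in \<open>auto simp: ecoeff_const_mult ecoeff_base\<close>)
  also have "\<dots> = zero_var k (ecoeff h T)"
    by (auto simp: finite_ecoeff_support)
  finally show ?thesis by simp
next
  case False
  interpret z: comm_ring_hom "zero_var k" by (rule comm_ring_hom_zero_var)
  have "ecoeff h T = 0" using False finite_if_ecoeff_nonzero by metis
  then show ?thesis by simp
qed

text \<open>At x_n = 0 the image of e_n vanishes, since its coefficients are powers of x_n up to
  sign, and so do the coefficients of \<open>h\<close> at all nonempty T without \<open>n\<close>.
  Only the term for T = {} survives, so the coefficient at e_S is an invariant divisible by
  x_n.\<close>

lemma frob_map_invariant_dvd: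
  fixes h :: "'p::prime_card fp_poly ext"
  assumes h: "h \<in> invariants (Suc n)" and S: "S \<noteq> {}"
  shows "dickson_Q (Suc n) 0 dvd ecoeff (frob_map (Suc n) h) S"
proof -
  let ?H = "{S. ecoeff h S \<noteq> 0}"
  interpret z: comm_ring_hom "zero_var n" by (rule comm_ring_hom_zero_var)
  let ?z = "ext_map (zero_var n) :: 'p fp_poly ext \<Rightarrow> _"
  let ?a = "\<lambda>j. \<Sum>s<Suc n. ext_const (frob_coeff j s) * ext_gen s"
  have z_prod: "?z (prod_list gs) = prod_list (map ?z gs)" for gs
    by (induction gs) (simp_all add: ext_map_1 ext_map_mult comm_ring_hom_zero_var)
  have za: "?z (?a n) = 0"
    by (simp add: ext_map_sum ext_map_mult comm_ring_hom_zero_var frob_coeff_def z.hom_mult z.hom_power zero_power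
        del: sum.lessThan_Suc)
  have hc: "h \<in> cohomology (Suc n)" using h by (simp add: invariants_def)
  have "?z (frob_map (Suc n) h) =
      (\<Sum>T\<in>?H. ext_const (zero_var n (ecoeff h T)) * prod_list (map ?z (map ?a (sorted_list_of_set T))))"
    unfolding ext_lin_def ext_subst_def
    by (simp add: ext_map_sum ext_map_mult comm_ring_hom_zero_var z_prod del: map_map sum.lessThan_Suc)
  also have "\<dots> = (\<Sum>T\<in>?H. if T = {} then ext_const (zero_var n (ecoeff h {})) else 0)"
  proof (rule sum.cong)
    fix T assume T: "T \<in> ?H"
    then have fin: "finite T" and sub: "T \<subseteq> {..<Suc n}"
      using hc finite_if_ecoeff_nonzero[of h T] by (auto simp: cohomology_def)
    show "ext_const (zero_var n (ecoeff h T)) * prod_list (map ?z (map ?a (sorted_list_of_set T))) =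
        (if T = {} then ext_const (zero_var n (ecoeff h {})) else 0)"
    proof (cases "n \<in> T \<or> T = {}")
      case True
      show ?thesis
      proof (cases "T = {}")
        case False
        then have "n \<in> T" using True by blast
        then have "?z (?a n) \<in> set (map ?z (map ?a (sorted_list_of_set T)))"
          using fin by (auto simp del: sum.lessThan_Suc)
        then have "prod_list (map ?z (map ?a (sorted_list_of_set T))) = 0"
          unfolding za by (rule prod_list_zero_mem)
        then show ?thesis using False by (simp del: map_map sum.lessThan_Suc)
      qed simp
    next
      case False
      then obtain j where j: "j \<in> T" "j \<noteq> n" by blast
      then have "j < Suc n" using sub by blast
      then have "zero_var n (ecoeff h T) = 0"
        using invariant_coeff_zero_var[OF h, of j n T] False j by simp
      then show ?thesis using False by simp
    qed
  qed simp
  also have "ecoeff \<dots> S = 0"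
    unfolding ecoeff_sum using S by (intro sum.neutral) (auto simp: ext_const.rep_eq)
  finally have "zero_var n (ecoeff (frob_map (Suc n) h) S) = 0"
    by (simp add: ecoeff_ext_map comm_ring_hom_zero_var)
  then show ?thesis
    by (intro poly_invariants_dvd_L_power frob_map_invariant_coeff[OF h] dvd_poly_var_if_zero_var)
qed

section \<open>Mui invariants\<close>

text \<open>Expanding the transposed matrix assigns a variable to each exponent, as
  \<open>row_det\<close> does in \<open>mui_M\<close>.\<close>

lemma moore_leibniz:
  "length r = n \<Longrightarrow> moore y r =
    (\<Sum>\<pi> | \<pi> permutes {..<n}. of_int (sign \<pi>) * (\<Prod>i<n. y (\<pi> i) ^ (CARD('p) ^ (r ! i))))"
  for y :: "nat \<Rightarrow> 'p::prime_card fp_poly"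
proof -
  assume n: "length r = n"
  let ?A = "mat n n (\<lambda>(i, j). y i ^ (CARD('p) ^ (r ! j)))"
  have "moore y r = det (transpose_mat ?A)"
    by (simp add: moore_def n det_transpose[of _ n])
  also have "\<dots> = (\<Sum>\<pi> | \<pi> permutes {0..<n}. of_int (sign \<pi>) * (\<Prod>i = 0..<n. transpose_mat ?A $$ (i, \<pi> i)))"
    by (subst det_def') auto
  also have "\<dots> = (\<Sum>\<pi> | \<pi> permutes {..<n}. of_int (sign \<pi>) * (\<Prod>i<n. y (\<pi> i) ^ (CARD('p) ^ (r ! i))))"
    unfolding atLeast0LessThan
  proof (rule sum.cong)
    fix \<pi> assume "\<pi> \<in> {\<pi>. \<pi> permutes {..<n}}"
    then have "\<pi> i < n" if "i < n" for i using that permutes_in_image[of \<pi> "{..<n}" i] by simp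
    then show "of_int (sign \<pi>) * (\<Prod>i<n. transpose_mat ?A $$ (i, \<pi> i)) =
        (of_int (sign \<pi>) * (\<Prod>i<n. y (\<pi> i) ^ (CARD('p) ^ (r ! i))) :: 'p fp_poly)"
      by (intro arg_cong2[of _ _ _ _ "(*)"] prod.cong) auto
  qed simp
  finally show ?thesis .
qed

lemma moore_swap_adjacent:
  fixes y :: "nat \<Rightarrow> 'p::prime_card fp_poly"
  shows "moore y (us @ a # b # vs) = - moore y (us @ b # a # vs)"
proof -
  let ?r = "us @ a # b # vs" and ?r' = "us @ b # a # vs"
  let ?n = "length ?r" and ?k = "length us"
  let ?A = "mat ?n ?n (\<lambda>(i, j). y i ^ (CARD('p) ^ (?r ! j)))"
  have nth: "?r' ! j = ?r ! (if j = ?k then Suc ?k else if j = Suc ?k then ?k else j)" for j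
    by (auto simp: nth_append nth_Cons' split: if_splits)
  have "swapcols ?k (Suc ?k) ?A = mat ?n ?n (\<lambda>(i, j). y i ^ (CARD('p) ^ (?r' ! j)))"
    by (rule eq_matI) (simp_all only: nth mat_swapcols_def, auto)
  then have "moore y ?r' = det (swapcols ?k (Suc ?k) ?A)"
    by (simp add: moore_def)
  also have "\<dots> = - det ?A"
    by (rule det_swapcols[of _ ?n]) auto
  finally show ?thesis by (simp add: moore_def)
qed

lemma moore_move_to_front: "moore y (us @ a # vs) = (-1) ^ length us * moore y (a # us @ vs)"
proof (induction us arbitrary: vs rule: rev_induct)
  case (snoc b us)
  have "moore y ((us @ [b]) @ a # vs) = - moore y (us @ a # b # vs)"
    using moore_swap_adjacent[of y us b a vs] by simp
  then show ?case by (simp add: snoc.IH)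
qed simp

lemma filter_neq_upt': "s < n \<Longrightarrow> filter (\<lambda>r. r \<noteq> s) [0..<n] = [0..<s] @ [Suc s..<n]"
  using filter_neq_upt[of s "n - 1"] by (cases n) (auto simp del: upt_Suc)

text \<open>An exponent t \<noteq> s occurs twice and makes two columns equal. For t = s the
  exponent returns to its place past \<open>s\<close> smaller ones.\<close>

lemma moore_Cons_filter:
  assumes s: "s < n" and t: "t < n"
  shows "moore y (t # filter (\<lambda>r. r \<noteq> s) [0..<n]) = (if t = s then (-1) ^ s * moore y [0..<n] else 0)"
proof (cases "t = s")
  case True
  have "[0..<n] = [0..<s] @ s # [Suc s..<n]"
    using s by (metis upt_add_eq_append upt_conv_Cons le_add_diff_inverse less_imp_le_nat zero_le)
  then have "moore y [0..<n] = (-1) ^ s * moore y (s # [0..<s] @ [Suc s..<n])"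
    using moore_move_to_front[of y "[0..<s]" s "[Suc s..<n]"] by simp
  then have "(-1) ^ s * moore y [0..<n] = moore y (s # [0..<s] @ [Suc s..<n])"
    by (simp add: minus_one_power_iff)
  then show ?thesis using True s by (simp add: filter_neq_upt')
next
  case False
  then have "t \<in> set (filter (\<lambda>r. r \<noteq> s) [0..<n])" using t by auto
  then obtain k where k: "k < length (filter (\<lambda>r. r \<noteq> s) [0..<n])" "filter (\<lambda>r. r \<noteq> s) [0..<n] ! k = t"
    by (metis in_set_conv_nth)
  have "moore y (t # filter (\<lambda>r. r \<noteq> s) [0..<n]) = 0"
    by (rule moore_eq_columns[of 0 _ "Suc k"]) (use k in auto)
  then show ?thesis using False by simp
qed

text \<open>The scalar factor of the term of \<open>mui_M\<close> that belongs to
  \<open>\<pi>\<close>. Row 0 holds the exterior generators, so the i-th exponent sits in row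
  \<open>Suc i\<close>.\<close>

definition mui_cofactor :: "nat \<Rightarrow> nat \<Rightarrow> (nat \<Rightarrow> nat) \<Rightarrow> 'p::prime_card fp_poly"
  where "mui_cofactor n s \<pi> = of_int (sign \<pi>) *
    (\<Prod>i<n - 1. poly_var (\<pi> (Suc i)) ^ (CARD('p) ^ (filter (\<lambda>r. r \<noteq> s) [0..<n] ! i)))"

lemma ext_const_of_int: "ext_const (of_int k) = of_int k"
proof -
  have "ext_const (of_nat m) = (of_nat m :: 'a ext)" for m
    by (induction m) (simp_all add: ext_const_add ext_const_1)
  then show ?thesis
    by (cases k rule: int_cases2) (simp_all add: ext_const_uminus)
qed

lemma mui_M_eq:
  "mui_M (Suc n) s = (\<Sum>\<pi> | \<pi> permutes {..<Suc n}. ext_const (mui_cofactor (Suc n) s \<pi>) * ext_gen (\<pi> 0))"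
  for s :: nat
  unfolding mui_M_def row_det_def
proof (rule sum.cong)
  fix \<pi> :: "nat \<Rightarrow> nat"
  let ?f = "\<lambda>i. filter (\<lambda>r. r \<noteq> s) [0..<Suc n] ! i"
  let ?a = "\<lambda>i j. if i = 0 then ext_gen j else ext_const (poly_var j ^ (CARD('a) ^ ?f (i - 1))) :: 'a fp_poly ext"
  have "[0..<Suc n] = 0 # map Suc [0..<n]"
    by (simp add: map_Suc_upt upt_conv_Cons del: upt_Suc)
  then have "prod_list (map (\<lambda>i. ?a i (\<pi> i)) [0..<Suc n]) =
      ext_gen (\<pi> 0) * prod_list (map (\<lambda>i. ext_const (poly_var (\<pi> (Suc i)) ^ (CARD('a) ^ ?f i))) [0..<n])"
    by (simp add: o_def del: upt_Suc)
  also have "prod_list (map (\<lambda>i. ext_const (poly_var (\<pi> (Suc i)) ^ (CARD('a) ^ ?f i))) [0..<n]) =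
      ext_const (\<Prod>i<n. poly_var (\<pi> (Suc i)) ^ (CARD('a) ^ ?f i) :: 'a fp_poly)"
  proof -
    have "prod_list (map (\<lambda>i. ext_const (g i)) [0..<m]) = ext_const (\<Prod>i<m. g i)" for g :: "nat \<Rightarrow> 'a fp_poly" and m
      by (induction m) (simp_all add: ext_const_1 ext_const_mult)
    then show ?thesis .
  qed
  finally have eq: "prod_list (map (\<lambda>i. ?a i (\<pi> i)) [0..<Suc n]) =
      ext_gen (\<pi> 0) * ext_const (\<Prod>i<n. poly_var (\<pi> (Suc i)) ^ (CARD('a) ^ ?f i))" .
  show "of_int (sign \<pi>) * prod_list (map (\<lambda>i. ?a i (\<pi> i)) [0..<Suc n]) =
      ext_const (mui_cofactor (Suc n) s \<pi>) * ext_gen (\<pi> 0)"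
    unfolding eq mui_cofactor_def ext_const_mult ext_const_of_int diff_Suc_1
    by (simp only: ext_const_commute[of "ext_gen _"] mult.assoc)
qed simp

lemma mui_M_in_cohomology: "mui_M (Suc n) s \<in> cohomology (Suc n)"
  unfolding mui_M_eq
proof (rule cohomology_sum)
  fix \<pi> :: "nat \<Rightarrow> nat" assume "\<pi> \<in> {\<pi>. \<pi> permutes {..<Suc n}}"
  then have \<pi>: "\<pi> i < Suc n" if "i < Suc n" for i
    using that permutes_in_image[of \<pi> "{..<Suc n}" i] by simp
  have int: "of_int k \<in> polys (Suc n)" for k
    by (cases k rule: int_cases2)
      (auto intro!: polys_uminus simp flip: single_of_nat poly_const_def)
  show "ext_const (mui_cofactor (Suc n) s \<pi>) * ext_gen (\<pi> 0) \<in> cohomology (Suc n)"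
    unfolding mui_cofactor_def
    by (intro cohomology_mult cohomology_const cohomology_gen polys_mult int polys_prod polys_power polysI_var \<pi>) simp_all
qed

text \<open>The coefficient of e_t in the image arises by replacing e_j in the first row by
  \<open>frob_coeff j t\<close>. It is a signed Moore determinant with a repeated exponent unless t
  = s, and then the sign in \<open>frob_coeff\<close> cancels the one from reordering.\<close>

lemma frob_map_mui_M:
  assumes s: "s < Suc n"
  shows "frob_map (Suc n) (mui_M (Suc n) s) =
    ext_const (dickson_L (Suc n) (Suc n)) * (ext_gen s :: 'p::prime_card fp_poly ext)"
proof -
  let ?f = "filter (\<lambda>r. r \<noteq> s) [0..<Suc n]"
  have len: "length ?f = n" using length_filter_neq_upt[of s n] s by simp
  have coeff: "(\<Sum>\<pi> | \<pi> permutes {..<Suc n}. mui_cofactor (Suc n) s \<pi> * frob_coeff (\<pi> 0) t) =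
      (if t = s then dickson_L (Suc n) (Suc n) else (0 :: 'p fp_poly))" if t: "t < Suc n" for t
  proof -
    have "(\<Sum>\<pi> | \<pi> permutes {..<Suc n}. mui_cofactor (Suc n) s \<pi> * frob_coeff (\<pi> 0) t) =
        (-1) ^ t * (moore poly_var (t # ?f) :: 'p fp_poly)"
      unfolding moore_leibniz[of "t # ?f" "Suc n", simplified length_Cons len, OF refl]
      by (simp add: sum_distrib_left mui_cofactor_def frob_coeff_def prod.lessThan_Suc_shift mult_ac
          del: prod.lessThan_Suc upt_Suc)
    also have "\<dots> = (if t = s then dickson_L (Suc n) (Suc n) else 0)"
      unfolding moore_Cons_filter[OF s t] dickson_L_top bracket_eq_moore
      by (simp add: minus_one_power_iff)
    finally show ?thesis .
  qed
  have "frob_map (Suc n) (mui_M (Suc n) s :: 'p fp_poly ext) =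
      (\<Sum>\<pi> | \<pi> permutes {..<Suc n}. ext_const (mui_cofactor (Suc n) s \<pi>) *
        (\<Sum>t<Suc n. ext_const (frob_coeff (\<pi> 0) t) * ext_gen t))"
    unfolding mui_M_eq ext_lin_sum ext_lin_const_mult ext_lin_gen ..
  also have "\<dots> = (\<Sum>t<Suc n. \<Sum>\<pi> | \<pi> permutes {..<Suc n}.
      ext_const (mui_cofactor (Suc n) s \<pi> * frob_coeff (\<pi> 0) t) * ext_gen t)"
    by (subst sum.swap) (simp add: sum_distrib_left ext_const_mult mult.assoc del: sum.lessThan_Suc)
  also have "\<dots> = (\<Sum>t<Suc n. ext_const (if t = s then dickson_L (Suc n) (Suc n) else 0) * ext_gen t)"
    by (rule sum.cong) (simp_all add: ext_const_sum sum_distrib_right flip: coeff)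
  also have "\<dots> = (\<Sum>t<Suc n. if t = s then ext_const (dickson_L (Suc n) (Suc n)) * ext_gen s else 0)"
    by (rule sum.cong) auto
  finally show ?thesis using s by (simp del: sum.lessThan_Suc)
qed

text \<open>By injectivity this may be checked on the image L_n e_s, where the group acts on L_n
  alone.\<close>

lemma act_mui_M:
  assumes A: "A \<in> general_linear (Suc n)" and s: "s < Suc n"
  shows "act (Suc n) A (mui_M (Suc n) s) = ext_const (poly_const (det A)) * mui_M (Suc n) s"
proof (rule frob_map_injective)
  have "act_poly (Suc n) A (dickson_L (Suc n) (Suc n)) = poly_const (det A) * dickson_L (Suc n) (Suc n)"
    by (rule act_dickson_L) (use general_linear_det(1)[OF A] in auto)
  then show "frob_map (Suc n) (act (Suc n) A (mui_M (Suc n) s)) =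
      frob_map (Suc n) (ext_const (poly_const (det A)) * mui_M (Suc n) s)"
    by (simp add: frob_map_act frob_map_mui_M s ext_lin_const_mult ext_map_mult comm_ring_hom_act_poly
        ext_const_mult mult.assoc)
qed (intro cohomology_subset_ext_on act_in_cohomology cohomology_mult cohomology_const polysI_const mui_M_in_cohomology)+

text \<open>As \<open>e\<^sub>n\<^sup>2 = 0\<close>, this makes products of the \<open>M\<^bsub>n;s\<^esub>\<close> divisible by powers of \<open>x\<^sub>n\<close>.\<close>

lemma mui_M_decomp:
  obtains c b where "mui_M (Suc n) s = ext_const c * ext_gen n + ext_const (poly_var n) * b"
    "b * ext_gen n = - (ext_gen n * (b :: 'p::prime_card fp_poly ext))"
proof -
  let ?P = "{\<pi>. \<pi> permutes {..<Suc n}}"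
  let ?c = "mui_cofactor (Suc n) s :: _ \<Rightarrow> 'p fp_poly"
  \<comment> \<open>If \<pi> does not select column \<open>n\<close> in row 0, it does so in a row
    of powers, and x_n divides the term.\<close>
  have "\<exists>q. ?c \<pi> = poly_var n * q" if "\<pi> \<in> ?P" "\<pi> 0 \<noteq> n" for \<pi>
  proof -
    have \<pi>: "\<pi> permutes {..<Suc n}" using that by simp
    obtain i where i: "\<pi> i = n" using permutes_surj[OF \<pi>] by (metis surjD)
    then have "i < Suc n" using permutes_in_image[OF \<pi>, of i] by simp
    moreover have "i \<noteq> 0" using i that by metis
    ultimately obtain j where j: "i = Suc j" "j < n" by (cases i) auto
    have "poly_var n dvd (\<Prod>i<n. poly_var (\<pi> (Suc i)) ^ (CARD('p) ^ (filter (\<lambda>r. r \<noteq> s) [0..<Suc n] ! i)) :: 'p fp_poly)"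
      using i j by (intro dvd_trans[OF _ dvd_prodI[of "{..<n}" j]]) (auto intro!: dvd_power simp del: upt_Suc)
    then show ?thesis by (auto simp: mui_cofactor_def dvd_def mult.left_commute simp del: upt_Suc)
  qed
  then obtain q where q: "\<And>\<pi>. \<pi> \<in> ?P \<Longrightarrow> \<pi> 0 \<noteq> n \<Longrightarrow> ?c \<pi> = poly_var n * q \<pi>" by metis
  let ?P1 = "{\<pi> \<in> ?P. \<pi> 0 = n}" and ?P2 = "{\<pi> \<in> ?P. \<pi> 0 \<noteq> n}"
  have fin: "finite ?P" by (rule finite_permutations) simp
  define b where "b = (\<Sum>\<pi>\<in>?P2. ext_const (q \<pi>) * ext_gen (\<pi> 0))"
  have "mui_M (Suc n) s = (\<Sum>\<pi>\<in>?P1. ext_const (?c \<pi>) * ext_gen (\<pi> 0)) + (\<Sum>\<pi>\<in>?P2. ext_const (?c \<pi>) * ext_gen (\<pi> 0))"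
  proof -
    have "?P = ?P1 \<union> ?P2" "?P1 \<inter> ?P2 = {}" by auto
    then show ?thesis using fin unfolding mui_M_eq by (metis (no_types, lifting) finite_Un sum.union_disjoint)
  qed
  also have "(\<Sum>\<pi>\<in>?P1. ext_const (?c \<pi>) * ext_gen (\<pi> 0)) = ext_const (\<Sum>\<pi>\<in>?P1. ?c \<pi>) * ext_gen n"
    by (simp add: ext_const_sum sum_distrib_right)
  also have "(\<Sum>\<pi>\<in>?P2. ext_const (?c \<pi>) * ext_gen (\<pi> 0)) = ext_const (poly_var n) * b"
    unfolding b_def sum_distrib_left by (rule sum.cong) (auto simp: q ext_const_mult mult.assoc)
  finally have "mui_M (Suc n) s = ext_const (\<Sum>\<pi>\<in>?P1. ?c \<pi>) * ext_gen n + ext_const (poly_var n) * b" .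
  moreover have "b * ext_gen n = - (ext_gen n * b)"
  proof -
    have "ext_const (q \<pi>) * ext_gen (\<pi> 0) * ext_gen n = - (ext_gen n * (ext_const (q \<pi>) * ext_gen (\<pi> 0)))" for \<pi>
      by (simp add: ext_const_left_commute[of "ext_gen n"] mult.assoc ext_gen_anticommute[of "\<pi> 0" n])
    then show ?thesis
      by (simp add: b_def sum_distrib_left sum_distrib_right sum_negf)
  qed
  ultimately show ?thesis by (rule that)
qed

text \<open>The two claims support each other. With M = c e_n + x_n b, the term c P e_n of P M takes
  its power of x_n from the second claim for P, and e_n^2 = 0 leaves P M e_n = - x_n P e_n
  b.\<close>

lemma mui_M_prod_dvd:
  fixes ss :: "nat list" and n :: nat
  defines "P \<equiv> prod_list (map (mui_M (Suc n)) ss) :: 'p::prime_card fp_poly ext"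
  shows "(\<exists>g. P = ext_const (poly_var n ^ (length ss - 1)) * g) \<and>
    (\<exists>g. P * ext_gen n = ext_const (poly_var n ^ length ss) * g)"
  unfolding P_def
proof (induction ss rule: rev_induct)
  case Nil
  show ?case by (simp add: ext_const_1)
next
  case (snoc s ss)
  let ?P = "prod_list (map (mui_M (Suc n)) ss) :: 'p fp_poly ext" and ?l = "length ss"
  let ?x = "\<lambda>k. ext_const (poly_var n ^ k) :: 'p fp_poly ext"
  obtain g1 g2 where g1: "?P = ?x (?l - 1) * g1" and g2: "?P * ext_gen n = ?x ?l * g2"
    using snoc.IH by blast
  obtain c b where M: "mui_M (Suc n) s = ext_const c * ext_gen n + ext_const (poly_var n) * b"
    and b: "b * ext_gen n = - (ext_gen n * (b :: 'p fp_poly ext))"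
    using mui_M_decomp by blast
  have P': "prod_list (map (mui_M (Suc n)) (ss @ [s])) = ext_const c * (?P * ext_gen n) + ext_const (poly_var n) * (?P * b)"
    by (simp add: M distrib_left ext_const_left_commute[of ?P])
  have "\<exists>g. prod_list (map (mui_M (Suc n)) (ss @ [s])) = ?x ?l * g"
  \<comment> \<open>For \<open>?l = 0\<close> the truncated exponent spoils x_n x_n^(l-1) = x_n^l,
    but then the power claimed is x_n^0.\<close>
  proof (cases "?l = 0")
    case True
    then show ?thesis by (intro exI[of _ "prod_list (map (mui_M (Suc n)) (ss @ [s]))"]) (simp add: ext_const_1)
  next
    case False
    then have x: "ext_const (poly_var n) * ?x (?l - 1) = ?x ?l"
      by (simp flip: ext_const_mult power_Suc)
    have "ext_const c * (?P * ext_gen n) + ext_const (poly_var n) * (?P * b) =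
        ext_const c * (?x ?l * g2) + ext_const (poly_var n) * ?x (?l - 1) * (g1 * b)"
      unfolding g2 by (simp add: g1 mult.assoc)
    also have "\<dots> = ?x ?l * (ext_const c * g2 + g1 * b)"
      unfolding x by (simp add: distrib_left ext_const_left_commute[of "ext_const c"])
    finally show ?thesis unfolding P' by blast
  qed
  moreover have "prod_list (map (mui_M (Suc n)) (ss @ [s])) * ext_gen n = ?x (Suc ?l) * (- (g2 * b))"
  proof -
    have "prod_list (map (mui_M (Suc n)) (ss @ [s])) * ext_gen n =
        ext_const c * (?P * (ext_gen n * ext_gen n)) + ext_const (poly_var n) * (?P * (b * ext_gen n))"
      unfolding P' by (simp add: distrib_right mult.assoc)
    also have "\<dots> = - (ext_const (poly_var n) * ((?P * ext_gen n) * b))"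
      by (simp add: ext_gen_square b mult.assoc)
    also have "\<dots> = ?x (Suc ?l) * (- (g2 * b))"
      unfolding g2 by (simp add: ext_const_mult mult.assoc)
    finally show ?thesis .
  qed
  moreover have len: "length (ss @ [s]) = Suc ?l" by simp
  ultimately show ?case unfolding len diff_Suc_1 by blast
qed

lemma act_prod_list: "act n A (prod_list hs) = prod_list (map (act n A) hs)"
  by (induction hs) (simp_all add: act_1 act_mult)

lemma prod_list_const_mult:
  "prod_list (map (\<lambda>s. ext_const (c s) * f s) ss) = ext_const (prod_list (map c ss)) * prod_list (map f ss)"
  by (induction ss) (simp_all add: ext_const_1 ext_const_mult ext_const_left_commute[of "f _"] mult.assoc)

text \<open>The group multiplies the product by a power of the determinant, so divisibility by
  powers of x_n spreads to all linear forms.\<close>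

lemma mui_M_prod_dvd_L:
  assumes ss: "set ss \<subseteq> {..<Suc n}"
  obtains g where "prod_list (map (mui_M (Suc n)) ss) =
    ext_const (dickson_L (Suc n) (Suc n) ^ (length ss - 1)) * (g :: 'p::prime_card fp_poly ext)"
proof -
  let ?P = "prod_list (map (mui_M (Suc n)) ss) :: 'p fp_poly ext"
  have "dickson_L (Suc n) (Suc n) ^ (length ss - 1) dvd ecoeff ?P S" for S
  proof (rule dickson_L_dvd_semiinvariant)
    show "poly_var n ^ (length ss - 1) dvd ecoeff ?P S" for S
      using mui_M_prod_dvd[of n ss, where 'p='p] by (auto simp: ecoeff_const_mult)
  next
    fix A :: "'p mod_ring mat" assume A: "A \<in> general_linear (Suc n)"
    have "act (Suc n) A ?P = prod_list (map (\<lambda>s. ext_const (poly_const (det A)) * mui_M (Suc n) s) ss)"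
      unfolding act_prod_list map_map using ss
      by (intro arg_cong[of _ _ prod_list] map_cong) (auto simp: act_mui_M[OF A])
    also have "\<dots> = ext_const (prod_list (map (\<lambda>_. poly_const (det A)) ss)) * ?P"
      by (rule prod_list_const_mult)
    also have "prod_list (map (\<lambda>_. poly_const (det A)) ss) = poly_const (det A ^ length ss)"
      by (induction ss) (simp_all add: poly_const_1 poly_const_mult)
    finally show "\<exists>c. c \<noteq> 0 \<and> act (Suc n) A ?P = ext_const (poly_const c) * ?P"
      using general_linear_det(2)[OF A] by (intro exI[of _ "det A ^ length ss"]) simp
  qed
  then show ?thesis using ext_const_dvd that by metis
qed

lemma ext_const_mult_left_cancel:
  "d \<noteq> 0 \<Longrightarrow> ext_const d * g = ext_const d * h \<Longrightarrow> g = h" for d :: "'a::idom"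
  by (rule ext_eqI) (metis ecoeff_const_mult mult_left_cancel)

text \<open>Dividing the product of the \<open>M\<^bsub>n;s\<^esub>\<close>, \<open>s \<in> S\<close>, by \<open>L\<^sub>n\<^bsup>k-1\<^esup>\<close>, \<open>k = |S|\<close>, and multiplying by
  \<open>L\<^sub>n\<^bsup>p-2\<^esup>\<close> yields the preimage of \<open>q\<^bsub>n,0\<^esub> e\<^sub>S\<close>.\<close>

lemma invariant_with_frob_map:
  assumes odd: "odd CARD('p::prime_card)" and S: "S \<subseteq> {..<Suc n}" and f: "f \<in> poly_invariants (Suc n)"
    and Sf: "S \<noteq> {} \<Longrightarrow> dickson_Q (Suc n) 0 dvd f"
  obtains h where "h \<in> invariants (Suc n)"
    "frob_map (Suc n) h = ext_const f * (ext_base S :: 'p fp_poly ext)"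
proof -
  let ?L = "dickson_L (Suc n) (Suc n) :: 'p fp_poly"
  have fin: "finite S" using S finite_subset by blast
  have ex: "\<exists>h\<in>cohomology (Suc n). frob_map (Suc n) h = ext_const f * ext_base S"
  proof (cases "S = {}")
    case True
    then show ?thesis
      using f by (intro bexI[of _ "ext_const f"]) (simp_all add: poly_invariants_def cohomology_const)
  next
    case False
    let ?ss = "sorted_list_of_set S"
    let ?P = "prod_list (map (mui_M (Suc n)) ?ss) :: 'p fp_poly ext"
    obtain r where r: "f = dickson_Q (Suc n) 0 * r" using Sf False by blast
    have "length ?ss \<noteq> 0" using False fin by simp
    then have len: "length ?ss = Suc (length ?ss - 1)" by simp
    obtain g where g: "?P = ext_const (?L ^ (length ?ss - 1)) * g"
      using mui_M_prod_dvd_L[of ?ss n] S fin by auto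
    have Pc: "?P \<in> cohomology (Suc n)"
      by (rule cohomology_prod_list) (use mui_M_in_cohomology in auto)
    have coeff_P: "ecoeff ?P T = ?L ^ (length ?ss - 1) * ecoeff g T" for T
      unfolding g by (rule ecoeff_const_mult)
    have L0: "?L ^ (length ?ss - 1) \<noteq> 0" by (simp add: dickson_L_nonzero)
    have Lp: "?L ^ (length ?ss - 1) \<in> polys (Suc n)" by (intro polys_power dickson_L_in_polys) simp
    have gc: "g \<in> cohomology (Suc n)"
      unfolding cohomology_alt ext_on_def
    proof (intro CollectI conjI allI impI)
      fix T
      show "ecoeff g T \<in> polys (Suc n)"
      proof (rule polys_factor[OF Lp L0])
        have "ecoeff ?P T \<in> polys (Suc n)" using Pc unfolding cohomology_alt by blast
        then show "?L ^ (length ?ss - 1) * ecoeff g T \<in> polys (Suc n)" unfolding coeff_P .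
      qed
      assume "ecoeff g T \<noteq> 0"
      then have "ecoeff ?P T \<noteq> 0" unfolding coeff_P using L0 by simp
      then show "T \<subseteq> {..<Suc n}" using Pc unfolding cohomology_def by blast
    qed
    have "ext_const (?L ^ (length ?ss - 1)) * frob_map (Suc n) g = frob_map (Suc n) ?P"
      by (simp only: g ext_lin_const_mult)
    also have "\<dots> = prod_list (map (\<lambda>s. ext_const ?L * ext_gen s) ?ss)"
      unfolding ext_lin_prod_list map_map using S fin
      by (intro arg_cong[of _ _ prod_list] map_cong) (auto simp: frob_map_mui_M)
    also have "\<dots> = ext_const (?L ^ length ?ss) * ext_base S"
      unfolding prod_list_const_mult using fin
      by (simp add: ext_base_conv_prod_list map_replicate_const prod_list_replicate)
    also have "?L ^ length ?ss = ?L ^ (length ?ss - 1) * ?L"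
      using len by (metis power_Suc2)
    finally have "ext_const (?L ^ (length ?ss - 1)) * frob_map (Suc n) g =
        ext_const (?L ^ (length ?ss - 1)) * (ext_const ?L * ext_base S)"
      by (simp add: ext_const_mult mult.assoc)
    then have gL: "frob_map (Suc n) g = ext_const ?L * ext_base S"
      by (rule ext_const_mult_left_cancel[rotated]) (simp add: dickson_L_nonzero)
    have "CARD('p) \<noteq> 2" using odd by auto
    then have "CARD('p) - 1 = Suc (CARD('p) - 2)"
      using prime_ge_2_nat[OF prime_card[where 'a='p]] by simp
    then have L: "?L ^ (CARD('p) - 2) * r * ?L = f"
      unfolding r dickson_Q_0 by (simp add: mult_ac)
    have r_in: "r \<in> polys (Suc n)"
      by (rule polys_factor[of "dickson_Q (Suc n) 0"])
        (use f r dickson_Q_0_nonzero in \<open>simp_all add: dickson_Q_in_polys poly_invariants_def\<close>)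
    show ?thesis
    proof (rule bexI)
      show "ext_const (?L ^ (CARD('p) - 2) * r) * g \<in> cohomology (Suc n)"
        by (intro cohomology_mult cohomology_const gc polys_mult polys_power dickson_L_in_polys r_in) simp
      show "frob_map (Suc n) (ext_const (?L ^ (CARD('p) - 2) * r) * g) = ext_const f * ext_base S"
        by (simp add: ext_lin_const_mult gL flip: mult.assoc ext_const_mult L)
    qed
  qed
  then obtain h where h: "h \<in> cohomology (Suc n)" "frob_map (Suc n) h = ext_const f * ext_base S" by blast
  have "h \<in> invariants (Suc n)"
    by (rule invariantsI[OF h(1)])
      (use f poly_invariants_const[of "0 :: 'p mod_ring" "Suc n"] in \<open>simp add: h(2) ecoeff_const_mult ecoeff_base\<close>)
  then show ?thesis using that h(2) by blast
qed

section \<open>The basis\<close>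

abbreviation frob_map_loc :: "nat \<Rightarrow> 'p::prime_card fp_poly fract ext \<Rightarrow> 'p fp_poly fract ext"
  where "frob_map_loc n \<equiv> ext_lin n (\<lambda>j s. to_fract (frob_coeff j s))"

lemma frob_map_loc_to_loc: "frob_map_loc n (to_loc h) = to_loc (frob_map n h)"
  by (simp add: to_loc_eq_ext_map ext_map_ext_lin comm_ring_hom_to_fract)

lemma to_loc_const: "to_loc (ext_const c) = ext_const (to_fract c)"
  by (simp add: to_loc_eq_ext_map comm_ring_hom_to_fract)

lemma to_loc_add: "to_loc (g + h) = to_loc g + to_loc h"
  by (simp add: to_loc_eq_ext_map ext_map_add comm_ring_hom_to_fract)

lemma to_loc_0: "to_loc 0 = 0"
  by (simp add: to_loc_eq_ext_map ext_map_0 comm_ring_hom_to_fract)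

lemma to_loc_base: "to_loc (ext_base S) = ext_base S"
  by (rule ext_eqI) (simp add: to_loc.rep_eq ecoeff_base)

lemma to_loc_gen: "to_loc (ext_gen i) = ext_gen i"
  by (simp add: to_loc_eq_ext_map comm_ring_hom_to_fract)

lemma to_loc_ext_on: "h \<in> ext_on n \<Longrightarrow> to_loc h \<in> ext_on n"
  by (simp add: ext_on_def to_loc.rep_eq)

lemma frob_map_loc_fp_scale: "frob_map_loc n (fp_scale c h) = fp_scale c (frob_map_loc n h)"
  by (simp add: fp_scale_def ext_lin_const_mult)

definition index_set :: "nat \<Rightarrow> multi_index \<Rightarrow> nat set"
  where "index_set n I = {s \<in> {..<n}. fst (I ! s) = 1}"

text \<open>The exponents of \<open>q\<^bsub>n,0\<^esub>, \<dots>, q\<^bsub>n,n-1\<^esub>\<close> in the coefficient of the image of \<open>q\<^sup>I\<close>: each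
  factor \<open>R\<^bsub>n;s\<^esub>\<close> is mapped to \<open>q\<^bsub>n,0\<^esub> e\<^sub>s\<close>.\<close>

definition index_exponent :: "nat \<Rightarrow> multi_index \<Rightarrow> nat \<Rightarrow> nat"
  where "index_exponent n I i =
    (if n \<le> i then 0 else if i = 0 then nat (snd (I ! 0) + int (eps_sum I)) else nat (snd (I ! i)))"

lemma admissible_facts:
  assumes "I \<in> admissible n" "1 \<le> n"
  shows "length I = n" "s < n \<Longrightarrow> fst (I ! s) \<in> {0, 1}" "1 \<le> s \<Longrightarrow> s < n \<Longrightarrow> snd (I ! s) \<ge> 0"
    and eps_sum_card: "eps_sum I = card (index_set n I)"
    and "snd (I ! 0) + int (eps_sum I) \<ge> 0"
    and "index_set n I \<noteq> {} \<Longrightarrow> snd (I ! 0) + int (eps_sum I) \<ge> 1"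
proof -
  show len: "length I = n" and eps: "s < n \<Longrightarrow> fst (I ! s) \<in> {0, 1}"
    and "1 \<le> s \<Longrightarrow> s < n \<Longrightarrow> snd (I ! s) \<ge> 0" for s
    using assms(1) by (auto simp: admissible_def)
  have "eps_sum I = (\<Sum>s<n. fst (I ! s))"
    by (simp add: eps_sum_def sum_list_sum_nth len atLeast0LessThan)
  also have "\<dots> = (\<Sum>s<n. if s \<in> index_set n I then 1 else 0)"
    by (rule sum.cong) (use eps in \<open>auto simp: index_set_def\<close>)
  also have "\<dots> = card (index_set n I)"
    by (simp add: index_set_def sum.If_cases Int_def conj_commute)
  finally show "eps_sum I = card (index_set n I)" .
  have ge: "snd (I ! 0) + int (eps_sum I) \<ge> int (eps_max I)"
    using assms(1) by (simp add: admissible_def)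
  then show "snd (I ! 0) + int (eps_sum I) \<ge> 0" by linarith
  assume "index_set n I \<noteq> {}"
  then obtain s where "s < n" "fst (I ! s) = 1" by (auto simp: index_set_def)
  then have "1 \<in> set (map fst I)" by (metis len length_map nth_map nth_mem)
  then have "1 \<le> eps_max I" unfolding eps_max_def by (intro Max_ge) auto
  with ge show "snd (I ! 0) + int (eps_sum I) \<ge> 1" by linarith
qed

lemma frob_map_loc_q_monomial:
  fixes I :: multi_index
  assumes I: "I \<in> admissible (Suc n)"
  shows "frob_map_loc (Suc n) (q_monomial (Suc n) I) =
    ext_const (to_fract (dickson_monomial (Suc n) (index_exponent (Suc n) I) :: 'p::prime_card fp_poly)) *
      ext_base (index_set (Suc n) I)"
proof -
  interpret f: comm_ring_hom "to_fract :: 'p fp_poly \<Rightarrow> _" by (rule comm_ring_hom_to_fract)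
  note adm = admissible_facts[OF I]
  let ?N = "Suc n" and ?q = "dickson_q (Suc n) :: nat \<Rightarrow> 'p fp_poly fract"
  let ?\<epsilon> = "\<lambda>s. fst (I ! s)" and ?i = "\<lambda>s. snd (I ! s)"
  have q: "?q i = to_fract (dickson_Q ?N i)" if "i < ?N" for i
    using dickson_q_eq[of i ?N] that by simp
  have q0: "?q 0 \<noteq> 0" using q[of 0] dickson_Q_0_nonzero[of ?N, where 'a='p] by simp
  have p: "Suc (CARD('p) - 2) = CARD('p) - 1"
    using prime_ge_2_nat[OF prime_card[where 'a='p]] by simp
  have R: "frob_map_loc ?N (to_loc (mui_R ?N s)) = ext_const (?q 0) * ext_gen s" if "s < ?N" for s
  proof -
    have "frob_map ?N (mui_R ?N s) =
        ext_const (dickson_L ?N ?N * dickson_L ?N ?N ^ (CARD('p) - 2)) * (ext_gen s :: 'p fp_poly ext)"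
      using that by (simp add: mui_R_def ext_lin_mult frob_map_mui_M ext_const_mult
          ext_const_commute[of "ext_gen s"] mult.assoc)
    also have "dickson_L ?N ?N * dickson_L ?N ?N ^ (CARD('p) - 2) = (dickson_Q ?N 0 :: 'p fp_poly)"
      by (simp add: dickson_Q_0 p flip: power_Suc)
    finally show ?thesis
      by (simp add: frob_map_loc_to_loc to_loc_mult to_loc_const to_loc_gen q)
  qed
  have factor: "frob_map_loc ?N (to_loc (mui_R ?N s) ^ ?\<epsilon> s * ext_const (?q s powi ?i s)) =
      ext_const (?q 0 ^ ?\<epsilon> s * ?q s powi ?i s) * (if ?\<epsilon> s = 1 then ext_gen s else 1)" if "s < ?N" for s
    using adm(2)[of s] that
    by (auto simp: ext_lin_mult R ext_const_mult ext_const_commute[of "ext_gen s"] mult.assoc ext_const_1)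
  have base: "prod_list (map (\<lambda>s. if ?\<epsilon> s = 1 then ext_gen s else 1) [0..<?N]) =
      (ext_base (index_set ?N I) :: 'p fp_poly fract ext)"
  proof -
    have "prod_list (map (\<lambda>s. if ?\<epsilon> s = 1 then ext_gen s else 1) xs) =
        (prod_list (map ext_gen (filter (\<lambda>s. ?\<epsilon> s = 1) xs)) :: 'p fp_poly fract ext)" for xs
      by (induction xs) simp_all
    moreover have "set (filter (\<lambda>s. ?\<epsilon> s = 1) [0..<?N]) = index_set ?N I"
      by (auto simp: index_set_def simp del: upt_Suc)
    ultimately show ?thesis
      by (simp add: prod_list_ext_gen sorted_wrt_filter del: upt_Suc filter.simps)
  qed
  have prod_upt: "prod_list (map g [0..<m]) = (\<Prod>i<m. g i)" for g :: "nat \<Rightarrow> 'p fp_poly fract" and m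
    by (induction m) (simp_all add: mult.commute)
  have "prod_list (map (\<lambda>s. ?q 0 ^ ?\<epsilon> s * ?q s powi ?i s) [0..<?N]) =
      (\<Prod>s<?N. ?q 0 ^ ?\<epsilon> s) * (\<Prod>s<?N. ?q s powi ?i s)"
    unfolding prod_upt prod.distrib ..
  also have "(\<Prod>s<?N. ?q 0 ^ ?\<epsilon> s) = ?q 0 ^ eps_sum I"
    by (simp add: eps_sum_def sum_list_sum_nth adm(1) atLeast0LessThan flip: power_sum del: prod.lessThan_Suc sum.lessThan_Suc)
  also have "(\<Prod>s<?N. ?q s powi ?i s) = ?q 0 powi ?i 0 * (\<Prod>s<n. ?q (Suc s) ^ nat (?i (Suc s)))"
    unfolding prod.lessThan_Suc_shift
    using adm(3) by (simp add: power_int_def)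
  \<comment> \<open>\<open>?i 0\<close> alone may be negative. Since q_{n,0} is invertible among
    fractions, the exponents combine, and their sum is a natural number by admissibility.\<close>
  also have "?q 0 ^ eps_sum I * (?q 0 powi ?i 0 * (\<Prod>s<n. ?q (Suc s) ^ nat (?i (Suc s)))) =
      ?q 0 ^ nat (?i 0 + int (eps_sum I)) * (\<Prod>s<n. ?q (Suc s) ^ nat (?i (Suc s)))"
  proof -
    have "?q 0 ^ nat (?i 0 + int (eps_sum I)) = ?q 0 powi (?i 0 + int (eps_sum I))"
      using adm(5) by (simp add: power_int_def)
    also have "\<dots> = ?q 0 powi ?i 0 * ?q 0 ^ eps_sum I"
      using q0 by (simp add: power_int_add)
    finally show ?thesis by (simp add: mult_ac)
  qed
  also have "\<dots> = (\<Prod>s<?N. ?q s ^ index_exponent ?N I s)"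
    unfolding prod.lessThan_Suc_shift by (simp add: index_exponent_def)
  also have "\<dots> = to_fract (dickson_monomial ?N (index_exponent ?N I))"
    unfolding dickson_monomial_def f.hom_prod by (rule prod.cong) (simp_all add: q f.hom_power)
  finally have coeff: "prod_list (map (\<lambda>s. ?q 0 ^ ?\<epsilon> s * ?q s powi ?i s) [0..<?N]) =
      to_fract (dickson_monomial ?N (index_exponent ?N I))" .
  have "frob_map_loc ?N (q_monomial ?N I) =
      prod_list (map (\<lambda>s. ext_const (?q 0 ^ ?\<epsilon> s * ?q s powi ?i s) * (if ?\<epsilon> s = 1 then ext_gen s else 1)) [0..<?N])"
    unfolding q_monomial_def ext_lin_prod_list map_map
    by (intro arg_cong[of _ _ prod_list] map_cong) (simp_all only: o_def factor set_upt atLeastLessThan_iff)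
  also have "\<dots> = ext_const (to_fract (dickson_monomial ?N (index_exponent ?N I))) * ext_base (index_set ?N I)"
    unfolding prod_list_const_mult coeff base ..
  finally show ?thesis .
qed

text \<open>The index set determines b(I), which is what has to be subtracted from the exponent of
  q_{n,0} to recover i_1.\<close>

lemma admissible_eqI:
  assumes I: "I \<in> admissible n" and J: "J \<in> admissible n" and n: "1 \<le> n"
    and set: "index_set n I = index_set n J" and exp: "index_exponent n I = index_exponent n J"
  shows "I = J"
proof (rule nth_equalityI)
  note adm = admissible_facts[OF I n] admissible_facts[OF J n]
  show "length I = length J" by (simp add: adm)
  fix s assume "s < length I"
  then have s: "s < n" by (simp add: adm)
  have "fst (I ! s) = 1 \<longleftrightarrow> fst (J ! s) = 1"
    using set s by (auto simp: index_set_def)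
  then have "fst (I ! s) = fst (J ! s)"
    using adm(2)[OF s] adm(8)[OF s] by auto
  moreover have "snd (I ! s) = snd (J ! s)"
  proof (cases "s = 0")
    case True
    have "eps_sum I = eps_sum J" using adm(4,10) set by simp
    then show ?thesis
      using fun_cong[OF exp, of 0] adm(5,11) n True by (auto simp: index_exponent_def)
  next
    case False
    then show ?thesis
      using fun_cong[OF exp, of s] adm(3)[of s] adm(9)[of s] s by (auto simp: index_exponent_def)
  qed
  ultimately show "I ! s = J ! s" by (simp add: prod_eq_iff)
qed

lemma admissible_exists:
  assumes S: "S \<subseteq> {..<n}" and n: "1 \<le> n" and a: "\<And>i. n \<le> i \<Longrightarrow> a i = 0" and Sa: "S \<noteq> {} \<Longrightarrow> 1 \<le> a 0"
  obtains I where "I \<in> admissible n" "index_set n I = S" "index_exponent n I = a"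
proof -
  \<comment> \<open>Each Mui factor contributes one q_{n,0}, so \<open>card S\<close> is subtracted
    in advance and i_1 may become negative.\<close>
  let ?I = "map (\<lambda>s. (if s \<in> S then 1 else 0 :: nat, if s = 0 then int (a 0) - int (card S) else int (a s))) [0..<n]"
  have "eps_sum ?I = (\<Sum>s<n. if s \<in> S then 1 else 0)"
    by (simp add: eps_sum_def o_def interv_sum_list_conv_sum_set_nat atLeast0LessThan)
  also have "\<dots> = card S"
    using S by (simp add: sum.If_cases Int_absorb1)
  finally have sum: "eps_sum ?I = card S" .
  have ne: "set (map fst ?I) \<noteq> {}" unfolding set_empty using n by simp
  have max: "int (eps_max ?I) \<le> int (a 0)"
  proof -
    have "x \<le> a 0" if "x \<in> set (map fst ?I)" for x
      using that Sa by (auto split: if_splits)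
    then show ?thesis unfolding eps_max_def using ne by simp
  qed
  have 1: "?I \<in> admissible n"
    using n sum max by (auto simp: admissible_def nth_append)
  have 2: "index_set n ?I = S"
    using S by (auto simp: index_set_def split: if_splits)
  have 3: "index_exponent n ?I = a"
    using n sum a by (auto simp: index_exponent_def fun_eq_iff)
  from 1 2 3 show ?thesis by (rule that)
qed

lemma q_monomial_in_ext_on: "q_monomial (Suc n) I \<in> ext_on (Suc n)"
proof -
  have "mui_R (Suc n) s \<in> ext_on (Suc n)" for s
    unfolding mui_R_def
    by (intro ext_on_mult cohomology_subset_ext_on[OF mui_M_in_cohomology] ext_on_const)
  then show ?thesis
    unfolding q_monomial_def
    by (intro ext_on_prod_list) (auto intro!: ext_on_mult ext_on_power to_loc_ext_on)
qed

lemma to_fract_poly_const_sum: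
  "(\<Sum>x\<in>B. to_fract (poly_const (c x)) * to_fract (f x)) = to_fract (\<Sum>x\<in>B. poly_const (c x) * f x)"
proof -
  interpret f: comm_ring_hom "to_fract :: 'a fp_poly \<Rightarrow> _" by (rule comm_ring_hom_to_fract)
  show ?thesis by (simp add: f.hom_sum f.hom_mult)
qed

section \<open>Linear independence\<close>

text \<open>Stated for families of indices, so that injectivity of \<open>q_monomial\<close> follows
  too. The e_S separate the index sets; for fixed S the exponents are distinct and the Dickson
  monomials are independent.\<close>

lemma q_monomial_family_independent:
  fixes c :: "multi_index \<Rightarrow> 'p::prime_card mod_ring"
  assumes odd: "odd CARD('p)" and T: "finite T" "T \<subseteq> admissible (Suc n)"
    and zero: "(\<Sum>I\<in>T. fp_scale (c I) (q_monomial (Suc n) I)) = 0" and J: "J \<in> T"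
  shows "c J = 0"
proof -
  let ?a = "index_exponent (Suc n)" and ?S = "index_set (Suc n)"
  let ?T = "{I \<in> T. ?S I = ?S J}"
  have fin: "finite (?S I)" for I by (simp add: index_set_def)
  have inj: "inj_on ?a ?T"
    using T by (intro inj_onI) (auto intro!: admissible_eqI[of _ "Suc n"])
  define c' where "c' = c \<circ> the_inv_into ?T ?a"
  have c': "c' (?a I) = c I" if "I \<in> ?T" for I
    using the_inv_into_f_f[OF inj that] by (simp add: c'_def)
  have "0 = frob_map_loc (Suc n) (\<Sum>I\<in>T. fp_scale (c I) (q_monomial (Suc n) I))"
    by (simp add: zero)
  also have "\<dots> = (\<Sum>I\<in>T. fp_scale (c I) (ext_const (to_fract (dickson_monomial (Suc n) (?a I) :: 'p fp_poly)) * ext_base (?S I)))"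
    unfolding ext_lin_sum using T by (intro sum.cong) (auto simp: frob_map_loc_fp_scale frob_map_loc_q_monomial)
  finally have "0 = ecoeff (\<Sum>I\<in>T. fp_scale (c I) (ext_const (to_fract (dickson_monomial (Suc n) (?a I) :: 'p fp_poly)) * ext_base (?S I))) (?S J)"
    by (metis ecoeff_0)
  also have "\<dots> = (\<Sum>I\<in>T. if ?S I = ?S J then to_fract (poly_const (c I)) * to_fract (dickson_monomial (Suc n) (?a I)) else 0)"
    unfolding ecoeff_sum
    by (rule sum.cong) (auto simp: fp_scale_def ecoeff_const_mult ecoeff_base fin)
  also have "\<dots> = (\<Sum>I\<in>?T. to_fract (poly_const (c I)) * to_fract (dickson_monomial (Suc n) (?a I)))"
    using T by (simp add: sum.inter_filter)
  also have "\<dots> = to_fract (\<Sum>I\<in>?T. poly_const (c I) * dickson_monomial (Suc n) (?a I))"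
    by (rule to_fract_poly_const_sum)
  finally have "to_fract (\<Sum>I\<in>?T. poly_const (c I) * dickson_monomial (Suc n) (?a I) :: 'p fp_poly) = 0"
    by (rule sym)
  then have "(\<Sum>I\<in>?T. poly_const (c I) * dickson_monomial (Suc n) (?a I) :: 'p fp_poly) = 0"
    by (rule to_fract_eq_0_iff[THEN iffD1])
  moreover have "(\<Sum>I\<in>?T. poly_const (c I) * dickson_monomial (Suc n) (?a I) :: 'p fp_poly) =
      (\<Sum>b\<in>?a ` ?T. poly_const (c' b) * dickson_monomial (Suc n) b)"
    unfolding sum.reindex[OF inj] o_def by (rule sum.cong) (simp_all add: c')
  ultimately have "(\<Sum>b\<in>?a ` ?T. poly_const (c' b) * dickson_monomial (Suc n) b :: 'p fp_poly) = 0"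
    by simp
  then have "\<forall>b\<in>?a ` ?T. c' b = 0"
    using T by (intro dickson_monomials_independent[OF odd]) (auto simp: index_exponent_def)
  then show ?thesis using c'[of J] J by auto
qed

section \<open>Spanning of the invariants\<close>

text \<open>An invariant with the same image exists, as admissibility yields the factor q_{n,0} for
  a nonempty index set. By injectivity it equals q^I, which therefore lies in the unlocalized
  ring.\<close>

lemma q_monomial_in_invariants:
  assumes odd: "odd CARD('p::prime_card)" and I: "I \<in> admissible (Suc n)"
  shows "(q_monomial (Suc n) I :: 'p fp_poly fract ext) \<in> to_loc ` invariants (Suc n)"
proof -
  let ?a = "index_exponent (Suc n) I" and ?S = "index_set (Suc n) I"
  let ?f = "dickson_monomial (Suc n) ?a :: 'p fp_poly"
  have S: "?S \<subseteq> {..<Suc n}" by (auto simp: index_set_def)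
  have "dickson_Q (Suc n) 0 dvd ?f" if "?S \<noteq> {}"
  proof -
    have "1 \<le> ?a 0"
      using admissible_facts(6)[OF I _ that] by (simp add: index_exponent_def)
    then have "dickson_Q (Suc n) 0 dvd (dickson_Q (Suc n) 0 ^ ?a 0 :: 'p fp_poly)"
      by (intro dvd_power) simp
    then show ?thesis
      by (simp add: dickson_monomial_def prod.lessThan_Suc_shift del: prod.lessThan_Suc)
  qed
  then obtain h where h: "h \<in> invariants (Suc n)" "frob_map (Suc n) h = ext_const ?f * ext_base ?S"
    using invariant_with_frob_map[OF odd S dickson_monomial_in_poly_invariants] by blast
  have q: "to_loc h = q_monomial (Suc n) I"
  proof (rule frob_map_fract_injective)
    show "to_loc h \<in> ext_on (Suc n)"
      using h(1) by (auto simp: invariants_def intro: to_loc_ext_on cohomology_subset_ext_on)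
    show "frob_map_loc (Suc n) (to_loc h) = frob_map_loc (Suc n) (q_monomial (Suc n) I)"
      by (simp add: frob_map_loc_to_loc h(2) frob_map_loc_q_monomial[OF I] to_loc_mult to_loc_const to_loc_base)
  qed (rule q_monomial_in_ext_on)
  show ?thesis unfolding q[symmetric] using h(1) by (rule imageI)
qed

lemma subspace_invariants: "Fp.subspace (to_loc ` invariants n)"
proof (rule Fp.subspaceI)
  show "0 \<in> to_loc ` invariants n"
    using to_loc_0 by (auto simp: invariants_def cohomology_0 act_0 intro!: image_eqI[of _ _ 0])
next
  fix x y :: "'a fp_poly fract ext"
  assume "x \<in> to_loc ` invariants n" "y \<in> to_loc ` invariants n"
  then show "x + y \<in> to_loc ` invariants n"
    by (auto simp: invariants_def cohomology_add act_add simp flip: to_loc_add intro!: imageI)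
next
  fix c :: "'a mod_ring" and x :: "'a fp_poly fract ext"
  assume "x \<in> to_loc ` invariants n"
  then obtain h where h: "x = to_loc h" "h \<in> invariants n" by blast
  have "act_poly n A (poly_const c) = poly_const c" for A :: "'a mod_ring mat"
    by (simp add: act_poly_eq_psubst comm_ring_hom_poly_const)
  then have "ext_const (poly_const c) * h \<in> invariants n"
    using h(2) by (auto simp: invariants_def act_mult act_const intro!: cohomology_mult cohomology_const)
  moreover have "fp_scale c x = to_loc (ext_const (poly_const c) * h)"
    by (simp add: h(1) fp_scale_def to_loc_mult to_loc_const)
  ultimately show "fp_scale c x \<in> to_loc ` invariants n" by blast
qed

lemma dickson_monomial_in_span_q_monomials:
  fixes g :: "'p::prime_card fp_poly"
  assumes S: "S \<subseteq> {..<Suc n}"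
  shows "dickson_span (Suc n) d g \<Longrightarrow>
    \<exists>u\<in>Fp.span (q_monomial (Suc n) ` admissible (Suc n)). frob_map_loc (Suc n) u =
      ext_const (to_fract (if S = {} then g else dickson_Q (Suc n) 0 * g)) * ext_base S"
proof (induction rule: dickson_span.induct)
  case (monomial a d)
  \<comment> \<open>For nonempty S the factor q_{n,0} raises its exponent to at least 1, as an
    admissible index with that set demands. Exponents from \<open>Suc n\<close> on are
    cleared.\<close>
  let ?b = "\<lambda>i. if Suc n \<le> i then 0 else if i = 0 \<and> S \<noteq> {} then Suc (a 0) else a i"
  obtain I where I: "I \<in> admissible (Suc n)" "index_set (Suc n) I = S" "index_exponent (Suc n) I = ?b"
    using admissible_exists[OF S, of ?b] by auto
  have "dickson_monomial (Suc n) ?b =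
      (if S = {} then dickson_monomial (Suc n) a else dickson_Q (Suc n) 0 * dickson_monomial (Suc n) a :: 'p fp_poly)"
    by (simp add: dickson_monomial_def prod.lessThan_Suc_shift mult.assoc del: prod.lessThan_Suc)
  then show ?case
    using frob_map_loc_q_monomial[OF I(1), where 'p='p] I
    by (intro bexI[of _ "q_monomial (Suc n) I"]) (auto intro: Fp.span_base)
next
  case (add d f g)
  then obtain u v where "u \<in> Fp.span (q_monomial (Suc n) ` admissible (Suc n))"
    "v \<in> Fp.span (q_monomial (Suc n) ` admissible (Suc n))"
    "frob_map_loc (Suc n) u = ext_const (to_fract (if S = {} then f else dickson_Q (Suc n) 0 * f)) * ext_base S"
    "frob_map_loc (Suc n) v = ext_const (to_fract (if S = {} then g else dickson_Q (Suc n) 0 * g)) * ext_base S"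
    by blast
  then show ?case
    by (intro bexI[of _ "u + v"])
      (auto simp: ext_lin_add distrib_left ext_const_add distrib_right intro: Fp.span_add)
next
  case (const_mult d f c)
  then obtain u where "u \<in> Fp.span (q_monomial (Suc n) ` admissible (Suc n))"
    "frob_map_loc (Suc n) u = ext_const (to_fract (if S = {} then f else dickson_Q (Suc n) 0 * f)) * ext_base S"
    by blast
  note u = this
  have "(if S = {} then poly_const c * f else dickson_Q (Suc n) 0 * (poly_const c * f)) =
      poly_const c * (if S = {} then f else dickson_Q (Suc n) 0 * f)"
    by (simp add: mult.left_commute)
  then have "frob_map_loc (Suc n) (fp_scale c u) = ext_const (to_fract
      (if S = {} then poly_const c * f else dickson_Q (Suc n) 0 * (poly_const c * f))) * ext_base S"
    unfolding frob_map_loc_fp_scale u(2)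
    by (simp only: fp_scale_def to_fract_mult ext_const_mult mult.assoc)
  then show ?case using Fp.span_scale[OF u(1)] by (rule bexI)
qed

lemma invariants_in_span_q_monomials:
  fixes h :: "'p::prime_card fp_poly ext"
  assumes odd: "odd CARD('p)" and h: "h \<in> invariants (Suc n)"
  shows "to_loc h \<in> Fp.span (q_monomial (Suc n) ` admissible (Suc n))"
proof -
  let ?span = "Fp.span (q_monomial (Suc n) ` admissible (Suc n)) :: 'p fp_poly fract ext set"
  let ?b = "ecoeff (frob_map (Suc n) h)"
  have "\<exists>u\<in>?span. frob_map_loc (Suc n) u = ext_const (to_fract (?b S)) * ext_base S" if S: "S \<subseteq> {..<Suc n}" for S
  proof (cases "S = {}")
    case True
    then show ?thesis
      using dickson_monomial_in_span_q_monomials[OF S dickson_invariants[OF odd frob_map_invariant_coeff[OF h, of S]]]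
      by (simp only: True simp_thms if_True)
  next
    case False
    obtain r where r: "?b S = dickson_Q (Suc n) 0 * r"
      using frob_map_invariant_dvd[OF h False] by blast
    have "r \<in> poly_invariants (Suc n)"
      by (rule poly_invariants_factor[of "dickson_Q (Suc n) 0"])
        (use frob_map_invariant_coeff[OF h, of S] r dickson_Q_0_nonzero in \<open>auto intro: dickson_Q_in_poly_invariants\<close>)
    from dickson_monomial_in_span_q_monomials[OF S dickson_invariants[OF odd this]] show ?thesis
      unfolding r by (simp only: False if_False)
  qed
  then obtain u where u: "\<And>S. S \<subseteq> {..<Suc n} \<Longrightarrow> u S \<in> ?span"
    "\<And>S. S \<subseteq> {..<Suc n} \<Longrightarrow> frob_map_loc (Suc n) (u S) = ext_const (to_fract (?b S)) * ext_base S"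
    by metis
  let ?u = "\<Sum>S\<in>Pow {..<Suc n}. u S"
  have u_span: "?u \<in> ?span" by (intro Fp.span_sum) (use u in auto)
  \<comment> \<open>Injectivity is available on \<open>ext_on\<close> only; \<open>?u\<close> lies
    there because the span consists of invariants.\<close>
  have "?span \<subseteq> to_loc ` invariants (Suc n)"
    by (rule Fp.span_minimal[OF _ subspace_invariants]) (use q_monomial_in_invariants[OF odd] in auto)
  then obtain g where "?u = to_loc g" and g: "g \<in> invariants (Suc n)" using u_span by blast
  moreover have "g \<in> ext_on (Suc n)"
    using g unfolding invariants_def by (intro cohomology_subset_ext_on) blast
  ultimately have u_on: "?u \<in> ext_on (Suc n)"
    using to_loc_ext_on by metis
  have hc: "h \<in> cohomology (Suc n)" using h by (simp add: invariants_def)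
  have "{S. ecoeff (to_loc (frob_map (Suc n) h)) S \<noteq> 0} \<subseteq> Pow {..<Suc n}"
    using frob_map_in_cohomology[OF hc] by (auto simp: to_loc.rep_eq cohomology_alt ext_on_def)
  then have "to_loc (frob_map (Suc n) h) =
      (\<Sum>S\<in>Pow {..<Suc n}. ext_const (ecoeff (to_loc (frob_map (Suc n) h)) S) * ext_base S)"
    by (intro ext_sum_base) auto
  also have "\<dots> = frob_map_loc (Suc n) ?u"
    unfolding ext_lin_sum by (rule sum.cong) (auto simp: u to_loc.rep_eq)
  finally have "frob_map_loc (Suc n) (to_loc h) = frob_map_loc (Suc n) ?u"
    by (simp add: frob_map_loc_to_loc)
  then have "to_loc h = ?u"
    by (rule frob_map_fract_injective[rotated 2]) (intro to_loc_ext_on cohomology_subset_ext_on hc u_on)+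
  then show ?thesis using u_span by simp
qed

theorem proposition3p3:
  fixes n :: nat
  assumes "odd CARD('p::prime_card)" and "n \<ge> 1"
  shows "inj_on (q_monomial n :: multi_index \<Rightarrow> 'p fp_poly fract ext) (admissible n) \<and>
    Fp.independent (q_monomial n ` admissible n :: 'p fp_poly fract ext set) \<and>
    Fp.span (q_monomial n ` admissible n :: 'p fp_poly fract ext set) = to_loc ` invariants n"
proof -
  obtain k where n: "n = Suc k" using assms(2) by (cases n) auto
  let ?q = "q_monomial n :: multi_index \<Rightarrow> 'p fp_poly fract ext"
  note indep = q_monomial_family_independent[OF assms(1), of _ k, folded n]
  have inj: "inj_on ?q (admissible n)"
  proof (rule inj_onI, rule ccontr)
    fix I J assume IJ: "I \<in> admissible n" "J \<in> admissible n" "?q I = ?q J" "I \<noteq> J"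
    let ?c = "\<lambda>K. if K = I then 1 else -1 :: 'p mod_ring"
    have "(\<Sum>K\<in>{I, J}. fp_scale (?c K) (?q K)) = 0"
      using IJ by simp
    then have "?c I = 0"
      using IJ by (intro indep[of "{I, J}" ?c I]) auto
    then show False by simp
  qed
  have "Fp.independent (?q ` admissible n)"
    unfolding Fp.dependent_explicit
  proof (clarify)
    fix T u v
    assume T: "finite T" "T \<subseteq> ?q ` admissible n" and zero: "(\<Sum>v\<in>T. fp_scale (u v) v) = 0"
      and v: "v \<in> T" "u v \<noteq> 0"
    obtain B where B: "B \<subseteq> admissible n" "finite B" "T = ?q ` B"
      using finite_subset_image[OF T] by blast
    have "(\<Sum>v\<in>T. fp_scale (u v) v) = (\<Sum>I\<in>B. fp_scale (u (?q I)) (?q I))"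
      unfolding B(3) sum.reindex[OF inj_on_subset[OF inj B(1)]] o_def ..
    then have B0: "(\<Sum>I\<in>B. fp_scale (u (?q I)) (?q I)) = 0"
      using zero by (rule trans[OF sym])
    obtain J where J: "J \<in> B" "v = ?q J" using v B by blast
    have "u (?q J) = 0"
      by (rule indep[OF B(2,1) B0 J(1)])
    then show False using v(2) J(2) by blast
  qed
  moreover have "Fp.span (?q ` admissible n) = to_loc ` invariants n"
  proof
    show "Fp.span (?q ` admissible n) \<subseteq> to_loc ` invariants n"
      by (rule Fp.span_minimal[OF _ subspace_invariants])
        (use q_monomial_in_invariants[OF assms(1)] n in auto)
    show "to_loc ` invariants n \<subseteq> Fp.span (?q ` admissible n)"
      using invariants_in_span_q_monomials[OF assms(1)] n by auto
  qed
  ultimately show ?thesis using inj by blast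
qed

end
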